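(* Let $(N^n,h)$ be a compact $\Phi_{(3)}$-superstrongly unstable ($\Phi_{(3)}$-SSU) manifold and $(M^m,g)$ any compact Riemannian manifold. Then every stable $\Phi_{(3)}$-harmonic map $u:(M^m,g)\to(N^n,h)$ is constant.
   Context: A Riemannian manifold $N^n$ is $\Phi_{(3)}$-SSU if there is an isometric immersion of $N$ in some $\mathbb R^q$ with second fundamental form $B$ such that for every $y\in N$ and every unit tangent vector $v\in T_yN$, $$\sum_{i=1}^n\big(6\langle B(v,\epsilon_i),B(v,\epsilon_i)\rangle-\langle B(v,v),B(\epsilon_i,\epsilon_i)\rangle\big)<0,$$ where $\{\epsilon_1,\dots,\epsilon_n\}$ is a local orthonormal frame near $y$. For a smooth map $u:(M,g)\to(N,h)$ and a local orthonormal frame $\{e_i\}$ on $M$ set $\|d_{(3)}u\|^2=\sum_{i,j,k}h(du(e_i),du(e_j))h(du(e_j),du(e_k))h(du(e_k),du(e_i))$ and $E_{\Phi_{(3)}}(u)=\int_M\frac{\|d_{(3)}u\|^2}{6}dv_g$. A smooth map is $\Phi_{(3)}$-harmonic if it is a critical point of $E_{\Phi_{(3)}}$ with respect to every smooth compactly supported variation. A $\Phi_{(3)}$-harmonic map $u$ is stable if $I(V,V)=\frac{d^2}{dt^2}E_{\Phi_{(3)}}(u_t)\big|_{t=0}\ge0$ for every compactly supported vector field $V$ along $u$, where $u_t$ is any smooth variation with $u_0=u$ and variation field $V$. Manifolds are smooth, connected and without boundary. *)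

theory Defs
  imports "HOL-Analysis.Analysis"
begin

section \<open>Smooth functions between Euclidean spaces\<close>

text \<open>\<open>Ck_on k S f\<close>, for open \<open>S\<close>: all iterated directional derivatives of \<open>f\<close> up to order \<open>k\<close>
  exist (as Frechet derivatives) and are continuous on \<open>S\<close>.\<close>

primrec Ck_on :: "nat \<Rightarrow> 'a::euclidean_space set \<Rightarrow> ('a \<Rightarrow> 'b::real_normed_vector) \<Rightarrow> bool" where
  "Ck_on 0 S f \<longleftrightarrow> continuous_on S f"
| "Ck_on (Suc k) S f \<longleftrightarrow>
     (\<forall>x\<in>S. f differentiable (at x)) \<and> (\<forall>v. Ck_on k S (\<lambda>x. frechet_derivative f (at x) v))"

definition smooth_on :: "'a::euclidean_space set \<Rightarrow> ('a \<Rightarrow> 'b::real_normed_vector) \<Rightarrow> bool" where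
  "smooth_on S f \<longleftrightarrow> (\<forall>k. Ck_on k S f)"


section \<open>Smooth Riemannian manifolds\<close>

text \<open>The underlying space of a manifold is a whole type \<open>'a\<close>, Hausdorff and second countable by
  its class constraints; the dimension is \<open>CARD('m)\<close>. A chart is a pair of a domain and a
  coordinate map. Tangent vectors at \<open>p\<close> are handled through their components in the charts
  around \<open>p\<close>, which change by the Jacobian of the change of coordinates, and the
  metric is given by its Gram matrix \<open>gram M c p\<close> at \<open>p\<close> in each chart \<open>c\<close>.\<close>

type_synonym ('a, 'm) chart = "'a set \<times> ('a \<Rightarrow> real ^ 'm)"

record ('a, 'm::finite) mfd =
  charts :: "('a, 'm) chart set"
  gram :: "('a, 'm) chart \<Rightarrow> 'a \<Rightarrow> real ^ 'm ^ 'm"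

abbreviation dom_chart :: "('a, 'm::finite) chart \<Rightarrow> 'a set" where
  "dom_chart c \<equiv> fst c"

abbreviation coord :: "('a, 'm::finite) chart \<Rightarrow> 'a \<Rightarrow> real ^ 'm" where
  "coord c \<equiv> snd c"

definition codom_chart :: "('a, 'm::finite) chart \<Rightarrow> (real ^ 'm) set" where
  "codom_chart c = coord c ` dom_chart c"

definition inv_coord :: "('a, 'm::finite) chart \<Rightarrow> real ^ 'm \<Rightarrow> 'a" where
  "inv_coord c = inv_into (dom_chart c) (coord c)"

definition smooth_atlas ::
  "('a::{t2_space, second_countable_topology}, 'm::finite) chart set \<Rightarrow> bool" where
  "smooth_atlas A \<longleftrightarrow>
     (\<forall>c\<in>A. open (dom_chart c) \<and> open (codom_chart c) \<and>
        homeomorphism (dom_chart c) (codom_chart c) (coord c) (inv_coord c)) \<and>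
     (\<Union>c\<in>A. dom_chart c) = UNIV \<and>
     (\<forall>c\<in>A. \<forall>d\<in>A.
        smooth_on (coord c ` (dom_chart c \<inter> dom_chart d)) (coord d \<circ> inv_coord c))"

definition smooth_map ::
  "('a::{t2_space, second_countable_topology}, 'm::finite) mfd \<Rightarrow>
   ('b::{t2_space, second_countable_topology}, 'n::finite) mfd \<Rightarrow> ('a \<Rightarrow> 'b) \<Rightarrow> bool" where
  "smooth_map M N u \<longleftrightarrow> continuous_on UNIV u \<and>
     (\<forall>c\<in>charts M. \<forall>d\<in>charts N.
        smooth_on (coord c ` (dom_chart c \<inter> u -` dom_chart d)) (coord d \<circ> u \<circ> inv_coord c))"

text \<open>The differential of \<open>u\<close> at \<open>p\<close> on components with respect to charts \<open>c\<close> around \<open>p\<close> and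
  \<open>d\<close> around \<open>u p\<close>; with \<open>u = id\<close> it is the change of components of tangent vectors from \<open>c\<close> to \<open>d\<close>.\<close>

definition differential ::
  "('a, 'm::finite) chart \<Rightarrow> ('b, 'n::finite) chart \<Rightarrow> ('a \<Rightarrow> 'b) \<Rightarrow> 'a \<Rightarrow> real ^ 'm \<Rightarrow> real ^ 'n" where
  "differential c d u p = frechet_derivative (coord d \<circ> u \<circ> inv_coord c) (at (coord c p))"

definition metric ::
  "('a, 'm::finite) mfd \<Rightarrow> ('a, 'm) chart \<Rightarrow> 'a \<Rightarrow> real ^ 'm \<Rightarrow> real ^ 'm \<Rightarrow> real" where
  "metric M c p v w = v \<bullet> (gram M c p *v w)"

definition riemannian_manifold ::
  "('a::{t2_space, second_countable_topology}, 'm::finite) mfd \<Rightarrow> bool" where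
  "riemannian_manifold M \<longleftrightarrow>
     smooth_atlas (charts M) \<and> connected (UNIV :: 'a set) \<and>
     (\<forall>c\<in>charts M. smooth_on (codom_chart c) (gram M c \<circ> inv_coord c)) \<and>
     (\<forall>c\<in>charts M. \<forall>p\<in>dom_chart c.
        (\<forall>v w. metric M c p v w = metric M c p w v) \<and>
        (\<forall>v. v \<noteq> 0 \<longrightarrow> metric M c p v v > 0)) \<and>
     (\<forall>c\<in>charts M. \<forall>d\<in>charts M. \<forall>p\<in>dom_chart c \<inter> dom_chart d. \<forall>v w.
        metric M d p (differential c d id p v) (differential c d id p w) = metric M c p v w)"

definition orthonormal_frame ::
  "('a, 'm::finite) mfd \<Rightarrow> ('a, 'm) chart \<Rightarrow> 'a \<Rightarrow> ('m \<Rightarrow> real ^ 'm) \<Rightarrow> bool" where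
  "orthonormal_frame M c p e \<longleftrightarrow> (\<forall>i j. metric M c p (e i) (e j) = (if i = j then 1 else 0))"

text \<open>The Riemannian measure \<open>dv\<close>: the Borel measure with density \<open>sqrt (det g)\<close> with respect to
  Lebesgue measure in every chart.\<close>

definition is_volume_measure ::
  "('a::{t2_space, second_countable_topology}, 'm::finite) mfd \<Rightarrow> 'a measure \<Rightarrow> bool" where
  "is_volume_measure M \<mu> \<longleftrightarrow> sets \<mu> = sets borel \<and>
     (\<forall>c\<in>charts M. \<forall>B\<in>sets borel. B \<subseteq> dom_chart c \<longrightarrow>
        emeasure \<mu> B =
          (\<integral>\<^sup>+x\<in>coord c ` B. ennreal (sqrt (det (gram M c (inv_coord c x)))) \<partial>lborel))"

definition volume_measure ::
  "('a::{t2_space, second_countable_topology}, 'm::finite) mfd \<Rightarrow> 'a measure" where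
  "volume_measure M = (THE \<mu>. is_volume_measure M \<mu>)"


section \<open>Isometric immersions and the superstrong instability condition\<close>

definition differential_euclidean ::
  "('a, 'm::finite) chart \<Rightarrow> ('a \<Rightarrow> real ^ 'q) \<Rightarrow> 'a \<Rightarrow> real ^ 'm \<Rightarrow> real ^ ('q::finite)" where
  "differential_euclidean c F p = frechet_derivative (F \<circ> inv_coord c) (at (coord c p))"

definition isometric_immersion ::
  "('a::{t2_space, second_countable_topology}, 'm::finite) mfd \<Rightarrow> ('a \<Rightarrow> real ^ ('q::finite)) \<Rightarrow> bool" where
  "isometric_immersion M F \<longleftrightarrow>
     (\<forall>c\<in>charts M. smooth_on (codom_chart c) (F \<circ> inv_coord c)) \<and>
     (\<forall>c\<in>charts M. \<forall>p\<in>dom_chart c.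
        inj (differential_euclidean c F p) \<and>
        (\<forall>v w. differential_euclidean c F p v \<bullet> differential_euclidean c F p w = metric M c p v w))"

text \<open>\<open>B(v,w)\<close> is the normal component of the derivative in direction \<open>v\<close> of the vector field
  \<open>dF(W)\<close>, where \<open>W\<close> is a local extension of \<open>w\<close>; here \<open>W\<close> has constant components in the chart \<open>c\<close>.\<close>

definition second_fundamental_form ::
  "('a, 'm::finite) chart \<Rightarrow> ('a \<Rightarrow> real ^ ('q::finite)) \<Rightarrow> 'a \<Rightarrow> real ^ 'm \<Rightarrow> real ^ 'm \<Rightarrow> real ^ 'q" where
  "second_fundamental_form c F p v w =
     (THE b. b \<in> orthogonal_comp (range (differential_euclidean c F p)) \<and>
        frechet_derivative (\<lambda>x. differential_euclidean c F (inv_coord c x) w) (at (coord c p)) v - b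
          \<in> range (differential_euclidean c F p))"

text \<open>The dimension \<open>q = CARD('q)\<close> of the ambient Euclidean space is a type, so that
  ``for some \<open>q\<close>'' is expressed by assuming \<open>phi3_SSU TYPE('q) N\<close> for an arbitrary type \<open>'q\<close>.\<close>

definition phi3_SSU ::
  "'q::finite itself \<Rightarrow> ('b::{t2_space, second_countable_topology}, 'n::finite) mfd \<Rightarrow> bool" where
  "phi3_SSU _ N \<longleftrightarrow>
     (\<exists>F :: 'b \<Rightarrow> real ^ 'q. isometric_immersion N F \<and>
        (\<forall>c\<in>charts N. \<forall>y\<in>dom_chart c. \<forall>v e.
           metric N c y v v = 1 \<and> orthonormal_frame N c y e \<longrightarrow>
           (let B = second_fundamental_form c F y in
             (\<Sum>i\<in>UNIV. 6 * (B v (e i) \<bullet> B v (e i)) - B v v \<bullet> B (e i) (e i)) < 0)))"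


section \<open>The energy functional and its critical points\<close>

text \<open>The value does not depend on the charts nor on the orthonormal frame used.\<close>

definition d3_norm_sq ::
  "('a::{t2_space, second_countable_topology}, 'm::finite) mfd \<Rightarrow>
   ('b::{t2_space, second_countable_topology}, 'n::finite) mfd \<Rightarrow> ('a \<Rightarrow> 'b) \<Rightarrow> 'a \<Rightarrow> real" where
  "d3_norm_sq M N u p =
     (SOME s. \<exists>c\<in>charts M. \<exists>d\<in>charts N. \<exists>e.
        p \<in> dom_chart c \<and> u p \<in> dom_chart d \<and> orthonormal_frame M c p e \<and>
        s = (let du = differential c d u p; h = metric N d (u p) in
              (\<Sum>i\<in>UNIV. \<Sum>j\<in>UNIV. \<Sum>k\<in>UNIV.
                 h (du (e i)) (du (e j)) * h (du (e j)) (du (e k)) * h (du (e k)) (du (e i)))))"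

definition phi3_energy ::
  "('a::{t2_space, second_countable_topology}, 'm::finite) mfd \<Rightarrow>
   ('b::{t2_space, second_countable_topology}, 'n::finite) mfd \<Rightarrow> ('a \<Rightarrow> 'b) \<Rightarrow> real" where
  "phi3_energy M N u = (\<integral>p. d3_norm_sq M N u p / 6 \<partial>volume_measure M)"

text \<open>\<open>U t\<close>, for \<open>t\<close> in an interval around \<open>0\<close>, is a smooth variation of \<open>u\<close> fixed outside a compact
  set; smoothness is joint in \<open>t\<close> and the point. Values of \<open>U\<close> outside the interval are irrelevant.\<close>

definition smooth_variation ::
  "('a::{t2_space, second_countable_topology}, 'm::finite) mfd \<Rightarrow>
   ('b::{t2_space, second_countable_topology}, 'n::finite) mfd \<Rightarrow> ('a \<Rightarrow> 'b) \<Rightarrow>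
   (real \<Rightarrow> 'a \<Rightarrow> 'b) \<Rightarrow> bool" where
  "smooth_variation M N u U \<longleftrightarrow> U 0 = u \<and>
     (\<exists>\<epsilon>>0.
        continuous_on ({-\<epsilon><..<\<epsilon>} \<times> UNIV) (\<lambda>(t, p). U t p) \<and>
        (\<forall>c\<in>charts M. \<forall>d\<in>charts N.
           smooth_on {(t, x). t \<in> {-\<epsilon><..<\<epsilon>} \<and> x \<in> codom_chart c \<and> U t (inv_coord c x) \<in> dom_chart d}
             (\<lambda>(t, x). coord d (U t (inv_coord c x)))) \<and>
        (\<exists>K. compact K \<and> (\<forall>t\<in>{-\<epsilon><..<\<epsilon>}. \<forall>p. p \<notin> K \<longrightarrow> U t p = u p)))"

definition phi3_harmonic ::
  "('a::{t2_space, second_countable_topology}, 'm::finite) mfd \<Rightarrow>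
   ('b::{t2_space, second_countable_topology}, 'n::finite) mfd \<Rightarrow> ('a \<Rightarrow> 'b) \<Rightarrow> bool" where
  "phi3_harmonic M N u \<longleftrightarrow> smooth_map M N u \<and>
     (\<forall>U. smooth_variation M N u U \<longrightarrow>
        ((\<lambda>t. phi3_energy M N (U t)) has_real_derivative 0) (at 0))"

text \<open>A vector field along \<open>u\<close> is given by its components \<open>V d p\<close> in each chart \<open>d\<close> around \<open>u p\<close>.\<close>

definition compact_vector_field_along ::
  "('a::{t2_space, second_countable_topology}, 'm::finite) mfd \<Rightarrow>
   ('b::{t2_space, second_countable_topology}, 'n::finite) mfd \<Rightarrow> ('a \<Rightarrow> 'b) \<Rightarrow>
   (('b, 'n) chart \<Rightarrow> 'a \<Rightarrow> real ^ 'n) \<Rightarrow> bool" where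
  "compact_vector_field_along M N u V \<longleftrightarrow>
     (\<forall>d\<in>charts N. \<forall>d'\<in>charts N. \<forall>p. u p \<in> dom_chart d \<inter> dom_chart d' \<longrightarrow>
        V d' p = differential d d' id (u p) (V d p)) \<and>
     (\<forall>c\<in>charts M. \<forall>d\<in>charts N.
        smooth_on (coord c ` (dom_chart c \<inter> u -` dom_chart d)) (V d \<circ> inv_coord c)) \<and>
     (\<exists>K. compact K \<and> (\<forall>d\<in>charts N. \<forall>p. u p \<in> dom_chart d \<and> p \<notin> K \<longrightarrow> V d p = 0))"

definition has_variation_field ::
  "('b::{t2_space, second_countable_topology}, 'n::finite) mfd \<Rightarrow> (real \<Rightarrow> 'a \<Rightarrow> 'b) \<Rightarrow>
   (('b, 'n) chart \<Rightarrow> 'a \<Rightarrow> real ^ 'n) \<Rightarrow> bool" where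
  "has_variation_field N U V \<longleftrightarrow>
     (\<forall>d\<in>charts N. \<forall>p. U 0 p \<in> dom_chart d \<longrightarrow>
        ((\<lambda>t. coord d (U t p)) has_vector_derivative V d p) (at 0))"

definition stable_phi3_harmonic ::
  "('a::{t2_space, second_countable_topology}, 'm::finite) mfd \<Rightarrow>
   ('b::{t2_space, second_countable_topology}, 'n::finite) mfd \<Rightarrow> ('a \<Rightarrow> 'b) \<Rightarrow> bool" where
  "stable_phi3_harmonic M N u \<longleftrightarrow> phi3_harmonic M N u \<and>
     (\<forall>V U. compact_vector_field_along M N u V \<and> smooth_variation M N u U \<and>
        has_variation_field N U V \<longrightarrow>
        deriv (deriv (\<lambda>t. phi3_energy M N (U t))) 0 \<ge> 0)"

end

theory Submission
  imports Defs
begin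

text \<open>
  The target is viewed inside \<open>\<real>\<^sup>q\<close> through its immersion \<open>F\<close>. Each vector \<open>E\<close> of the standard basis
  of \<open>\<real>\<^sup>q\<close> has a tangential projection \<open>X\<^sub>E\<close>, a vector field on \<open>N\<close>, and the map \<open>u\<close> is moved along
  the fields \<open>X\<^sub>E\<close>. No single second variation need be negative, but their sum over \<open>E\<close> is, unless
  \<open>du = 0\<close>.

  To see this, let \<open>\<phi>\<^sub>t\<close> be a family of maps of \<open>N\<close> with velocity \<open>X\<^sub>E\<close> at \<open>t = 0\<close>. The energy density
  of \<open>\<phi>\<^sub>t \<circ> u\<close> is the sum of \<open>G\<^sub>i\<^sub>j G\<^sub>j\<^sub>k G\<^sub>k\<^sub>i\<close>, where \<open>G\<close> is the Gram matrix of the derivatives of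
  \<open>F \<circ> \<phi>\<^sub>t \<circ> u\<close> in an orthonormal frame \<open>e\<^sub>i\<close> of \<open>M\<close>. The frame is chosen such that \<open>G\<close> is diagonal at
  \<open>t = 0\<close>, with entries \<open>s\<^sub>i\<close>. With \<open>a\<^sub>i = du(e\<^sub>i)\<close>, an orthonormal frame \<open>f\<^sub>k\<close> of \<open>N\<close>, the second
  fundamental form \<open>B\<close> and \<open>H = \<Sum>\<^sub>k B(f\<^sub>k, f\<^sub>k)\<close>, the second derivatives of the density, summed over
  \<open>E\<close>, amount, up to a term that is the subject of the next paragraph, to six times
  \<open>Q = \<Sum>\<^sub>i s\<^sub>i\<^sup>2 (2 \<Sum>\<^sub>k |B(a\<^sub>i, f\<^sub>k)|\<^sup>2 - \<langle>H, B(a\<^sub>i, a\<^sub>i)\<rangle>) + 4 \<Sum>\<^sub>i\<^sub>j s\<^sub>i |B(a\<^sub>i, a\<^sub>j)|\<^sup>2\<close>.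
  Write \<open>a\<^sub>i = \<surd>s\<^sub>i c\<^sub>i\<close>. The inequality \<open>s\<^sub>i\<^sup>2 s\<^sub>j + s\<^sub>j\<^sup>2 s\<^sub>i \<le> s\<^sub>i\<^sup>3 + s\<^sub>j\<^sup>3\<close> and Bessel's inequality for the
  \<open>c\<^sub>j\<close> bound the last sum by \<open>4 \<Sum>\<^sub>i s\<^sub>i\<^sup>3 \<Sum>\<^sub>k |B(c\<^sub>i, f\<^sub>k)|\<^sup>2\<close>, so that \<open>Q\<close> is at most
  \<open>\<Sum>\<^sub>i s\<^sub>i\<^sup>3 (6 \<Sum>\<^sub>k |B(c\<^sub>i, f\<^sub>k)|\<^sup>2 - \<langle>H, B(c\<^sub>i, c\<^sub>i)\<rangle>)\<close>, and every summand with \<open>s\<^sub>i > 0\<close> is negative because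
  \<open>N\<close> is superstrongly unstable (\<open>averaged_second_variation_negative\<close>).

  The second derivative also involves the acceleration of \<open>F \<circ> \<phi>\<^sub>t\<close>. Its normal part is
  \<open>B(X\<^sub>E, X\<^sub>E)\<close>. Its tangential part \<open>T\<close> depends on the choice of \<open>\<phi>\<close>, but it enters only
  through the first variation of the energy along \<open>T\<close>, which vanishes because \<open>u\<close> is critical. Hence
  every family with velocity \<open>X\<^sub>E\<close> serves, and such a family is a composition of finitely many moves
  \<open>x \<mapsto> x + t w(x)\<close> in charts, where the fields \<open>w\<close> come from a partition of unity
  (\<open>ex_family_with_velocity\<close>).

  Two analytic facts turn the pointwise inequality into a statement about energies. The Riemannian
  measure exists and is unique, is finite on the compact \<open>M\<close> and positive on nonempty open sets
  (\<open>volume_measure_is_volume_measure\<close>, \<open>volume_measure_finite_positive\<close>). And the energy may be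
  differentiated under the integral sign, because the density, being the trace of the cube of
  \<open>g\<inverse> u\<^sub>t\<^sup>*h\<close>, is smooth jointly in time and point (\<open>smooth_evolution_energy_density\<close>,
  \<open>integral_has_time_derivative\<close>). Stability then makes the integral of \<open>Q\<close> nonnegative, while
  \<open>Q \<le> 0\<close> everywhere and \<open>Q < 0\<close> wherever \<open>du \<noteq> 0\<close>. So \<open>du = 0\<close>, and \<open>u\<close> is constant on the
  connected manifold \<open>M\<close>.
\<close>

section \<open>Calculus of smooth functions\<close>

lemma frechet_derivative_cong_open:
  assumes "open S" "x \<in> S" "\<And>y. y \<in> S \<Longrightarrow> f y = g y"
  shows "frechet_derivative f (at x) = frechet_derivative g (at x)"
proof -
  have "(f has_derivative f') (at x) \<longleftrightarrow> (g has_derivative f') (at x)" for f'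
    using has_derivative_transform_within_open[of f f' x UNIV S g]
      has_derivative_transform_within_open[of g f' x UNIV S f] assms by auto
  then show ?thesis by (simp add: frechet_derivative_def)
qed

lemma Ck_on_subset: "Ck_on k S f \<Longrightarrow> T \<subseteq> S \<Longrightarrow> Ck_on k T f"
  by (induction k arbitrary: f) (auto intro: continuous_on_subset)

lemma Ck_on_cong:
  assumes "open S" "\<And>x. x \<in> S \<Longrightarrow> f x = g x" "Ck_on k S f"
  shows "Ck_on k S g"
  using assms
proof (induction k arbitrary: f g)
  case 0
  then show ?case unfolding Ck_on.simps by (blast intro: continuous_on_eq)
next
  case (Suc k)
  have fr: "frechet_derivative f (at x) = frechet_derivative g (at x)" if "x \<in> S" for x
    by (rule frechet_derivative_cong_open[OF Suc.prems(1) that Suc.prems(2)])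
  have "g differentiable (at x)" if "x \<in> S" for x
  proof -
    have "f differentiable (at x)" using Suc.prems that by simp
    then obtain f' where "(f has_derivative f') (at x)" by (auto simp: differentiable_def)
    then have "(g has_derivative f') (at x)"
      by (rule has_derivative_transform_within_open[OF _ Suc.prems(1) that Suc.prems(2)])
    then show ?thesis by (auto simp: differentiable_def)
  qed
  moreover have "Ck_on k S (\<lambda>x. frechet_derivative g (at x) v)" for v
  proof (rule Suc.IH[OF Suc.prems(1)])
    show "Ck_on k S (\<lambda>x. frechet_derivative f (at x) v)" using Suc.prems(3) by simp
  qed (simp add: fr)
  ultimately show ?case by simp
qed

text \<open>Differentiability at a point and the derivatives there depend on a neighbourhood only.\<close>

lemma Ck_on_local:
  assumes "\<And>x. x \<in> S \<Longrightarrow> \<exists>T. open T \<and> x \<in> T \<and> Ck_on k T f"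
  shows "Ck_on k S f"
  using assms
proof (induction k arbitrary: f)
  case 0
  show ?case unfolding Ck_on.simps continuous_on_eq_continuous_within
  proof
    fix x assume "x \<in> S"
    from 0[OF this] obtain T where "open T" "x \<in> T" "continuous_on T f" by auto
    then show "continuous (at x within S) f"
      by (meson continuous_at_imp_continuous_within continuous_on_eq_continuous_at)
  qed
next
  case (Suc k)
  have "f differentiable (at x)" if "x \<in> S" for x using Suc.prems[OF that] by auto
  moreover have "Ck_on k S (\<lambda>x. frechet_derivative f (at x) v)" for v
  proof (rule Suc.IH)
    fix x assume "x \<in> S"
    from Suc.prems[OF this] show "\<exists>T. open T \<and> x \<in> T \<and> Ck_on k T (\<lambda>x. frechet_derivative f (at x) v)"
      by auto
  qed
  ultimately show ?case by simp
qed

lemma Ck_on_SucD: "Ck_on (Suc k) S f \<Longrightarrow> Ck_on k S f"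
proof (induction k arbitrary: f)
  case 0
  then show ?case
    by (simp add: continuous_at_imp_continuous_on differentiable_imp_continuous_within)
next
  case (Suc k)
  then show ?case
    unfolding Ck_on.simps(2)[of "Suc k"] Ck_on.simps(2)[of k S f] by blast
qed

text \<open>For the inductions on the order: it suffices to exhibit the derivatives by a formula whose values are of
  the lower class.\<close>

lemma Ck_on_SucI:
  assumes "open S" "\<And>x. x \<in> S \<Longrightarrow> (f has_derivative f' x) (at x)" "\<And>v. Ck_on k S (\<lambda>x. f' x v)"
  shows "Ck_on (Suc k) S f"
proof -
  have "f' x = frechet_derivative f (at x)" if "x \<in> S" for x
    using assms(2)[OF that] by (rule frechet_derivative_at)
  then have "Ck_on k S (\<lambda>x. frechet_derivative f (at x) v)" for v
    using Ck_on_cong[OF assms(1) _ assms(3)[of v], of "\<lambda>x. frechet_derivative f (at x) v"] by auto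
  then show ?thesis using assms(2) by (auto simp: differentiable_def)
qed

lemma Ck_on_SucE:
  assumes "Ck_on (Suc k) S f" "x \<in> S"
  shows "(f has_derivative frechet_derivative f (at x)) (at x)"
  using assms by (simp flip: frechet_derivative_works)

lemma Ck_on_const: "Ck_on k S (\<lambda>x. c)"
  by (induction k arbitrary: c) (auto simp: )

lemma Ck_on_linear:
  assumes "bounded_linear L" "open S" "Ck_on k S f"
  shows "Ck_on k S (\<lambda>x. L (f x))"
  using assms(3)
proof (induction k arbitrary: f)
  case 0
  then show ?case using assms(1) by (simp add: bounded_linear.continuous_on)
next
  case (Suc k)
  show ?case
  proof (rule Ck_on_SucI[OF assms(2)])
    fix x assume "x \<in> S"
    from Ck_on_SucE[OF Suc.prems this]
    show "((\<lambda>x. L (f x)) has_derivative (\<lambda>v. L (frechet_derivative f (at x) v))) (at x)"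
      by (rule bounded_linear.has_derivative[OF assms(1)])
  next
    show "Ck_on k S (\<lambda>x. L (frechet_derivative f (at x) v))" for v
      by (rule Suc.IH) (use Suc.prems in simp)
  qed
qed

lemma Ck_on_add:
  assumes "open S" "Ck_on k S f" "Ck_on k S g"
  shows "Ck_on k S (\<lambda>x. f x + g x)"
  using assms(2,3)
proof (induction k arbitrary: f g)
  case 0
  then show ?case by (simp add: continuous_on_add)
next
  case (Suc k)
  show ?case
  proof (rule Ck_on_SucI[OF assms(1)])
    fix x assume "x \<in> S"
    with Suc.prems show "((\<lambda>x. f x + g x) has_derivative
        (\<lambda>v. frechet_derivative f (at x) v + frechet_derivative g (at x) v)) (at x)"
      by (intro has_derivative_add Ck_on_SucE)
  next
    show "Ck_on k S (\<lambda>x. frechet_derivative f (at x) v + frechet_derivative g (at x) v)" for v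
      by (rule Suc.IH) (use Suc.prems in simp_all)
  qed
qed

lemma Ck_on_sum:
  assumes "open S" "\<And>i. i \<in> I \<Longrightarrow> Ck_on k S (f i)"
  shows "Ck_on k S (\<lambda>x. \<Sum>i\<in>I. f i x)"
  using assms(2) by (induction I rule: infinite_finite_induct)
    (auto simp: Ck_on_const intro: Ck_on_add[OF assms(1)])

lemma Ck_on_bilinear:
  assumes bl: "bounded_bilinear B" and "open S" "Ck_on k S f" "Ck_on k S g"
  shows "Ck_on k S (\<lambda>x. B (f x) (g x))"
  using assms(3,4)
proof (induction k arbitrary: f g)
  case 0
  then show ?case by (simp add: bounded_bilinear.continuous_on[OF bl])
next
  case (Suc k)
  show ?case
  proof (rule Ck_on_SucI[OF assms(2)])
    fix x assume "x \<in> S"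
    with Suc.prems show "((\<lambda>x. B (f x) (g x)) has_derivative
        (\<lambda>v. B (f x) (frechet_derivative g (at x) v) + B (frechet_derivative f (at x) v) (g x))) (at x)"
      by (intro bounded_bilinear.FDERIV[OF bl] Ck_on_SucE)
  next
    fix v
    have 1: "Ck_on k S f" "Ck_on k S g" using Suc.prems Ck_on_SucD by blast+
    have 2: "Ck_on k S (\<lambda>x. frechet_derivative f (at x) v)" "Ck_on k S (\<lambda>x. frechet_derivative g (at x) v)"
      using Suc.prems by simp_all
    show "Ck_on k S (\<lambda>x. B (f x) (frechet_derivative g (at x) v) + B (frechet_derivative f (at x) v) (g x))"
      by (intro Ck_on_add[OF assms(2)] Suc.IH 1 2)
  qed
qed

text \<open>The chain rule is written in a basis, so that the derivative of the composition is a sum of products of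
  functions to which the induction hypothesis applies.\<close>

lemma Ck_on_compose:
  fixes f :: "'a::euclidean_space \<Rightarrow> 'c::euclidean_space" and g :: "'c \<Rightarrow> 'b::real_normed_vector"
  assumes "open S" "open T" "Ck_on k S f" "Ck_on k T g" "f ` S \<subseteq> T"
  shows "Ck_on k S (\<lambda>x. g (f x))"
  using assms(3-5)
proof (induction k arbitrary: g)
  case 0
  then show ?case by (auto intro: continuous_on_compose2)
next
  case (Suc k)
  let ?D = "\<lambda>x v. \<Sum>b\<in>Basis. (frechet_derivative f (at x) v \<bullet> b) *\<^sub>R frechet_derivative g (at (f x)) b"
  show ?case
  proof (rule Ck_on_SucI[OF assms(1)])
    fix x assume x: "x \<in> S"
    then have fx: "f x \<in> T" using Suc.prems by auto
    have lin: "linear (frechet_derivative g (at (f x)))"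
      using Ck_on_SucE[OF Suc.prems(2) fx] has_derivative_linear by blast
    have eq: "frechet_derivative g (at (f x)) w = (\<Sum>b\<in>Basis. (w \<bullet> b) *\<^sub>R frechet_derivative g (at (f x)) b)" for w
      by (subst euclidean_representation[of w, symmetric])
        (simp add: linear_sum[OF lin] linear_scale[OF lin])
    have "((\<lambda>x. g (f x)) has_derivative
       (\<lambda>v. frechet_derivative g (at (f x)) (frechet_derivative f (at x) v))) (at x)"
      using has_derivative_compose[OF Ck_on_SucE[OF Suc.prems(1) x], of g]
        Ck_on_SucE[OF Suc.prems(2) fx] by blast
    moreover have "(\<lambda>v. frechet_derivative g (at (f x)) (frechet_derivative f (at x) v)) = ?D x"
      by (rule ext) (rule eq)
    ultimately show "((\<lambda>x. g (f x)) has_derivative ?D x) (at x)"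
      by (simp only:)
  next
    fix v
    have "Ck_on k S (\<lambda>x. frechet_derivative g (at (f x)) b)" for b
      by (rule Suc.IH[OF Ck_on_SucD[OF Suc.prems(1)] _ Suc.prems(3)]) (use Suc.prems(2) in simp)
    moreover have "Ck_on k S (\<lambda>x. frechet_derivative f (at x) v \<bullet> b)" for b
      by (rule Ck_on_linear[OF _ assms(1)]) (use Suc.prems in \<open>auto intro: bounded_linear_inner_left\<close>)
    ultimately show "Ck_on k S (\<lambda>x. ?D x v)"
      by (intro Ck_on_sum Ck_on_bilinear[OF bounded_bilinear_scaleR] assms(1))
  qed
qed

lemma Ck_on_id: "open S \<Longrightarrow> Ck_on k S (\<lambda>x. x)"
proof (induction k)
  case (Suc k)
  show ?case by (rule Ck_on_SucI[where f' = "\<lambda>x v. v"]) (use Suc in \<open>auto simp: Ck_on_const\<close>)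
qed simp

lemma Ck_on_inverse_real: "Ck_on k (-{0}) (inverse :: real \<Rightarrow> real)"
proof (induction k)
  case 0
  show ?case by (simp, intro continuous_intros) auto
next
  case (Suc k)
  show ?case
  proof (rule Ck_on_SucI)
    fix x :: real assume "x \<in> - {0}"
    then show "(inverse has_derivative (\<lambda>v. - (inverse x * v * inverse x))) (at x)"
      by (intro has_derivative_inverse') auto
  next
    fix v :: real
    show "Ck_on k (-{0}) (\<lambda>x. - (inverse x * v * inverse x))"
      by (intro Ck_on_linear[OF bounded_linear_minus[OF bounded_linear_ident]]
          Ck_on_bilinear[OF bounded_bilinear_mult] Ck_on_const Suc) auto
  qed auto
qed

lemma smooth_on_subset: "smooth_on S f \<Longrightarrow> T \<subseteq> S \<Longrightarrow> smooth_on T f"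
  by (auto simp: smooth_on_def intro: Ck_on_subset)

lemma smooth_on_cong:
  "open S \<Longrightarrow> (\<And>x. x \<in> S \<Longrightarrow> f x = g x) \<Longrightarrow> smooth_on S f \<Longrightarrow> smooth_on S g"
  unfolding smooth_on_def by (auto intro: Ck_on_cong[of S f g])

lemma smooth_on_local:
  "(\<And>x. x \<in> S \<Longrightarrow> \<exists>T. open T \<and> x \<in> T \<and> smooth_on T f) \<Longrightarrow> smooth_on S f"
  unfolding smooth_on_def by (intro allI Ck_on_local) fastforce

lemma smooth_on_has_derivative:
  "smooth_on S f \<Longrightarrow> x \<in> S \<Longrightarrow> (f has_derivative frechet_derivative f (at x)) (at x)"
  unfolding smooth_on_def by (rule Ck_on_SucE[of 0], rule spec)

lemma smooth_on_continuous: "smooth_on S f \<Longrightarrow> continuous_on S f"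
  by (simp only: smooth_on_def Ck_on.simps(1)[symmetric])

lemma smooth_on_frechet: "smooth_on S f \<Longrightarrow> smooth_on S (\<lambda>x. frechet_derivative f (at x) v)"
  unfolding smooth_on_def
proof
  fix k assume "\<forall>k. Ck_on k S f"
  then have "Ck_on (Suc k) S f" ..
  then show "Ck_on k S (\<lambda>x. frechet_derivative f (at x) v)" by simp
qed

lemma smooth_on_const: "smooth_on S (\<lambda>x. c)"
  by (simp add: smooth_on_def Ck_on_const)

lemma smooth_on_id: "open S \<Longrightarrow> smooth_on S (\<lambda>x. x)"
  by (simp add: smooth_on_def Ck_on_id)

lemma smooth_on_linear:
  "bounded_linear L \<Longrightarrow> open S \<Longrightarrow> smooth_on S f \<Longrightarrow> smooth_on S (\<lambda>x. L (f x))"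
  by (simp add: smooth_on_def Ck_on_linear)

lemma smooth_on_add:
  "open S \<Longrightarrow> smooth_on S f \<Longrightarrow> smooth_on S g \<Longrightarrow> smooth_on S (\<lambda>x. f x + g x)"
  by (simp add: smooth_on_def Ck_on_add)

lemma smooth_on_minus: "open S \<Longrightarrow> smooth_on S f \<Longrightarrow> smooth_on S (\<lambda>x. - f x)"
  by (rule smooth_on_linear) (auto intro: bounded_linear_minus bounded_linear_ident)

lemma smooth_on_diff:
  "open S \<Longrightarrow> smooth_on S f \<Longrightarrow> smooth_on S g \<Longrightarrow> smooth_on S (\<lambda>x. f x - g x)"
  using smooth_on_add[of S f "\<lambda>x. - g x"] smooth_on_minus by auto

lemma smooth_on_sum:
  "open S \<Longrightarrow> (\<And>i. i \<in> I \<Longrightarrow> smooth_on S (f i)) \<Longrightarrow> smooth_on S (\<lambda>x. \<Sum>i\<in>I. f i x)"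
  by (simp add: smooth_on_def Ck_on_sum)

lemma smooth_on_bilinear:
  "bounded_bilinear B \<Longrightarrow> open S \<Longrightarrow> smooth_on S f \<Longrightarrow> smooth_on S g \<Longrightarrow> smooth_on S (\<lambda>x. B (f x) (g x))"
  by (simp add: smooth_on_def Ck_on_bilinear)

lemmas smooth_on_scaleR = smooth_on_bilinear[OF bounded_bilinear_scaleR]
lemmas smooth_on_inner = smooth_on_bilinear[OF bounded_bilinear_inner]

lemma smooth_on_mult:
  fixes f g :: "'a::euclidean_space \<Rightarrow> real"
  shows "open S \<Longrightarrow> smooth_on S f \<Longrightarrow> smooth_on S g \<Longrightarrow> smooth_on S (\<lambda>x. f x * g x)"
  by (rule smooth_on_bilinear[OF bounded_bilinear_mult])

lemma smooth_on_prod: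
  fixes f :: "'i \<Rightarrow> 'a::euclidean_space \<Rightarrow> real"
  assumes "open S" "\<And>i. i \<in> I \<Longrightarrow> smooth_on S (f i)"
  shows "smooth_on S (\<lambda>x. \<Prod>i\<in>I. f i x)"
  using assms(2) by (induction I rule: infinite_finite_induct)
    (auto simp: smooth_on_const intro: smooth_on_mult[OF assms(1)])

lemma smooth_on_compose:
  fixes f :: "'a::euclidean_space \<Rightarrow> 'c::euclidean_space" and g :: "'c \<Rightarrow> 'b::real_normed_vector"
  assumes "open S" "open T" "smooth_on S f" "smooth_on T g" "\<And>x. x \<in> S \<Longrightarrow> f x \<in> T"
  shows "smooth_on S (\<lambda>x. g (f x))"
  unfolding smooth_on_def
proof
  fix k
  show "Ck_on k S (\<lambda>x. g (f x))"
    by (rule Ck_on_compose[OF assms(1,2)]) (use assms(3-5) in \<open>auto simp: smooth_on_def\<close>)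
qed

lemma smooth_on_inverse:
  fixes f :: "'a::euclidean_space \<Rightarrow> real"
  assumes "open S" "smooth_on S f" "\<And>x. x \<in> S \<Longrightarrow> f x \<noteq> 0"
  shows "smooth_on S (\<lambda>x. inverse (f x))"
  by (rule smooth_on_compose[OF assms(1) _ assms(2), where T = "-{0}"])
    (use assms(3) in \<open>auto simp: smooth_on_def Ck_on_inverse_real\<close>)

lemma smooth_on_componentwise:
  fixes f :: "'a::euclidean_space \<Rightarrow> 'b::euclidean_space"
  assumes "open S" "\<And>b. b \<in> Basis \<Longrightarrow> smooth_on S (\<lambda>x. f x \<bullet> b)"
  shows "smooth_on S f"
proof (rule smooth_on_cong[OF assms(1)])
  show "smooth_on S (\<lambda>x. \<Sum>b\<in>Basis. (f x \<bullet> b) *\<^sub>R b)"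
    by (intro smooth_on_sum smooth_on_scaleR smooth_on_const assms)
qed (simp add: euclidean_representation)

lemma smooth_on_vec:
  fixes f :: "'a::euclidean_space \<Rightarrow> ('b::euclidean_space) ^ 'n"
  assumes "open S" "\<And>i. smooth_on S (\<lambda>x. f x $ i)"
  shows "smooth_on S f"
proof (rule smooth_on_componentwise[OF assms(1)])
  fix b :: "'b ^ 'n" assume "b \<in> Basis"
  then obtain i c where "b = axis i c" by (auto simp: Basis_vec_def)
  then have "(\<lambda>x. f x \<bullet> b) = (\<lambda>x. f x $ i \<bullet> c)" by (auto simp: inner_axis)
  then show "smooth_on S (\<lambda>x. f x \<bullet> b)"
    by (simp add: smooth_on_inner smooth_on_const assms)
qed

lemma smooth_on_nth:
  "open S \<Longrightarrow> smooth_on S f \<Longrightarrow> smooth_on S (\<lambda>x. f x $ i)"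
  by (rule smooth_on_linear[OF bounded_linear_vec_nth])

lemma smooth_on_Pair:
  assumes "open S" "smooth_on S f" "smooth_on S g"
  shows "smooth_on S (\<lambda>x. (f x, g x))"
proof -
  have "bounded_linear (\<lambda>x. (x, 0 :: 'c))" "bounded_linear (\<lambda>x. (0 :: 'b, x))"
    by (intro bounded_linear_Pair bounded_linear_ident bounded_linear_zero)+
  from smooth_on_add[OF assms(1) smooth_on_linear[OF this(1) assms(1,2)] smooth_on_linear[OF this(2) assms(1,3)]]
  show ?thesis by simp
qed

lemma smooth_on_fst: "open S \<Longrightarrow> smooth_on S f \<Longrightarrow> smooth_on S (\<lambda>x. fst (f x))"
  by (rule smooth_on_linear[OF bounded_linear_fst])

lemma smooth_on_snd: "open S \<Longrightarrow> smooth_on S f \<Longrightarrow> smooth_on S (\<lambda>x. snd (f x))"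
  by (rule smooth_on_linear[OF bounded_linear_snd])

lemma smooth_on_det:
  fixes A :: "'a::euclidean_space \<Rightarrow> real ^ 'n ^ 'n"
  assumes "open S" "\<And>i j. smooth_on S (\<lambda>x. A x $ i $ j)"
  shows "smooth_on S (\<lambda>x. det (A x))"
  unfolding det_def by (intro smooth_on_sum smooth_on_mult smooth_on_const smooth_on_prod assms)

lemma smooth_on_entry:
  fixes A :: "'a::euclidean_space \<Rightarrow> real ^ 'n ^ 'm"
  shows "open S \<Longrightarrow> smooth_on S A \<Longrightarrow> smooth_on S (\<lambda>x. A x $ i $ j)"
  by (intro smooth_on_nth)

lemma matrix_inv_works:
  assumes "invertible A"
  shows "A ** matrix_inv A = mat 1" "matrix_inv A ** A = mat 1"
  using someI_ex[OF assms[unfolded invertible_def]] by (simp_all add: matrix_inv_def)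

text \<open>Cramer's rule: every entry of the inverse is a quotient of two determinants.\<close>

lemma smooth_on_matrix_inv:
  fixes A :: "'a::euclidean_space \<Rightarrow> real ^ 'n ^ 'n"
  assumes "open S" "smooth_on S A" "\<And>x. x \<in> S \<Longrightarrow> invertible (A x)"
  shows "smooth_on S (\<lambda>x. matrix_inv (A x))"
proof (intro smooth_on_vec assms(1))
  fix k j
  let ?M = "\<lambda>x. (\<chi> i l. if l = k then axis j 1 $ i else A x $ i $ l) :: real ^ 'n ^ 'n"
  show "smooth_on S (\<lambda>x. matrix_inv (A x) $ k $ j)"
  proof (rule smooth_on_cong[OF assms(1)])
    fix x assume x: "x \<in> S"
    then have d: "det (A x) \<noteq> 0" using assms(3) invertible_det_nz by blast
    have "A x ** matrix_inv (A x) = mat 1" using matrix_inv_works(1)[OF assms(3)[OF x]] .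
    then have "A x *v (matrix_inv (A x) *v axis j 1) = axis j 1"
      by (simp add: matrix_vector_mul_assoc)
    then have "(matrix_inv (A x) *v axis j 1) $ k = det (?M x) / det (A x)"
      using cramer[OF d] by simp
    then show "det (?M x) * inverse (det (A x)) = matrix_inv (A x) $ k $ j"
      by (simp add: matrix_vector_mult_basis column_def divide_inverse)
  next
    have "smooth_on S (\<lambda>x. ?M x $ i $ l)" for i l
      by (cases "l = k") (auto intro!: smooth_on_const smooth_on_entry assms)
    from smooth_on_det[OF assms(1) this]
    moreover have "smooth_on S (\<lambda>x. inverse (det (A x)))"
      by (intro smooth_on_inverse smooth_on_det smooth_on_entry assms)
        (use assms(3) invertible_det_nz in blast)
    ultimately show "smooth_on S (\<lambda>x. det (?M x) * inverse (det (A x)))"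
      by (rule smooth_on_mult[OF assms(1)])
  qed
qed

lemma DERIV_along_line:
  fixes g :: "'a::real_normed_vector \<Rightarrow> real"
  assumes "(g has_derivative g') (at (p + \<sigma> *\<^sub>R v))"
  shows "((\<lambda>\<sigma>. g (p + \<sigma> *\<^sub>R v)) has_real_derivative g' v) (at \<sigma>)"
proof -
  have "((\<lambda>\<sigma>. p + \<sigma> *\<^sub>R v) has_derivative (\<lambda>t. t *\<^sub>R v)) (at \<sigma>)"
    by (auto intro!: derivative_eq_intros)
  from has_derivative_compose[OF this assms]
  have "((\<lambda>\<sigma>. g (p + \<sigma> *\<^sub>R v)) has_derivative (\<lambda>t. g' (t *\<^sub>R v))) (at \<sigma>)" .
  moreover have "(\<lambda>t. g' (t *\<^sub>R v)) = (*) (g' v)"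
    using linear_scale[OF has_derivative_linear[OF assms]] by (auto simp: mult.commute)
  ultimately show ?thesis by (simp add: has_field_derivative_def)
qed

text \<open>The mean value theorem, first in direction \<open>v\<close> for the difference of \<open>f\<close> at
  points that differ by \<open>s w\<close>, then in direction \<open>w\<close> for the derivative along
  \<open>v\<close>.\<close>

lemma second_difference_mean_value:
  fixes f :: "'a::euclidean_space \<Rightarrow> real"
  assumes f: "\<And>y. y \<in> S \<Longrightarrow> (f has_derivative f' y) (at y)"
    and f': "\<And>y. y \<in> S \<Longrightarrow> ((\<lambda>y. f' y v) has_derivative f'' y) (at y)"
    and S: "\<And>a b. 0 \<le> a \<Longrightarrow> a \<le> s \<Longrightarrow> 0 \<le> b \<Longrightarrow> b \<le> s \<Longrightarrow> x + a *\<^sub>R v + b *\<^sub>R w \<in> S"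
    and "0 < s"
  shows "\<exists>a b. 0 < a \<and> a < s \<and> 0 < b \<and> b < s \<and>
    f (x + s *\<^sub>R v + s *\<^sub>R w) - f (x + s *\<^sub>R v) - f (x + s *\<^sub>R w) + f x
      = s * (s * f'' (x + a *\<^sub>R v + b *\<^sub>R w) w)"
proof -
  let ?\<phi> = "\<lambda>\<sigma>. f (x + s *\<^sub>R w + \<sigma> *\<^sub>R v) - f (x + \<sigma> *\<^sub>R v)"
  have "(?\<phi> has_real_derivative f' (x + s *\<^sub>R w + \<sigma> *\<^sub>R v) v - f' (x + \<sigma> *\<^sub>R v) v) (at \<sigma>)"
    if "0 \<le> \<sigma>" "\<sigma> \<le> s" for \<sigma>
    using S[of \<sigma> s] S[of \<sigma> 0] that \<open>0 < s\<close>
    by (intro DERIV_diff DERIV_along_line f) (simp_all add: algebra_simps)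
  from MVT2[OF \<open>0 < s\<close> this]
  obtain a where a: "0 < a" "a < s"
    "?\<phi> s - ?\<phi> 0 = s * (f' (x + s *\<^sub>R w + a *\<^sub>R v) v - f' (x + a *\<^sub>R v) v)" by auto
  let ?\<psi> = "\<lambda>\<tau>. f' (x + a *\<^sub>R v + \<tau> *\<^sub>R w) v"
  have "(?\<psi> has_real_derivative f'' (x + a *\<^sub>R v + \<tau> *\<^sub>R w) w) (at \<tau>)"
    if "0 \<le> \<tau>" "\<tau> \<le> s" for \<tau>
    using S[of a \<tau>] that a by (intro DERIV_along_line[of "\<lambda>y. f' y v"] f') auto
  from MVT2[OF \<open>0 < s\<close> this]
  obtain b where b: "0 < b" "b < s" "?\<psi> s - ?\<psi> 0 = s * f'' (x + a *\<^sub>R v + b *\<^sub>R w) w" by auto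
  have "f (x + s *\<^sub>R v + s *\<^sub>R w) - f (x + s *\<^sub>R v) - f (x + s *\<^sub>R w) + f x = ?\<phi> s - ?\<phi> 0"
    by (simp add: algebra_simps)
  also have "\<dots> = s * (?\<psi> s - ?\<psi> 0)" using a by (simp add: algebra_simps)
  finally show ?thesis using a b by auto
qed

text \<open>The second difference of \<open>f\<close> over a small parallelogram is symmetric in \<open>v\<close> and
  \<open>w\<close>. Taking mean values in either order identifies it with both mixed derivatives, each at some point
  of the parallelogram; by continuity these agree at \<open>x\<close>.\<close>

lemma smooth_on_mixed_derivatives_real:
  fixes f :: "'a::euclidean_space \<Rightarrow> real"
  assumes S: "open S" "smooth_on S f" "x \<in> S"
  shows "frechet_derivative (\<lambda>y. frechet_derivative f (at y) v) (at x) w =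
         frechet_derivative (\<lambda>y. frechet_derivative f (at y) w) (at x) v"
proof (rule ccontr)
  let ?D = "\<lambda>v w y. frechet_derivative (\<lambda>y. frechet_derivative f (at y) v) (at y) w"
  define e where "e = \<bar>?D v w x - ?D w v x\<bar> / 2"
  assume "?D v w x \<noteq> ?D w v x"
  then have "e > 0" by (simp add: e_def)
  have cont: "isCont (?D v w) x" for v w
    using smooth_on_continuous[OF smooth_on_frechet[OF smooth_on_frechet[OF S(2)]]] S
    by (simp add: continuous_on_eq_continuous_at)
  obtain r0 where r0: "r0 > 0" "ball x r0 \<subseteq> S" using S openE by blast
  obtain r1 where r1: "r1 > 0" "\<And>y. dist y x < r1 \<Longrightarrow> dist (?D v w y) (?D v w x) < e"
    using cont[of v w] \<open>e > 0\<close> unfolding continuous_at_eps_delta by blast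
  obtain r2 where r2: "r2 > 0" "\<And>y. dist y x < r2 \<Longrightarrow> dist (?D w v y) (?D w v x) < e"
    using cont[of w v] \<open>e > 0\<close> unfolding continuous_at_eps_delta by blast
  define r where "r = min r0 (min r1 r2)"
  \<comment> \<open>The summand 1 keeps the denominator positive when \<open>v = w = 0\<close>.\<close>
  define s where "s = r / (norm v + norm w + 1)"
  have n: "norm v + norm w + 1 > 0" by (simp add: add_nonneg_pos)
  have "s > 0" using r0 r1 r2 n by (simp add: s_def r_def)
  have near: "dist (x + a *\<^sub>R v + b *\<^sub>R w) x < r" if "0 \<le> a" "a \<le> s" "0 \<le> b" "b \<le> s" for a b
  proof -
    have "dist (x + a *\<^sub>R v + b *\<^sub>R w) x \<le> a * norm v + b * norm w"
      using norm_triangle_ineq[of "a *\<^sub>R v" "b *\<^sub>R w"] that by (simp add: dist_norm add.assoc)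
    also have "\<dots> \<le> s * norm v + s * norm w" using that by (intro add_mono mult_right_mono) auto
    also have "\<dots> < s * (norm v + norm w + 1)" using \<open>s > 0\<close> by (simp add: algebra_simps)
    also have "\<dots> = r" using n by (simp add: s_def)
    finally show ?thesis .
  qed
  have inS: "x + a *\<^sub>R v + b *\<^sub>R w \<in> S" if "0 \<le> a" "a \<le> s" "0 \<le> b" "b \<le> s" for a b
    using near[OF that] r0 by (auto simp: r_def dist_commute subset_iff)
  have inS': "x + a *\<^sub>R w + b *\<^sub>R v \<in> S" if "0 \<le> a" "a \<le> s" "0 \<le> b" "b \<le> s" for a b
    using inS[OF that(3,4,1,2)] by (simp add: algebra_simps)
  note d1 = smooth_on_has_derivative[OF S(2)] and d2 = smooth_on_has_derivative[OF smooth_on_frechet[OF S(2)]]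
  obtain a b where ab: "0 < a" "a < s" "0 < b" "b < s"
    "f (x + s *\<^sub>R v + s *\<^sub>R w) - f (x + s *\<^sub>R v) - f (x + s *\<^sub>R w) + f x
      = s * (s * ?D v w (x + a *\<^sub>R v + b *\<^sub>R w))"
    using second_difference_mean_value[OF d1 d2 inS \<open>s > 0\<close>] by blast
  obtain c d where cd: "0 < c" "c < s" "0 < d" "d < s"
    "f (x + s *\<^sub>R w + s *\<^sub>R v) - f (x + s *\<^sub>R w) - f (x + s *\<^sub>R v) + f x
      = s * (s * ?D w v (x + c *\<^sub>R w + d *\<^sub>R v))"
    using second_difference_mean_value[OF d1 d2 inS' \<open>s > 0\<close>] by blast
  have "s * (s * ?D v w (x + a *\<^sub>R v + b *\<^sub>R w)) = s * (s * ?D w v (x + d *\<^sub>R v + c *\<^sub>R w))"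
    using ab(5) cd(5) by (simp add: algebra_simps)
  then have "?D v w (x + a *\<^sub>R v + b *\<^sub>R w) = ?D w v (x + d *\<^sub>R v + c *\<^sub>R w)"
    using \<open>s > 0\<close> by simp
  moreover have "dist (?D v w (x + a *\<^sub>R v + b *\<^sub>R w)) (?D v w x) < e"
    using near[of a b] ab by (intro r1) (auto simp: r_def)
  moreover have "dist (?D w v (x + d *\<^sub>R v + c *\<^sub>R w)) (?D w v x) < e"
    using near[of d c] cd by (intro r2) (auto simp: r_def)
  moreover have "\<bar>?D v w x - ?D w v x\<bar> = 2 * e" by (simp add: e_def)
  ultimately show False unfolding dist_real_def by linarith
qed

lemma frechet_derivative_inner:
  assumes "(f has_derivative f') (at x)"
  shows "frechet_derivative (\<lambda>x. f x \<bullet> b) (at x) v = f' v \<bullet> b"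
  using has_derivative_inner_left[OF assms, of b] frechet_derivative_at by metis

lemma smooth_on_mixed_derivatives:
  fixes f :: "'a::euclidean_space \<Rightarrow> 'b::euclidean_space"
  assumes S: "open S" "smooth_on S f" "x \<in> S"
  shows "frechet_derivative (\<lambda>y. frechet_derivative f (at y) v) (at x) w =
         frechet_derivative (\<lambda>y. frechet_derivative f (at y) w) (at x) v"
proof (rule euclidean_eqI)
  fix b :: 'b
  have 1: "frechet_derivative (\<lambda>y. frechet_derivative f (at y) v) (at x) w \<bullet> b =
     frechet_derivative (\<lambda>y. frechet_derivative (\<lambda>y. f y \<bullet> b) (at y) v) (at x) w" for v w
  proof -
    have "frechet_derivative (\<lambda>y. frechet_derivative (\<lambda>y. f y \<bullet> b) (at y) v) (at x)
      = frechet_derivative (\<lambda>y. frechet_derivative f (at y) v \<bullet> b) (at x)"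
      by (rule frechet_derivative_cong_open[OF S(1,3)])
        (rule frechet_derivative_inner[OF smooth_on_has_derivative[OF S(2)]])
    then show ?thesis
      by (simp only: frechet_derivative_inner[OF smooth_on_has_derivative[OF smooth_on_frechet[OF S(2)] S(3)]])
  qed
  show "frechet_derivative (\<lambda>y. frechet_derivative f (at y) v) (at x) w \<bullet> b =
    frechet_derivative (\<lambda>y. frechet_derivative f (at y) w) (at x) v \<bullet> b"
    unfolding 1
    by (rule smooth_on_mixed_derivatives_real[OF S(1) smooth_on_inner[OF S(1,2) smooth_on_const] S(3)])
qed

section \<open>Linear algebra of inner products\<close>

lemma bilinear_expand2:
  assumes "bilinear K"
  shows "K (x + t *\<^sub>R y) (x + t *\<^sub>R y) = K x x + t * K x y + t * K y x + t\<^sup>2 * (K y y :: real)"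
  by (simp add: bilinear_ladd[OF assms] bilinear_radd[OF assms] bilinear_lmul[OF assms]
      bilinear_rmul[OF assms] power2_eq_square algebra_simps)

text \<open>For small \<open>t\<close> with the sign of \<open>k\<close> the linear term would exceed the quadratic
  one.\<close>

lemma linear_coefficient_zero:
  fixes k c :: real
  assumes "\<And>t. 2 * t * k \<le> t\<^sup>2 * c"
  shows "k = 0"
proof (rule ccontr)
  assume "k \<noteq> 0"
  define t where "t = k / (\<bar>c\<bar> + 1)"
  have t: "t * (\<bar>c\<bar> + 1) = k" by (simp add: t_def)
  have "t \<noteq> 0" using \<open>k \<noteq> 0\<close> t by auto
  have "2 * t * k = t\<^sup>2 * (2 * (\<bar>c\<bar> + 1))" by (simp add: t[symmetric] power2_eq_square)
  with assms[of t] have "t\<^sup>2 * (2 * (\<bar>c\<bar> + 1)) \<le> t\<^sup>2 * c" by simp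
  then have "2 * (\<bar>c\<bar> + 1) \<le> c" using \<open>t \<noteq> 0\<close> by simp
  then have "2 * \<bar>c\<bar> + 2 \<le> \<bar>c\<bar>" using abs_ge_self[of c] by (simp only: distrib_left)
  then show False using abs_ge_zero[of c] by simp
qed

text \<open>The vectors are found one after the other. The next one maximises the quotient \<open>K w w / g w
  w\<close> over the \<open>g\<close>-orthogonal complement \<open>W\<close> of those already chosen. At a maximum the
  quotient is stationary, so \<open>K\<close> pairs the new vector to zero with everything in \<open>W\<close> that is
  \<open>g\<close>-orthogonal to it. This is the third property; it makes all later vectors
  \<open>K\<close>-orthogonal to the earlier ones.\<close>

lemma simultaneous_diagonalisation_set:
  fixes g K :: "'a::euclidean_space \<Rightarrow> 'a \<Rightarrow> real"
  assumes g: "bilinear g" "\<And>v w. g v w = g w v" "\<And>v. v \<noteq> 0 \<Longrightarrow> g v v > 0"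
    and K: "bilinear K" "\<And>v w. K v w = K w v"
    and "finite I" "card I \<le> DIM('a)"
  shows "\<exists>e. (\<forall>i\<in>I. \<forall>j\<in>I. g (e i) (e j) = (if i = j then 1 else 0)) \<and>
     (\<forall>i\<in>I. \<forall>j\<in>I. i \<noteq> j \<longrightarrow> K (e i) (e j) = 0) \<and>
     (\<forall>i\<in>I. \<forall>w. (\<forall>j\<in>I. g w (e j) = 0) \<longrightarrow> K (e i) w = 0)"
  using assms(6,7)
proof (induction I rule: finite_induct)
  case empty
  then show ?case by simp
next
  case (insert i0 I)
  then have "card I \<le> DIM('a)" by simp
  then obtain e where e': "(\<forall>i\<in>I. \<forall>j\<in>I. g (e i) (e j) = (if i = j then 1 else 0)) \<and>
     (\<forall>i\<in>I. \<forall>j\<in>I. i \<noteq> j \<longrightarrow> K (e i) (e j) = 0) \<and>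
     (\<forall>i\<in>I. \<forall>w. (\<forall>j\<in>I. g w (e j) = 0) \<longrightarrow> K (e i) w = 0)"
    by (rule exE[OF insert.IH])
  have e: "\<And>i j. i \<in> I \<Longrightarrow> j \<in> I \<Longrightarrow> g (e i) (e j) = (if i = j then 1 else 0)"
    "\<And>i j. i \<in> I \<Longrightarrow> j \<in> I \<Longrightarrow> i \<noteq> j \<Longrightarrow> K (e i) (e j) = 0"
    "\<And>i w. i \<in> I \<Longrightarrow> (\<And>j. j \<in> I \<Longrightarrow> g w (e j) = 0) \<Longrightarrow> K (e i) w = 0"
    using e' by blast+
  note gl = bilinear_ladd[OF g(1)] bilinear_lmul[OF g(1)] bilinear_rmul[OF g(1)]
    bilinear_lzero[OF g(1)]
  define W where "W = {w. \<forall>j\<in>I. g w (e j) = 0}"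
  have Wscale: "t *\<^sub>R w \<in> W" if "w \<in> W" for t w using that by (simp add: W_def gl)
  have Wadd: "v + w \<in> W" if "v \<in> W" "w \<in> W" for v w using that by (simp add: W_def gl)
  \<comment> \<open>The functional \<open>g _ (e j)\<close> as a Euclidean product, so that \<open>W\<close> is the complement of fewer than \<open>DIM('a)\<close> vectors.\<close>
  define G where "G j = (\<Sum>b\<in>Basis. g b (e j) *\<^sub>R b)" for j
  have G: "g w (e j) = w \<bullet> G j" for w j
  proof -
    have lin: "linear (\<lambda>w. g w (e j))" using g(1) by (simp add: bilinear_def)
    have "g w (e j) = g (\<Sum>b\<in>Basis. (w \<bullet> b) *\<^sub>R b) (e j)" by (simp add: euclidean_representation)
    also have "\<dots> = (\<Sum>b\<in>Basis. (w \<bullet> b) * g b (e j))"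
      using linear_sum[OF lin, of "\<lambda>b. (w \<bullet> b) *\<^sub>R b" Basis] by (simp add: gl)
    also have "\<dots> = w \<bullet> G j" by (simp add: G_def inner_sum_right mult.commute)
    finally show ?thesis .
  qed
  have "dim (G ` I) \<le> card I"
    using dim_le_card'[of "G ` I"] card_image_le[of I G] insert(1) by simp
  then have "dim (G ` I) < DIM('a)" using insert by simp
  then obtain x0 where x0: "x0 \<noteq> 0" "\<And>y. y \<in> span (G ` I) \<Longrightarrow> orthogonal x0 y"
    using orthogonal_to_subspace_exists by blast
  then have x0W: "x0 \<in> W" by (auto simp: W_def G orthogonal_def span_base)
  define C where "C = W \<inter> sphere 0 1"
  have bb: "bounded_bilinear g" "bounded_bilinear K"
    using g(1) K(1) by (simp_all add: bilinear_conv_bounded_bilinear)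
  have "closed W"
  proof -
    have "closed {w. g w (e j) = 0}" for j
      unfolding G by (intro closed_Collect_eq continuous_intros)
    then have "closed (\<Inter>j\<in>I. {w. g w (e j) = 0})" by blast
    also have "(\<Inter>j\<in>I. {w. g w (e j) = 0}) = W" by (auto simp: W_def)
    finally show ?thesis .
  qed
  then have compC: "compact C" by (simp add: C_def closed_Int_compact)
  have neC: "C \<noteq> {}"
    using x0 Wscale[OF x0W, of "1 / norm x0"] by (auto simp: C_def)
  have gC: "\<forall>w\<in>C. g w w \<noteq> 0"
  proof
    fix w assume "w \<in> C"
    then have "w \<noteq> 0" by (auto simp: C_def)
    from g(3)[OF this] show "g w w \<noteq> 0" by simp
  qed
  have contC: "continuous_on C (\<lambda>w. K w w / g w w)"
    by (intro continuous_on_divide bounded_bilinear.continuous_on[OF bb(1)]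
        bounded_bilinear.continuous_on[OF bb(2)] continuous_on_id gC)
  obtain m where m: "m \<in> C" "\<forall>w\<in>C. K w w / g w w \<le> K m m / g m m"
    using continuous_attains_sup[OF compC neC contC] by (rule bexE)
  define mx where "mx = K m m / g m m"
  have m0: "m \<noteq> 0" "m \<in> W" using m(1) by (auto simp: C_def)
  have le: "K w w \<le> mx * g w w" if "w \<in> W" for w
  proof (cases "w = 0")
    case True
    then show ?thesis using bilinear_lzero[OF K(1)] by (simp add: gl)
  next
    case False
    define v where "v = (1 / norm w) *\<^sub>R w"
    have v: "v \<in> C" using False Wscale[OF that] by (simp add: C_def v_def)
    have w: "w = norm w *\<^sub>R v" using False by (simp add: v_def)
    have "v \<noteq> 0" using v by (auto simp: C_def)
    then have "K v v \<le> mx * g v v"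
      using bspec[OF m(2) v] g(3)[of v] by (simp add: mx_def pos_divide_le_eq)
    then have "(norm w)\<^sup>2 * K v v \<le> (norm w)\<^sup>2 * (mx * g v v)" by (intro mult_left_mono) auto
    moreover have "K w w = (norm w)\<^sup>2 * K v v" "g w w = (norm w)\<^sup>2 * g v v"
      by (subst (1 2) w; simp add: gl bilinear_lmul[OF K(1)] bilinear_rmul[OF K(1)] power2_eq_square)+
    ultimately show ?thesis by (simp add: algebra_simps)
  qed
  define n where "n = (1 / sqrt (g m m)) *\<^sub>R m"
  have gm: "g m m > 0" using g(3) m0 by blast
  have n: "n \<in> W" "g n n = 1" using Wscale[OF m0(2)] gm by (simp_all add: n_def gl)
  have Kn: "K n n = mx"
    using gm by (simp add: n_def mx_def bilinear_lmul[OF K(1)] bilinear_rmul[OF K(1)])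
  \<comment> \<open>First-order condition: \<open>K - mx * g\<close> is at most 0 on \<open>W\<close> and vanishes at \<open>n\<close>.\<close>
  have perp: "K n w = 0" if w: "w \<in> W" "g w n = 0" for w
  proof (rule linear_coefficient_zero)
    fix t
    have "K (n + t *\<^sub>R w) (n + t *\<^sub>R w) \<le> mx * g (n + t *\<^sub>R w) (n + t *\<^sub>R w)"
      by (intro le Wadd n Wscale w)
    then have "mx + 2 * t * K n w + t\<^sup>2 * K w w \<le> mx * (1 + t\<^sup>2 * g w w)"
      unfolding bilinear_expand2[OF g(1)] bilinear_expand2[OF K(1)]
      using w n Kn g(2)[of n w] K(2)[of n w] by simp
    then show "2 * t * K n w \<le> t\<^sup>2 * (mx * g w w - K w w)" by (simp add: algebra_simps)
  qed
  let ?e = "e(i0 := n)"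
  have gn: "g n (e j) = 0" "g (e j) n = 0" if "j \<in> I" for j using n(1) that g(2) by (auto simp: W_def)
  have Kn0: "K n (e j) = 0" "K (e j) n = 0" if "j \<in> I" for j
    using e(3)[OF that, of n] gn K(2) by auto
  have i0: "j \<noteq> i0" if "j \<in> I" for j using that insert by auto
  show ?case
  proof (intro exI[of _ ?e] conjI ballI allI impI)
    fix i j assume "i \<in> insert i0 I" "j \<in> insert i0 I"
    then show "g (?e i) (?e j) = (if i = j then 1 else 0)"
      using e(1) gn n i0 by auto
  next
    fix i j assume "i \<in> insert i0 I" "j \<in> insert i0 I" "i \<noteq> j"
    then show "K (?e i) (?e j) = 0" using e(2) Kn0 by auto
  next
    fix i w assume i: "i \<in> insert i0 I" and w: "\<forall>j\<in>insert i0 I. g w (?e j) = 0"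
    have w1: "g w (e j) = 0" if "j \<in> I" for j using w that i0[OF that] by (metis fun_upd_other insertCI)
    have w2: "g w n = 0" using w by (auto dest: bspec[of _ _ i0])
    show "K (?e i) w = 0"
    proof (cases "i = i0")
      case True
      then show ?thesis using perp[of w] w1 w2 by (simp add: W_def)
    next
      case False
      then show ?thesis using e(3)[of i w] w1 i by simp
    qed
  qed
qed

lemma simultaneous_diagonalisation:
  fixes g K :: "real ^ 'n \<Rightarrow> real ^ 'n \<Rightarrow> real"
  assumes "bilinear g" "\<And>v w. g v w = g w v" "\<And>v. v \<noteq> 0 \<Longrightarrow> g v v > 0"
    and "bilinear K" "\<And>v w. K v w = K w v"
  obtains e :: "'n \<Rightarrow> real ^ 'n" where "\<And>i j. g (e i) (e j) = (if i = j then 1 else 0)"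
    "\<And>i j. i \<noteq> j \<Longrightarrow> K (e i) (e j) = 0"
  using simultaneous_diagonalisation_set[OF assms, of "UNIV :: 'n set"] by auto

text \<open>If the frame forms the columns of \<open>E\<close>, orthonormality reads \<open>E\<^sup>T g E = 1\<close>,
  and a one-sided inverse of a square matrix is two-sided: \<open>E E\<^sup>T\<close> is the inverse of
  \<open>g\<close>.\<close>

lemma trace_in_orthonormal_frame:
  fixes g K :: "real ^ 'n ^ 'n" and e :: "'n \<Rightarrow> real ^ 'n"
  assumes e: "\<And>i j. e i \<bullet> (g *v e j) = (if i = j then 1 else 0)"
  defines "E \<equiv> (\<chi> k i. e i $ k)"
  shows "E ** transpose E ** g = mat 1" "matrix_inv g = E ** transpose E"
    "transpose E ** K ** E = (\<chi> i j. e i \<bullet> (K *v e j))"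
proof -
  have *: "transpose E ** K ** E = (\<chi> i j. e i \<bullet> (K *v e j))" for K :: "real ^ 'n ^ 'n"
    unfolding E_def matrix_matrix_mult_def transpose_def matrix_vector_mult_def inner_vec_def
    by (simp add: vec_eq_iff sum_distrib_left sum_distrib_right mult.assoc) (subst sum.swap, simp)
  show "transpose E ** K ** E = (\<chi> i j. e i \<bullet> (K *v e j))" by (rule *)
  have "transpose E ** g ** E = mat 1" unfolding * by (simp add: e mat_def vec_eq_iff)
  then have "E ** (transpose E ** g) = mat 1" by (metis matrix_left_right_inverse)
  then show 1: "E ** transpose E ** g = mat 1" by (simp add: matrix_mul_assoc)
  then have 2: "g ** (E ** transpose E) = mat 1" by (metis matrix_left_right_inverse)
  have "invertible g" using 1 2 invertible_def by blast
  then have "matrix_inv g ** g = mat 1"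
    using someI_ex[of "\<lambda>A'. g ** A' = mat 1 \<and> A' ** g = mat 1"] by (simp add: invertible_def matrix_inv_def)
  then show "matrix_inv g = E ** transpose E"
    by (metis 2 matrix_mul_assoc matrix_mul_lid matrix_mul_rid)
qed

lemma orthonormal_frame_expansion:
  fixes g :: "real ^ 'n ^ 'n" and e :: "'n \<Rightarrow> real ^ 'n"
  assumes e: "\<And>i j. e i \<bullet> (g *v e j) = (if i = j then 1 else 0)"
  shows "v = (\<Sum>i\<in>UNIV. (e i \<bullet> (g *v v)) *\<^sub>R e i)"
proof -
  let ?E = "(\<chi> k i. e i $ k) :: real ^ 'n ^ 'n"
  have "v = (?E ** transpose ?E ** g) *v v"
    by (simp add: trace_in_orthonormal_frame(1)[OF e])
  also have "\<dots> = ?E *v (transpose ?E *v (g *v v))"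
    by (simp add: matrix_vector_mul_assoc matrix_mul_assoc)
  also have "\<dots> = (\<Sum>i\<in>UNIV. (e i \<bullet> (g *v v)) *\<^sub>R e i)"
    by (simp add: vec_eq_iff matrix_vector_mult_def[of ?E] vector_matrix_mult_def inner_vec_def mult.commute)
  finally show ?thesis .
qed

text \<open>\<open>K\<close> has the matrix \<open>E\<^sup>T K E\<close> in the frame, and moving the outer factors
  around inside the trace leaves only products \<open>E E\<^sup>T = g\<inverse>\<close>. The right hand side mentions
  no frame, which gives both the independence of the frame and the smooth dependence on the point.\<close>

lemma trace_cube_in_orthonormal_frame:
  fixes g K :: "real ^ 'n ^ 'n" and e :: "'n \<Rightarrow> real ^ 'n"
  assumes e: "\<And>i j. e i \<bullet> (g *v e j) = (if i = j then 1 else 0)"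
  defines "k i j \<equiv> e i \<bullet> (K *v e j)" and "L \<equiv> matrix_inv g ** K"
  shows "(\<Sum>i\<in>UNIV. \<Sum>j\<in>UNIV. \<Sum>l\<in>UNIV. k i j * k j l * k l i) = trace (L ** L ** L)"
proof -
  let ?E = "(\<chi> k i. e i $ k) :: real ^ 'n ^ 'n"
  let ?F = "transpose ?E"
  let ?k = "(\<chi> i j. k i j) :: real ^ 'n ^ 'n"
  have k: "?k = ?F ** K ** ?E" unfolding k_def trace_in_orthonormal_frame(3)[OF e] ..
  have "(\<Sum>i\<in>UNIV. \<Sum>j\<in>UNIV. \<Sum>l\<in>UNIV. k i j * k j l * k l i) = trace (?k ** (?k ** ?k))"
    by (simp add: trace_def matrix_matrix_mult_def sum_distrib_left mult.assoc)
  also have "?k ** (?k ** ?k) = ?F ** (K ** ?E ** ?F ** K ** ?E ** ?F ** K ** ?E)"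
    by (simp add: k matrix_mul_assoc)
  also have "trace \<dots> = trace (K ** ?E ** ?F ** K ** ?E ** ?F ** K ** ?E ** ?F)"
    by (rule trace_mul_sym)
  also have "K ** ?E ** ?F ** K ** ?E ** ?F ** K ** ?E ** ?F
     = K ** ((?E ** ?F) ** K ** (?E ** ?F) ** K ** (?E ** ?F))"
    by (simp add: matrix_mul_assoc)
  also have "trace \<dots> = trace ((?E ** ?F) ** K ** (?E ** ?F) ** K ** (?E ** ?F) ** K)"
    by (rule trace_mul_sym)
  also have "\<dots> = trace (L ** L ** L)"
    by (simp add: L_def trace_in_orthonormal_frame(2)[OF e] matrix_mul_assoc)
  finally show ?thesis .
qed

text \<open>For each component \<open>\<phi>\<close> of \<open>L\<close> this is Bessel's inequality for the vector
  \<open>\<xi>\<close> that represents \<open>\<phi>\<close>: its squared length is the sum over the frame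
  \<open>f\<close>, and the difference of the two sides is the squared length of \<open>\<xi>\<close> minus its
  expansion in the \<open>c j\<close>. The \<open>c j\<close> may vanish, which covers degenerate directions of a
  differential.\<close>

lemma bessel_for_orthogonal_family:
  fixes h :: "'a::real_vector \<Rightarrow> 'a \<Rightarrow> real" and L :: "'a \<Rightarrow> 'v::euclidean_space"
    and f :: "'n::finite \<Rightarrow> 'a" and c :: "'m::finite \<Rightarrow> 'a"
  assumes h: "bilinear h" "\<And>v w. h v w = h w v" "\<And>v. h v v \<ge> 0"
    and f: "\<And>i j. h (f i) (f j) = (if i = j then 1 else 0)" "\<And>v. v = (\<Sum>k\<in>UNIV. h (f k) v *\<^sub>R f k)"
    and c: "\<And>i j. i \<noteq> j \<Longrightarrow> h (c i) (c j) = 0" "\<And>i. h (c i) (c i) = 1 \<or> c i = 0"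
    and L: "linear L"
  shows "(\<Sum>j\<in>UNIV. (norm (L (c j)))\<^sup>2) \<le> (\<Sum>k\<in>UNIV. (norm (L (f k)))\<^sup>2)"
proof -
  have hl: "linear (\<lambda>v. h v w)" "linear (h w)" for w using h(1) by (simp_all add: bilinear_def)
  have 1: "(\<Sum>j\<in>UNIV. (L (c j) \<bullet> b)\<^sup>2) \<le> (\<Sum>k\<in>UNIV. (L (f k) \<bullet> b)\<^sup>2)" for b
  proof -
    define \<phi> where "\<phi> v = L v \<bullet> b" for v
    define \<xi> where "\<xi> = (\<Sum>k\<in>UNIV. \<phi> (f k) *\<^sub>R f k)"
    have lin: "linear \<phi>" unfolding \<phi>_def
      using L bounded_linear_inner_left[of b, THEN bounded_linear.linear] linear_compose[of L "\<lambda>v. v \<bullet> b"]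
      by (simp add: o_def)
    have \<xi>: "h \<xi> v = \<phi> v" for v
    proof -
      have "\<phi> v = (\<Sum>k\<in>UNIV. h (f k) v * \<phi> (f k))"
        by (subst f(2)) (simp add: linear_sum[OF lin] linear_scale[OF lin])
      then show ?thesis
        by (simp add: \<xi>_def linear_sum[OF hl(1)] linear_scale[OF hl(1)] mult.commute)
    qed
    define \<eta> where "\<eta> = (\<Sum>j\<in>UNIV. \<phi> (c j) *\<^sub>R c j)"
    have hc: "h (c i) \<eta> = \<phi> (c i)" for i
    proof -
      have "h (c i) \<eta> = (\<Sum>j\<in>UNIV. \<phi> (c j) * h (c i) (c j))"
        by (simp add: \<eta>_def linear_sum[OF hl(2)] linear_scale[OF hl(2)])
      also have "\<dots> = (\<Sum>j\<in>UNIV. if j = i then \<phi> (c i) * h (c i) (c i) else 0)"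
        by (intro sum.cong) (use c(1) in auto)
      also have "\<dots> = \<phi> (c i) * h (c i) (c i)" by simp
      also have "\<dots> = \<phi> (c i)" using c(2)[of i] linear_0[OF lin] by auto
      finally show ?thesis .
    qed
    have hh: "h \<eta> v = (\<Sum>j\<in>UNIV. \<phi> (c j) * h (c j) v)" for v
      by (simp add: \<eta>_def linear_sum[OF hl(1)] linear_scale[OF hl(1)])
    have "0 \<le> h (\<xi> - \<eta>) (\<xi> - \<eta>)" by (rule h(3))
    also have "\<dots> = h \<xi> \<xi> - 2 * h \<xi> \<eta> + h \<eta> \<eta>"
      using h(2)[of \<eta> \<xi>] by (simp add: linear_diff[OF hl(1)] linear_diff[OF hl(2)])
    also have "h \<eta> \<eta> = (\<Sum>j\<in>UNIV. (\<phi> (c j))\<^sup>2)" by (simp add: hh hc power2_eq_square)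
    also have "h \<xi> \<eta> = (\<Sum>j\<in>UNIV. (\<phi> (c j))\<^sup>2)"
      by (simp add: \<xi>) (simp add: \<eta>_def linear_sum[OF lin] linear_scale[OF lin] power2_eq_square)
    also have "h \<xi> \<xi> = (\<Sum>k\<in>UNIV. (\<phi> (f k))\<^sup>2)"
      by (simp add: \<xi>) (simp add: \<xi>_def linear_sum[OF lin] linear_scale[OF lin] power2_eq_square)
    finally show ?thesis by (simp add: \<phi>_def)
  qed
  have n: "(norm v)\<^sup>2 = (\<Sum>b\<in>Basis. (v \<bullet> b)\<^sup>2)" for v :: 'v
    unfolding power2_norm_eq_inner by (subst euclidean_inner) (simp add: power2_eq_square)
  have "(\<Sum>j\<in>UNIV. (norm (L (c j)))\<^sup>2) = (\<Sum>b\<in>Basis. \<Sum>j\<in>UNIV. (L (c j) \<bullet> b)\<^sup>2)"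
    unfolding n by (rule sum.swap)
  also have "\<dots> \<le> (\<Sum>b\<in>Basis. \<Sum>k\<in>UNIV. (L (f k) \<bullet> b)\<^sup>2)" by (rule sum_mono) (rule 1)
  also have "\<dots> = (\<Sum>k\<in>UNIV. (norm (L (f k)))\<^sup>2)" unfolding n by (rule sum.swap)
  finally show ?thesis .
qed

text \<open>The factor 6 of superstrong instability is 2 from the first sum plus 4 from the double sum. The latter is
  symmetrised: \<open>s\<^sub>i\<^sup>2 s\<^sub>j + s\<^sub>j\<^sup>2 s\<^sub>i \<le> s\<^sub>i\<^sup>3 +
  s\<^sub>j\<^sup>3\<close> reduces it to a sum over the normalised vectors \<open>c i\<close>, to which Bessel's
  inequality applies.\<close>

lemma averaged_second_variation_negative:
  fixes h :: "'a::euclidean_space \<Rightarrow> 'a \<Rightarrow> real" and B :: "'a \<Rightarrow> 'a \<Rightarrow> 'v::euclidean_space"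
    and f :: "'n::finite \<Rightarrow> 'a" and a :: "'m::finite \<Rightarrow> 'a"
  assumes h: "bilinear h" "\<And>v w. h v w = h w v" "\<And>v. v \<noteq> 0 \<Longrightarrow> h v v > 0"
    and f: "\<And>i j. h (f i) (f j) = (if i = j then 1 else 0)" "\<And>v. v = (\<Sum>k\<in>UNIV. h (f k) v *\<^sub>R f k)"
    and B: "bilinear B" "\<And>v w. B v w = B w v"
    and ssu: "\<And>v. h v v = 1 \<Longrightarrow> (\<Sum>k\<in>UNIV. 6 * (B v (f k) \<bullet> B v (f k)) - B v v \<bullet> B (f k) (f k)) < 0"
    and a: "\<And>i j. i \<noteq> j \<Longrightarrow> h (a i) (a j) = 0"
  defines "H \<equiv> \<Sum>k\<in>UNIV. B (f k) (f k)"
  defines "Q \<equiv> (\<Sum>i\<in>UNIV. (h (a i) (a i))\<^sup>2 *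
        (2 * (\<Sum>k\<in>UNIV. (norm (B (a i) (f k)))\<^sup>2) - H \<bullet> B (a i) (a i)))
      + 4 * (\<Sum>i\<in>UNIV. \<Sum>j\<in>UNIV. h (a i) (a i) * (norm (B (a i) (a j)))\<^sup>2)"
  shows "Q \<le> 0" "a i \<noteq> 0 \<Longrightarrow> Q < 0"
proof -
  define s where "s i = h (a i) (a i)" for i
  \<comment> \<open>If \<open>a i = 0\<close>, then \<open>1 / sqrt 0 = 0\<close> and \<open>c i = 0\<close>.\<close>
  define c where "c i = (1 / sqrt (s i)) *\<^sub>R a i" for i
  note hl = bilinear_lmul[OF h(1)] bilinear_rmul[OF h(1)] bilinear_lzero[OF h(1)]
  note Bl = bilinear_lmul[OF B(1)] bilinear_rmul[OF B(1)] bilinear_lzero[OF B(1)]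
  have hn: "h v v \<ge> 0" for v using h(3)[of v] hl by (cases "v = 0") auto
  have s0: "s i \<ge> 0" for i by (simp add: s_def hn)
  have sz: "s i = 0 \<longleftrightarrow> a i = 0" for i
    using h(3)[of "a i"] hl(3)[of 0] by (cases "a i = 0") (simp_all add: s_def)
  have ac: "a i = sqrt (s i) *\<^sub>R c i" for i using sz[of i] by (cases "a i = 0") (simp_all add: c_def)
  have cc: "h (c i) (c i) = 1 \<or> c i = 0" for i
  proof (cases "a i = 0")
    case False
    then have "s i > 0" using s0[of i] sz[of i] by simp
    then show ?thesis by (simp add: c_def hl s_def[symmetric])
  qed (simp add: c_def)
  have co: "h (c i) (c j) = 0" if "i \<noteq> j" for i j using a[OF that] by (simp add: c_def hl)
  define \<beta> where "\<beta> i j = (norm (B (c i) (c j)))\<^sup>2" for i j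
  define \<gamma> where "\<gamma> i = (\<Sum>k\<in>UNIV. (norm (B (c i) (f k)))\<^sup>2)" for i
  have lB: "linear (B v)" for v using B(1) unfolding bilinear_def by (rule conjunct1[THEN spec])
  have bessel: "(\<Sum>j\<in>UNIV. \<beta> i j) \<le> \<gamma> i" for i
    unfolding \<beta>_def \<gamma>_def
    by (rule bessel_for_orthogonal_family[OF h(1,2) hn f co cc lB])
  have 1: "(norm (B (a i) (f k)))\<^sup>2 = s i * (norm (B (c i) (f k)))\<^sup>2" for i k
    by (subst ac) (simp add: Bl power_mult_distrib s0)
  have 2: "H \<bullet> B (a i) (a i) = s i * (H \<bullet> B (c i) (c i))" for i
    by (subst (1 2) ac) (simp add: Bl s0)
  have 3: "(norm (B (a i) (a j)))\<^sup>2 = s i * s j * \<beta> i j" for i j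
    by (subst (1 2) ac) (simp add: Bl power_mult_distrib s0 \<beta>_def)
  have Q: "Q = (\<Sum>i\<in>UNIV. s i ^ 3 * (2 * \<gamma> i - H \<bullet> B (c i) (c i)))
      + 4 * (\<Sum>i\<in>UNIV. \<Sum>j\<in>UNIV. (s i)\<^sup>2 * s j * \<beta> i j)"
    unfolding Q_def 1 2 3 s_def[symmetric] \<gamma>_def sum_distrib_left[symmetric]
    by (simp add: power2_eq_square power3_eq_cube algebra_simps sum_distrib_left)
  have sym: "(\<Sum>i\<in>UNIV. \<Sum>j\<in>UNIV. \<psi> i j * \<beta> i j) = (\<Sum>i\<in>UNIV. \<Sum>j\<in>UNIV. \<psi> j i * \<beta> i j)" for \<psi>
    by (subst sum.swap) (simp add: \<beta>_def B(2))
  have young: "(s i)\<^sup>2 * s j + (s j)\<^sup>2 * s i \<le> s i ^ 3 + s j ^ 3" for i j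
  proof -
    \<comment> \<open>This product is \<open>s\<^sub>i\<^sup>3 + s\<^sub>j\<^sup>3 - s\<^sub>i\<^sup>2 s\<^sub>j - s\<^sub>j\<^sup>2 s\<^sub>i\<close>.\<close>
    have "0 \<le> (s i + s j) * (s i - s j)\<^sup>2" using s0 by (simp add: add_nonneg_nonneg)
    then show ?thesis by (simp add: power2_eq_square power3_eq_cube algebra_simps)
  qed
  have "2 * (\<Sum>i\<in>UNIV. \<Sum>j\<in>UNIV. (s i)\<^sup>2 * s j * \<beta> i j)
     = (\<Sum>i\<in>UNIV. \<Sum>j\<in>UNIV. ((s i)\<^sup>2 * s j + (s j)\<^sup>2 * s i) * \<beta> i j)"
    using sym[of "\<lambda>i j. (s i)\<^sup>2 * s j"] by (simp add: distrib_right sum.distrib)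
  also have "\<dots> \<le> (\<Sum>i\<in>UNIV. \<Sum>j\<in>UNIV. (s i ^ 3 + s j ^ 3) * \<beta> i j)"
    by (intro sum_mono mult_right_mono young) (simp add: \<beta>_def)
  also have "\<dots> = 2 * (\<Sum>i\<in>UNIV. \<Sum>j\<in>UNIV. s i ^ 3 * \<beta> i j)"
    using sym[of "\<lambda>i j. s i ^ 3"] by (simp add: distrib_right sum.distrib)
  also have "(\<Sum>i\<in>UNIV. \<Sum>j\<in>UNIV. s i ^ 3 * \<beta> i j) \<le> (\<Sum>i\<in>UNIV. s i ^ 3 * \<gamma> i)"
    unfolding sum_distrib_left[symmetric] by (intro sum_mono mult_left_mono bessel) (simp add: s0)
  finally have "Q \<le> (\<Sum>i\<in>UNIV. s i ^ 3 * (2 * \<gamma> i - H \<bullet> B (c i) (c i))) + 4 * (\<Sum>i\<in>UNIV. s i ^ 3 * \<gamma> i)"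
    unfolding Q by simp
  also have "\<dots> = (\<Sum>i\<in>UNIV. s i ^ 3 * (6 * \<gamma> i - H \<bullet> B (c i) (c i)))"
    by (simp add: algebra_simps sum_distrib_left flip: sum.distrib)
  finally have Q': "Q \<le> (\<Sum>i\<in>UNIV. s i ^ 3 * (6 * \<gamma> i - H \<bullet> B (c i) (c i)))" .
  have neg: "s i ^ 3 * (6 * \<gamma> i - H \<bullet> B (c i) (c i)) < 0" if "a i \<noteq> 0" for i
  proof -
    have "s i > 0" using s0[of i] sz[of i] that by simp
    then have "c i \<noteq> 0" using that by (auto simp: c_def)
    then have "h (c i) (c i) = 1" using cc by blast
    from ssu[OF this] have "6 * \<gamma> i - H \<bullet> B (c i) (c i) < 0"
      by (simp add: \<gamma>_def H_def sum_subtractf sum_distrib_left power2_norm_eq_inner inner_sum_left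
          inner_sum_right inner_commute)
    then show ?thesis using \<open>s i > 0\<close> by (simp add: mult_pos_neg)
  qed
  have np: "s i ^ 3 * (6 * \<gamma> i - H \<bullet> B (c i) (c i)) \<le> 0" for i
    using neg[of i] sz[of i] by (cases "a i = 0") auto
  have "(\<Sum>i\<in>UNIV. s i ^ 3 * (6 * \<gamma> i - H \<bullet> B (c i) (c i))) \<le> 0"
    by (rule sum_nonpos) (rule np)
  with Q' show "Q \<le> 0" by simp
  show "Q < 0" if "a i \<noteq> 0"
  proof -
    have "(\<Sum>i\<in>UNIV. s i ^ 3 * (6 * \<gamma> i - H \<bullet> B (c i) (c i))) < (\<Sum>i\<in>(UNIV::'m set). 0)"
      by (rule sum_strict_mono_ex1) (use np neg[OF that] in auto)
    then show ?thesis using Q' by simp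
  qed
qed

section \<open>Change of variables for Lebesgue measure\<close>

text \<open>The change of variables theorem for Lebesgue measure speaks of \<open>real ^ 'k\<close> with a
  well-ordered index type \<open>'k\<close>. This is such an index type of any given finite size; renumbering
  coordinates carries the theorem over to all finite index types.\<close>

typedef ('m::finite) ordered_index = "{..<CARD('m)}"
  by (auto intro!: exI[of _ 0])

instantiation ordered_index :: (finite) linorder
begin
definition "a \<le> b \<longleftrightarrow> Rep_ordered_index a \<le> Rep_ordered_index b"
definition "a < b \<longleftrightarrow> Rep_ordered_index a < Rep_ordered_index b"
instance
proof
  fix x y z :: "'a ordered_index"
  show "x < y \<longleftrightarrow> x \<le> y \<and> \<not> y \<le> x" "x \<le> x" "x \<le> y \<or> y \<le> x"
    unfolding less_eq_ordered_index_def less_ordered_index_def by linarith+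
  show "x \<le> z" if "x \<le> y" "y \<le> z"
    using that unfolding less_eq_ordered_index_def by linarith
  show "x = y" if "x \<le> y" "y \<le> x"
    using that unfolding less_eq_ordered_index_def by (simp flip: Rep_ordered_index_inject)
qed
end

instance ordered_index :: (finite) wellorder
proof
  fix P :: "'a ordered_index \<Rightarrow> bool" and a :: "'a ordered_index"
  assume step: "\<And>x. (\<And>y. y < x \<Longrightarrow> P y) \<Longrightarrow> P x"
  show "P a"
  proof (induction a rule: measure_induct_rule[of Rep_ordered_index])
    case (less x)
    show ?case by (rule step, rule less) (simp only: less_ordered_index_def)
  qed
qed

instance ordered_index :: (finite) finite
proof
  show "finite (UNIV :: 'a ordered_index set)"
    using type_definition.univ[OF type_definition_ordered_index] by (metis finite_imageI finite_lessThan)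
qed

lemma ex_bij_ordered_index: "\<exists>r :: 'm::finite \<Rightarrow> 'm ordered_index. bij r"
proof (intro finite_same_card_bij)
  show "CARD('m) = CARD('m ordered_index)"
    by (simp add: type_definition.card[OF type_definition_ordered_index])
qed auto

lemma swapidseq_conjugate:
  assumes "bij r" "swapidseq n p"
  shows "swapidseq n (r \<circ> p \<circ> inv r)"
  using assms(2)
proof (induction rule: swapidseq.induct)
  case id
  have "r \<circ> id \<circ> inv r = id"
  proof
    fix x
    have "r (inv r x) = x" using assms(1) by (meson bij_is_surj surj_f_inv_f)
    then show "(r \<circ> id \<circ> inv r) x = id x" by (simp only: o_apply id_apply)
  qed
  then show ?case by (simp only: swapidseq.id)
next
  case (comp_Suc n p a b)
  have "r \<circ> (Transposition.transpose a b \<circ> p) \<circ> inv r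
      = Transposition.transpose (r a) (r b) \<circ> (r \<circ> p \<circ> inv r)"
    using assms(1) by (auto simp: fun_eq_iff Transposition.transpose_def bij_is_inj inj_eq)
  moreover have "r a \<noteq> r b" using comp_Suc.hyps assms(1) by (simp add: bij_is_inj inj_eq)
  ultimately show ?case
    using swapidseq.comp_Suc[OF comp_Suc.IH] by (simp only:)
qed

lemma sign_conjugate:
  fixes r :: "'a::finite \<Rightarrow> 'b::finite"
  assumes "bij r" "permutation p"
  shows "sign (r \<circ> p \<circ> inv r) = sign p"
proof -
  obtain n where n: "swapidseq n p" using assms(2) by (auto simp: permutation_def)
  have "evenperm p = even n" "evenperm (r \<circ> p \<circ> inv r) = even n"
    using evenperm_unique[OF n] evenperm_unique[OF swapidseq_conjugate[OF assms(1) n]] by blast+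
  then show ?thesis by (simp add: sign_def)
qed

text \<open>Conjugation with \<open>r\<close> maps the permutations of one index type bijectively to those of the
  other, keeps the sign, and matches the factors of the Leibniz formula.\<close>

lemma det_reindex:
  fixes A :: "real ^ 'm ^ 'm" and r :: "'m::finite \<Rightarrow> 'k::finite"
  assumes "bij r"
  shows "det (\<chi> i j. A $ inv r i $ inv r j) = det A"
proof -
  have bi: "bij (inv r)" using assms by (rule bij_imp_bij_inv)
  have inv: "inv r (r x) = x" "r (inv r y) = y" for x y
    using assms by (simp_all add: bij_is_inj bij_is_surj surj_f_inv_f)
  have perm: "permutation p" if "p permutes (UNIV :: 'm set)" for p
    using that by (meson finite_class.finite_UNIV permutation_permutes)
  have bij: "bij_betw (\<lambda>p. r \<circ> p \<circ> inv r) {p. p permutes UNIV} {p. p permutes UNIV}"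
  proof (rule bij_betwI[where g = "\<lambda>q. inv r \<circ> q \<circ> r"])
    show "(\<lambda>p. r \<circ> p \<circ> inv r) \<in> {p. p permutes UNIV} \<rightarrow> {p. p permutes UNIV}"
      using assms bi by (auto simp: bij_imp_permutes permutes_bij intro!: bij_imp_permutes bij_comp)
    show "(\<lambda>q. inv r \<circ> q \<circ> r) \<in> {p. p permutes UNIV} \<rightarrow> {p. p permutes UNIV}"
      using assms bi by (auto simp: bij_imp_permutes permutes_bij intro!: bij_imp_permutes bij_comp)
  qed (auto simp: fun_eq_iff inv)
  have "det (\<chi> i j. A $ inv r i $ inv r j)
      = (\<Sum>q | q permutes UNIV. of_int (sign q) * (\<Prod>i\<in>UNIV. A $ inv r i $ inv r (q i)))"
    by (simp add: det_def)
  also have "\<dots> = (\<Sum>p | p permutes UNIV. of_int (sign (r \<circ> p \<circ> inv r)) *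
      (\<Prod>i\<in>UNIV. A $ inv r i $ inv r ((r \<circ> p \<circ> inv r) i)))"
    by (rule sum.reindex_bij_betw[OF bij, symmetric])
  also have "\<dots> = (\<Sum>p | p permutes UNIV. of_int (sign p) * (\<Prod>i\<in>UNIV. A $ i $ p i))"
  proof (intro sum.cong refl arg_cong2[of _ _ _ _ "(*)"])
    fix p assume "p \<in> {p. p permutes (UNIV :: 'm set)}"
    then show "of_int (sign (r \<circ> p \<circ> inv r)) = (of_int (sign p) :: real)"
      using sign_conjugate[OF assms perm] by auto
    have "(\<Prod>i\<in>UNIV. A $ inv r i $ p (inv r i)) = (\<Prod>i\<in>UNIV. A $ i $ p i)"
      by (rule prod.reindex_bij_betw[OF bi])
    then show "(\<Prod>i\<in>UNIV. A $ inv r i $ inv r ((r \<circ> p \<circ> inv r) i)) = (\<Prod>i\<in>UNIV. A $ i $ p i)"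
      by (simp add: inv)
  qed
  also have "\<dots> = det A" by (simp add: det_def)
  finally show ?thesis .
qed

text \<open>Both sides are finite and equal, or both infinite, since the image has finite measure exactly if the
  Jacobian is integrable.\<close>

lemma emeasure_differentiable_image_wellorder:
  fixes f :: "real ^ 'm::{finite,wellorder} \<Rightarrow> real ^ 'm::_"
  assumes B: "B \<in> sets borel" "f ` B \<in> sets borel"
    and f: "\<And>x. x \<in> B \<Longrightarrow> (f has_derivative f' x) (at x)" "inj_on f B"
    and meas: "(\<lambda>x. indicator B x * \<bar>det (matrix (f' x))\<bar>) \<in> borel_measurable borel"
  shows "emeasure lborel (f ` B) = (\<integral>\<^sup>+x\<in>B. ennreal \<bar>det (matrix (f' x))\<bar> \<partial>lborel)"
proof -
  let ?D = "\<lambda>x. \<bar>det (matrix (f' x))\<bar>"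
  let ?I = "\<integral>\<^sup>+x\<in>B. ennreal (?D x) \<partial>lborel"
  have eq: "f ` B \<in> lmeasurable \<and> measure lebesgue (f ` B) = m \<longleftrightarrow> (?D has_integral m) B" for m
    by (rule has_measure_differentiable_image) (use B f in \<open>auto intro: has_derivative_at_withinI\<close>)
  have em: "emeasure lebesgue (f ` B) = emeasure lborel (f ` B)" using B by simp
  have I: "?I = (\<integral>\<^sup>+x. ennreal (indicator B x * ?D x) \<partial>lborel)"
    by (intro nn_integral_cong) (auto simp: indicator_def)
  show ?thesis
  proof (cases "?I = \<infinity>")
    case False
    then obtain r where r: "?I = ennreal r" "0 \<le> r" by (cases ?I rule: ennreal_cases) auto
    have "((\<lambda>x. indicator B x * ?D x) has_integral r) UNIV"
      by (rule nn_integral_has_integral[OF meas]) (use r I in auto)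
    moreover have "(\<lambda>x. indicator B x * ?D x) = (\<lambda>x. if x \<in> B then ?D x else 0)"
      by (auto simp: indicator_def)
    ultimately have "(?D has_integral r) B"
      by (simp only: has_integral_restrict_UNIV)
    then have "f ` B \<in> lmeasurable" "measure lebesgue (f ` B) = r" using eq by auto
    then show ?thesis using r em emeasure_eq_measure2[of "f ` B" lebesgue] by (simp add: fmeasurable_def)
  next
    case True
    have "emeasure lborel (f ` B) = \<infinity>"
    proof (rule ccontr)
      assume "emeasure lborel (f ` B) \<noteq> \<infinity>"
      then have "f ` B \<in> lmeasurable" using B em by (simp add: fmeasurable_def top.not_eq_extremum)
      then have "(?D has_integral measure lebesgue (f ` B)) B" using eq by blast
      from nn_integral_has_integral_lebesgue'[OF _ this] True show False by simp
    qed
    then show ?thesis using True by simp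
  qed
qed

definition reindex :: "('m \<Rightarrow> 'k) \<Rightarrow> real ^ 'm \<Rightarrow> real ^ 'k" where
  "reindex r x = (\<chi> k. x $ inv r k)"

lemma reindex_inverse:
  assumes "bij r"
  shows "reindex (inv r) (reindex r x) = x" "reindex r (reindex (inv r) y) = y"
  using assms
  by (simp_all add: reindex_def vec_eq_iff inv_inv_eq bij_is_inj bij_is_surj surj_f_inv_f)

lemma bounded_linear_reindex: "bounded_linear (reindex r :: real ^ 'm \<Rightarrow> real ^ 'k::finite)"
  unfolding linear_conv_bounded_linear[symmetric]
  by (rule linearI) (simp_all add: reindex_def vec_eq_iff)

lemma reindex_measurable [measurable]:
  "(reindex r :: real ^ 'm::finite \<Rightarrow> real ^ 'k::finite) \<in> borel_measurable borel"
  using linear_continuous_on[OF bounded_linear_reindex] by (rule borel_measurable_continuous_onI)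

text \<open>Boxes go to boxes with the same side lengths in another order.\<close>

lemma distr_lborel_reindex:
  fixes r :: "'m::finite \<Rightarrow> 'k::finite"
  assumes "bij r"
  shows "distr lborel borel (reindex r :: real ^ 'm \<Rightarrow> real ^ 'k) = lborel"
proof (rule lborel_eqI[symmetric])
  fix l u :: "real ^ 'k" assume le: "\<And>b. b \<in> Basis \<Longrightarrow> l \<bullet> b \<le> u \<bullet> b"
  have le': "l $ i \<le> u $ i" for i using le[of "axis i 1"] by (simp add: axis_in_Basis_iff inner_axis)
  have inv: "inv r (r x) = x" "r (inv r y) = y" for x y
    using assms by (simp_all add: bij_is_inj bij_is_surj surj_f_inv_f)
  have "reindex r -` box l u = box (\<chi> i. l $ r i) (\<chi> i. u $ r i)"
    by (auto simp: mem_box_cart reindex_def) (metis inv(1), metis inv(1), metis inv(2), metis inv(2))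
  then have "emeasure (distr lborel borel (reindex r)) (box l u)
      = emeasure lborel (box (\<chi> i. l $ r i) (\<chi> i. u $ r i))"
    by (simp add: emeasure_distr)
  also have "\<dots> = ennreal (\<Prod>b\<in>Basis. ((\<chi> i. u $ r i) - (\<chi> i. l $ r i)) \<bullet> b)"
    by (rule emeasure_lborel_box) (use le' in \<open>auto simp: Basis_vec_def inner_axis\<close>)
  also have "(\<Prod>b\<in>Basis. ((\<chi> i. u $ r i) - (\<chi> i. l $ r i)) \<bullet> b) = (\<Prod>i\<in>UNIV. u $ r i - l $ r i)"
    by (simp add: Basis_vec_def Basis_real_def UNION_singleton_eq_range prod.reindex axis_eq_axis inj_on_def inner_axis)
  also have "\<dots> = (\<Prod>i\<in>UNIV. u $ i - l $ i)"
    by (rule prod.reindex_bij_betw[OF assms])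
  also have "\<dots> = (\<Prod>b\<in>Basis. (u - l) \<bullet> b)"
    by (simp add: Basis_vec_def Basis_real_def UNION_singleton_eq_range prod.reindex axis_eq_axis inj_on_def inner_axis)
  finally show "emeasure (distr lborel borel (reindex r)) (box l u) = (\<Prod>b\<in>Basis. (u - l) \<bullet> b)" .
qed simp

lemma emeasure_lborel_reindex_image:
  fixes r :: "'m::finite \<Rightarrow> 'k::finite"
  assumes "bij r" "S \<in> sets borel"
  shows "reindex r ` S \<in> sets borel" "emeasure lborel (reindex r ` S :: (real ^ 'k) set) = emeasure lborel S"
proof -
  have eq: "reindex r ` S = reindex (inv r) -` S"
    using reindex_inverse[OF assms(1)] by (auto simp: image_iff) metis
  have "reindex (inv r) -` S \<in> sets borel"
    using measurable_sets[OF reindex_measurable assms(2)] by (simp add: space_borel)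
  then show 1: "reindex r ` S \<in> sets borel" by (simp add: eq)
  have "emeasure lborel (reindex r ` S) = emeasure (distr lborel borel (reindex r)) (reindex r ` S :: (real ^ 'k) set)"
    by (simp add: distr_lborel_reindex[OF assms(1)])
  also have "\<dots> = emeasure lborel (reindex r -` (reindex r ` S :: (real ^ 'k) set))"
    using 1 by (simp add: emeasure_distr)
  also have "reindex r -` (reindex r ` S :: (real ^ 'k) set) = S"
    using reindex_inverse[OF assms(1)] by (auto simp: image_iff) metis
  finally show "emeasure lborel (reindex r ` S :: (real ^ 'k) set) = emeasure lborel S" .
qed

text \<open>The map is conjugated with a renumbering of the coordinates; neither measures nor the determinant of the
  derivative change.\<close>

lemma emeasure_differentiable_image:
  fixes f :: "real ^ 'm::finite \<Rightarrow> real ^ 'm"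
  assumes B: "B \<in> sets borel" "f ` B \<in> sets borel"
    and f: "\<And>x. x \<in> B \<Longrightarrow> (f has_derivative f' x) (at x)" "inj_on f B"
    and meas: "(\<lambda>x. indicator B x * \<bar>det (matrix (f' x))\<bar>) \<in> borel_measurable borel"
  shows "emeasure lborel (f ` B) = (\<integral>\<^sup>+x\<in>B. ennreal \<bar>det (matrix (f' x))\<bar> \<partial>lborel)"
proof -
  obtain r :: "'m \<Rightarrow> 'm ordered_index" where r: "bij r" using ex_bij_ordered_index by blast
  let ?R = "reindex r" and ?R' = "reindex (inv r) :: real ^ 'm ordered_index \<Rightarrow> real ^ 'm"
  note inv = reindex_inverse[OF r]
  define F where "F y = ?R (f (?R' y))" for y
  define F' where "F' y = ?R \<circ> f' (?R' y) \<circ> ?R'" for y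
  have blR: "bounded_linear ?R" "bounded_linear ?R'" by (rule bounded_linear_reindex)+
  have lin: "linear (f' x)" if "x \<in> B" for x using f(1)[OF that] has_derivative_linear by blast
  have mat: "det (matrix (F' (?R x))) = det (matrix (f' x))" for x
  proof -
    have "?R' (axis j 1) = axis (inv r j) 1" for j
      using r by (auto simp: reindex_def vec_eq_iff axis_def inv_inv_eq bij_is_inj bij_is_surj surj_f_inv_f)
    moreover have "F' (?R x) = ?R \<circ> f' x \<circ> ?R'" by (simp add: F'_def inv)
    ultimately have "matrix (F' (?R x)) = (\<chi> i j. matrix (f' x) $ inv r i $ inv r j)"
      by (simp add: matrix_def vec_eq_iff) (simp add: reindex_def)
    then show ?thesis using det_reindex[OF r] by simp
  qed
  have FB: "F ` ?R ` B = ?R ` f ` B" by (simp add: F_def inv image_image)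
  have mem: "?R x \<in> ?R ` B \<longleftrightarrow> x \<in> B" for x
  proof
    assume "?R x \<in> ?R ` B"
    then obtain y where "y \<in> B" "?R x = ?R y" by blast
    from arg_cong[OF this(2), of ?R'] have "x = y" unfolding inv(1) .
    with \<open>y \<in> B\<close> show "x \<in> B" by (simp only:)
  qed (rule imageI)
  have ind: "indicator (?R ` B) (?R x) = (indicator B x :: real)" for x
    by (simp add: indicator_def mem)
  have cmp: "(\<lambda>y. indicator (?R ` B) y * \<bar>det (matrix (F' y))\<bar>)
      = (\<lambda>x. indicator B x * \<bar>det (matrix (f' x))\<bar>) \<circ> ?R'"
  proof
    fix y
    show "indicator (?R ` B) y * \<bar>det (matrix (F' y))\<bar>
      = ((\<lambda>x. indicator B x * \<bar>det (matrix (f' x))\<bar>) \<circ> ?R') y"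
      using ind[of "?R' y"] mat[of "?R' y"] unfolding inv(2) by (simp only: comp_apply)
  qed
  have meas': "(\<lambda>y. indicator (?R ` B) y * \<bar>det (matrix (F' y))\<bar>) \<in> borel_measurable borel"
    unfolding cmp by (rule measurable_comp[OF reindex_measurable meas])
  have "emeasure lborel (f ` B) = emeasure lborel (F ` ?R ` B)"
    unfolding FB by (rule emeasure_lborel_reindex_image(2)[OF r B(2), symmetric])
  also have "\<dots> = (\<integral>\<^sup>+y\<in>?R ` B. ennreal \<bar>det (matrix (F' y))\<bar> \<partial>lborel)"
  proof (rule emeasure_differentiable_image_wellorder)
    show "?R ` B \<in> sets borel" by (rule emeasure_lborel_reindex_image(1)[OF r B(1)])
    show "F ` ?R ` B \<in> sets borel" unfolding FB by (rule emeasure_lborel_reindex_image(1)[OF r B(2)])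
    show "(F has_derivative F' y) (at y)" if "y \<in> ?R ` B" for y
    proof -
      have "?R' y \<in> B" using that inv by auto
      from f(1)[OF this] have "(f has_derivative f' (?R' y)) (at (?R' y))" .
      from has_derivative_compose[OF bounded_linear_imp_has_derivative[OF blR(2)] this]
      have "((\<lambda>y. f (?R' y)) has_derivative (\<lambda>v. f' (?R' y) (?R' v))) (at y)" .
      from bounded_linear.has_derivative[OF blR(1) this]
      show ?thesis by (simp add: F_def[abs_def] F'_def o_def)
    qed
    show "inj_on F (?R ` B)"
    proof (rule inj_onI)
      fix y z assume "y \<in> ?R ` B" "z \<in> ?R ` B" and eq: "F y = F z"
      then have yz: "?R' y \<in> B" "?R' z \<in> B" by (auto simp only: inv(1) image_iff)
      from arg_cong[OF eq, of ?R'] have "f (?R' y) = f (?R' z)" unfolding F_def inv(1) .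
      then have "?R' y = ?R' z" using f(2) yz by (simp only: inj_on_eq_iff)
      from arg_cong[OF this, of ?R] show "y = z" unfolding inv(2) .
    qed
  qed (rule meas')
  also have "\<dots> = (\<integral>\<^sup>+y. ennreal (indicator (?R ` B) y * \<bar>det (matrix (F' y))\<bar>) \<partial>distr lborel borel ?R)"
    by (simp only: distr_lborel_reindex[OF r]) (intro nn_integral_cong, auto simp: indicator_def)
  also have "\<dots> = (\<integral>\<^sup>+x. ennreal (indicator (?R ` B) (?R x) * \<bar>det (matrix (F' (?R x)))\<bar>) \<partial>lborel)"
    by (rule nn_integral_distr) (use meas' in simp_all)
  also have "\<dots> = (\<integral>\<^sup>+x\<in>B. ennreal \<bar>det (matrix (f' x))\<bar> \<partial>lborel)"
    unfolding mat ind by (intro nn_integral_cong) (auto simp: indicator_def)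
  finally show ?thesis .
qed

section \<open>Charts and smooth families of maps\<close>

lemma atlas_chart:
  assumes "smooth_atlas A" "c \<in> A"
  shows "open (dom_chart c)" "open (codom_chart c)"
    "continuous_on (dom_chart c) (coord c)" "continuous_on (codom_chart c) (inv_coord c)"
    "\<And>p. p \<in> dom_chart c \<Longrightarrow> inv_coord c (coord c p) = p"
    "\<And>p. p \<in> dom_chart c \<Longrightarrow> coord c p \<in> codom_chart c"
    "\<And>x. x \<in> codom_chart c \<Longrightarrow> coord c (inv_coord c x) = x"
    "\<And>x. x \<in> codom_chart c \<Longrightarrow> inv_coord c x \<in> dom_chart c"
proof -
  have *: "open (dom_chart c)" "open (codom_chart c)"
     "homeomorphism (dom_chart c) (codom_chart c) (coord c) (inv_coord c)"
    using assms unfolding smooth_atlas_def by blast+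
  show "open (dom_chart c)" "open (codom_chart c)" by (rule *)+
  show "continuous_on (dom_chart c) (coord c)" "continuous_on (codom_chart c) (inv_coord c)"
    "\<And>p. p \<in> dom_chart c \<Longrightarrow> inv_coord c (coord c p) = p"
    "\<And>p. p \<in> dom_chart c \<Longrightarrow> coord c p \<in> codom_chart c"
    "\<And>x. x \<in> codom_chart c \<Longrightarrow> coord c (inv_coord c x) = x"
    "\<And>x. x \<in> codom_chart c \<Longrightarrow> inv_coord c x \<in> dom_chart c"
    using *(3) unfolding homeomorphism_def by blast+
qed

lemma atlas_cover:
  assumes "smooth_atlas A"
  obtains c where "c \<in> A" "p \<in> dom_chart c"
  using assms unfolding smooth_atlas_def by blast

lemma chart_image_eq:
  assumes "smooth_atlas A" "c \<in> A"
  shows "coord c ` (dom_chart c \<inter> S) = {x \<in> codom_chart c. inv_coord c x \<in> S}"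
proof (intro equalityI subsetI)
  fix x assume "x \<in> coord c ` (dom_chart c \<inter> S)"
  then show "x \<in> {x \<in> codom_chart c. inv_coord c x \<in> S}"
    using atlas_chart[OF assms] by auto
next
  fix x assume x: "x \<in> {x \<in> codom_chart c. inv_coord c x \<in> S}"
  then have "x = coord c (inv_coord c x)" "inv_coord c x \<in> dom_chart c \<inter> S"
    using atlas_chart(7,8)[OF assms] by auto
  then show "x \<in> coord c ` (dom_chart c \<inter> S)" by (rule image_eqI)
qed

lemma open_preimage_within:
  assumes "open S" "continuous_on S f" "open T"
  shows "open {x \<in> S. f x \<in> T}"
proof -
  have "open (f -` T \<inter> S)"
    using continuous_on_open_vimage[OF assms(1)] assms(2,3) by blast
  also have "f -` T \<inter> S = {x \<in> S. f x \<in> T}" by blast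
  finally show ?thesis .
qed

lemma open_chart_image:
  assumes "smooth_atlas A" "c \<in> A" "open S"
  shows "open (coord c ` (dom_chart c \<inter> S))"
  unfolding chart_image_eq[OF assms(1,2)]
  by (intro open_preimage_within atlas_chart[OF assms(1,2)] assms(3))

lemma smooth_transition:
  assumes "smooth_atlas A" "c \<in> A" "d \<in> A"
  shows "smooth_on {x \<in> codom_chart c. inv_coord c x \<in> dom_chart d} (\<lambda>x. coord d (inv_coord c x))"
  using assms unfolding chart_image_eq[OF assms(1,2), symmetric] smooth_atlas_def o_def by blast

text \<open>The pairs \<open>(t, x)\<close> for which the expression of \<open>U t\<close> in the charts
  \<open>c\<close> and \<open>d\<close> makes sense at \<open>x\<close>.\<close>

definition family_domain ::
  "real \<Rightarrow> ('a, 'm::finite) chart \<Rightarrow> ('b, 'n::finite) chart \<Rightarrow> (real \<Rightarrow> 'a \<Rightarrow> 'b) \<Rightarrow> (real \<times> (real ^ 'm)) set" where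
  "family_domain \<epsilon> c d U =
     {(t, x). t \<in> {-\<epsilon><..<\<epsilon>} \<and> x \<in> codom_chart c \<and> U t (inv_coord c x) \<in> dom_chart d}"

text \<open>The joint smoothness demanded of a variation, over a named interval and with no prescribed map at time 0.
  In this form families can be composed, and families of maps of the target act on maps into it.\<close>

definition smooth_family ::
  "('a::{t2_space, second_countable_topology}, 'm::finite) mfd \<Rightarrow>
   ('b::{t2_space, second_countable_topology}, 'n::finite) mfd \<Rightarrow> (real \<Rightarrow> 'a \<Rightarrow> 'b) \<Rightarrow> real \<Rightarrow> bool" where
  "smooth_family M N U \<epsilon> \<longleftrightarrow>
     continuous_on ({-\<epsilon><..<\<epsilon>} \<times> UNIV) (\<lambda>(t, p). U t p) \<and>
     (\<forall>c\<in>charts M. \<forall>d\<in>charts N.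
        smooth_on (family_domain \<epsilon> c d U) (\<lambda>(t, x). coord d (U t (inv_coord c x))))"

lemma continuous_on_family_chart:
  assumes "smooth_atlas A" "c \<in> A"
    and "continuous_on ({-\<epsilon><..<\<epsilon>} \<times> UNIV) (\<lambda>(t, p). U t p)"
  shows "continuous_on ({-\<epsilon><..<\<epsilon>} \<times> codom_chart c) (\<lambda>z. U (fst z) (inv_coord c (snd z)))"
proof -
  have "continuous_on ({-\<epsilon><..<\<epsilon>} \<times> codom_chart c) (\<lambda>z. (fst z, inv_coord c (snd z)))"
    by (intro continuous_on_Pair continuous_on_fst continuous_on_id
        continuous_on_compose2[OF atlas_chart(4)[OF assms(1,2)]] continuous_on_snd) auto
  from continuous_on_compose2[OF assms(3) this] show ?thesis by (auto simp: image_subset_iff)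
qed

lemma smooth_familyD:
  assumes "smooth_family M N U \<epsilon>"
  shows "continuous_on ({-\<epsilon><..<\<epsilon>} \<times> UNIV) (\<lambda>(t, p). U t p)"
    "c \<in> charts M \<Longrightarrow> d \<in> charts N \<Longrightarrow>
      smooth_on (family_domain \<epsilon> c d U) (\<lambda>z. coord d (U (fst z) (inv_coord c (snd z))))"
  using assms unfolding smooth_family_def case_prod_beta' by blast+

lemma open_family_domain:
  assumes "smooth_atlas A" "c \<in> A" "smooth_atlas A'" "d \<in> A'"
    and "continuous_on ({-\<epsilon><..<\<epsilon>} \<times> UNIV) (\<lambda>(t, p). U t p)"
  shows "open (family_domain \<epsilon> c d U)"
proof -
  have "family_domain \<epsilon> c d U =
      {z \<in> {-\<epsilon><..<\<epsilon>} \<times> codom_chart c. U (fst z) (inv_coord c (snd z)) \<in> dom_chart d}"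
    by (auto simp: family_domain_def)
  then show ?thesis
    using open_preimage_within[OF _ continuous_on_family_chart[OF assms(1,2,5)] atlas_chart(1)[OF assms(3,4)]]
      atlas_chart(2)[OF assms(1,2)] by (simp add: open_Times)
qed

text \<open>One pair of charts near every point is enough, as the expressions in other charts arise by composing with
  transition maps. A composition of families can therefore be checked in a chart of the middle manifold that is chosen
  for the point at hand.\<close>

lemma smooth_familyI_local:
  fixes M :: "('a::{t2_space, second_countable_topology}, 'm::finite) mfd"
    and N :: "('b::{t2_space, second_countable_topology}, 'n::finite) mfd"
  assumes A: "smooth_atlas (charts M)" "smooth_atlas (charts N)"
    and cont: "continuous_on ({-\<epsilon><..<\<epsilon>} \<times> UNIV) (\<lambda>(t, p). U t p)"
    and loc: "\<And>t p. t \<in> {-\<epsilon><..<\<epsilon>} \<Longrightarrow> \<exists>c\<in>charts M. \<exists>d\<in>charts N. \<exists>W. p \<in> dom_chart c \<and> open W \<and>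
      (t, coord c p) \<in> W \<and> W \<subseteq> family_domain \<epsilon> c d U \<and>
      smooth_on W (\<lambda>(t, x). coord d (U t (inv_coord c x)))"
  shows "smooth_family M N U \<epsilon>"
  unfolding smooth_family_def
proof (intro conjI cont ballI smooth_on_local)
  fix c' d' z assume c': "c' \<in> charts M" and d': "d' \<in> charts N" and z: "z \<in> family_domain \<epsilon> c' d' U"
  obtain t x' where tx: "z = (t, x')" by fastforce
  define p where "p = inv_coord c' x'"
  have t: "t \<in> {-\<epsilon><..<\<epsilon>}" and x': "x' \<in> codom_chart c'" and U: "U t p \<in> dom_chart d'"
    using z by (auto simp: tx family_domain_def p_def)
  obtain c d W where c: "c \<in> charts M" "p \<in> dom_chart c" and d: "d \<in> charts N"
    and W: "open W" "(t, coord c p) \<in> W" "W \<subseteq> family_domain \<epsilon> c d U"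
      "smooth_on W (\<lambda>(t, x). coord d (U t (inv_coord c x)))"
    using loc[OF t, of p] by blast
  note ac = atlas_chart[OF A(1) c(1)] and ac' = atlas_chart[OF A(1) c']
    and ad = atlas_chart[OF A(2) d] and ad' = atlas_chart[OF A(2) d']
  define P where "P = {x \<in> codom_chart c'. inv_coord c' x \<in> dom_chart c}"
  have oP: "open P" unfolding P_def by (intro open_preimage_within ac ac')
  define \<tau> where "\<tau> z = (fst z, coord c (inv_coord c' (snd z)))" for z :: "real \<times> (real ^ 'm)"
  have oUP: "open (UNIV \<times> P :: (real \<times> (real ^ 'm)) set)" using oP by (simp add: open_Times)
  have s\<tau>: "smooth_on (UNIV \<times> P) \<tau>" unfolding \<tau>_def
  proof (intro smooth_on_Pair oUP smooth_on_fst smooth_on_id)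
    show "smooth_on (UNIV \<times> P) (\<lambda>z :: real \<times> (real ^ 'm). coord c (inv_coord c' (snd z)))"
      using smooth_on_compose[OF oUP oP smooth_on_snd[OF oUP smooth_on_id[OF oUP]]
          smooth_transition[OF A(1) c' c(1), folded P_def]] by auto
  qed
  \<comment> \<open>On \<open>T\<close> the expression in the charts \<open>c'\<close>, \<open>d'\<close> is the given one between two transition maps.\<close>
  define T where "T = family_domain \<epsilon> c' d' U \<inter> {z \<in> UNIV \<times> P. \<tau> z \<in> W}"
  have oT: "open T"
    unfolding T_def by (intro open_Int open_family_domain[OF A(1) c' A(2) d' cont]
        open_preimage_within oUP smooth_on_continuous s\<tau> W)
  define Q where "Q = {y \<in> codom_chart d. inv_coord d y \<in> dom_chart d'}"
  have oQ: "open Q" unfolding Q_def by (intro open_preimage_within ad ad')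
  have zT: "z \<in> T"
    using z W(2) x' c(2) by (simp add: T_def \<tau>_def tx P_def p_def[symmetric])
  have maps: "\<tau> w \<in> W" "(case \<tau> w of (t, x) \<Rightarrow> coord d (U t (inv_coord c x))) \<in> Q"
    "coord d' (inv_coord d (case \<tau> w of (t, x) \<Rightarrow> coord d (U t (inv_coord c x))))
      = (case w of (t, x) \<Rightarrow> coord d' (U t (inv_coord c' x)))" if w: "w \<in> T" for w
  proof -
    obtain s x where sx: "w = (s, x)" by fastforce
    have xP: "x \<in> P" and fw: "w \<in> family_domain \<epsilon> c' d' U" and \<tau>W: "\<tau> w \<in> W"
      using w by (auto simp: T_def sx)
    have inv: "inv_coord c (coord c (inv_coord c' x)) = inv_coord c' x"
      using xP by (intro ac) (auto simp: P_def)
    have "\<tau> w \<in> family_domain \<epsilon> c d U" using \<tau>W W(3) by blast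
    then have d1: "U s (inv_coord c' x) \<in> dom_chart d" by (simp add: \<tau>_def sx family_domain_def inv)
    have d2: "U s (inv_coord c' x) \<in> dom_chart d'" using fw by (simp add: sx family_domain_def)
    show "\<tau> w \<in> W" by (rule \<tau>W)
    have eq: "(case \<tau> w of (t, x) \<Rightarrow> coord d (U t (inv_coord c x))) = coord d (U s (inv_coord c' x))"
      by (simp add: \<tau>_def sx inv)
    show "(case \<tau> w of (t, x) \<Rightarrow> coord d (U t (inv_coord c x))) \<in> Q"
      unfolding eq Q_def using d1 d2 ad(5,6)[OF d1] by simp
    show "coord d' (inv_coord d (case \<tau> w of (t, x) \<Rightarrow> coord d (U t (inv_coord c x))))
      = (case w of (t, x) \<Rightarrow> coord d' (U t (inv_coord c' x)))"
      unfolding eq using ad(5)[OF d1] by (simp add: sx)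
  qed
  have "smooth_on T (\<lambda>w. case \<tau> w of (t, x) \<Rightarrow> coord d (U t (inv_coord c x)))"
  proof (rule smooth_on_compose[OF oT W(1) _ W(4)])
    show "smooth_on T \<tau>" by (rule smooth_on_subset[OF s\<tau>]) (auto simp: T_def)
  qed (rule maps(1))
  from smooth_on_compose[OF oT oQ this smooth_transition[OF A(2) d d', folded Q_def] maps(2)]
  have "smooth_on T (\<lambda>w. coord d' (inv_coord d (case \<tau> w of (t, x) \<Rightarrow> coord d (U t (inv_coord c x)))))"
    by blast
  from smooth_on_cong[OF oT maps(3) this]
  have "smooth_on T (\<lambda>(t, x). coord d' (U t (inv_coord c' x)))" .
  with oT zT show "\<exists>T. open T \<and> z \<in> T \<and> smooth_on T (\<lambda>(t, x). coord d' (U t (inv_coord c' x)))"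
    by blast
qed

lemma smooth_family_compose:
  fixes M :: "('a::{t2_space, second_countable_topology}, 'm::finite) mfd"
    and N :: "('b::{t2_space, second_countable_topology}, 'n::finite) mfd"
    and P :: "('c::{t2_space, second_countable_topology}, 'k::finite) mfd"
  assumes A: "smooth_atlas (charts M)" "smooth_atlas (charts N)" "smooth_atlas (charts P)"
    and U: "smooth_family M N U \<epsilon>" and \<phi>: "smooth_family N P \<phi> \<epsilon>"
  shows "smooth_family M P (\<lambda>t p. \<phi> t (U t p)) \<epsilon>"
proof (rule smooth_familyI_local[OF A(1,3)])
  let ?I = "{-\<epsilon><..<\<epsilon>}"
  have cU: "continuous_on (?I \<times> UNIV) (\<lambda>(t, p). U t p)" and c\<phi>: "continuous_on (?I \<times> UNIV) (\<lambda>(t, p). \<phi> t p)"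
    using U \<phi> by (blast dest: smooth_familyD)+
  have "continuous_on (?I \<times> UNIV) (\<lambda>z. (fst z, case z of (t, p) \<Rightarrow> U t p))"
    by (intro continuous_on_Pair continuous_on_fst continuous_on_id cU)
  from continuous_on_compose2[OF c\<phi> this]
  show cc: "continuous_on (?I \<times> UNIV) (\<lambda>(t, p). \<phi> t (U t p))"
    by (auto simp: case_prod_beta' image_subset_iff)
  fix t p assume t: "t \<in> ?I"
  obtain c where c: "c \<in> charts M" "p \<in> dom_chart c" using atlas_cover[OF A(1)] .
  obtain d where d: "d \<in> charts N" "U t p \<in> dom_chart d" using atlas_cover[OF A(2)] .
  obtain e where e: "e \<in> charts P" "\<phi> t (U t p) \<in> dom_chart e" using atlas_cover[OF A(3)] .
  note ac = atlas_chart[OF A(1) c(1)] and ad = atlas_chart[OF A(2) d(1)]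
  define W where "W = family_domain \<epsilon> c d U \<inter> family_domain \<epsilon> c e (\<lambda>t p. \<phi> t (U t p))"
  have oW: "open W" unfolding W_def
    by (intro open_Int open_family_domain[OF A(1) c(1) A(2) d(1) cU] open_family_domain[OF A(1) c(1) A(3) e(1) cc])
  define g where "g z = (fst z, coord d (U (fst z) (inv_coord c (snd z))))" for z :: "real \<times> (real ^ 'm)"
  have "smooth_on (family_domain \<epsilon> c d U) (\<lambda>z. coord d (U (fst z) (inv_coord c (snd z))))"
    by (rule smooth_familyD(2)[OF U c(1) d(1)])
  then have "smooth_on W (\<lambda>z. coord d (U (fst z) (inv_coord c (snd z))))"
    by (rule smooth_on_subset) (simp add: W_def)
  then have sg: "smooth_on W g" unfolding g_def
    by (intro smooth_on_Pair oW smooth_on_fst smooth_on_id)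
  have s\<phi>: "smooth_on (family_domain \<epsilon> d e \<phi>) (\<lambda>(t, x). coord e (\<phi> t (inv_coord d x)))"
    using \<phi> d(1) e(1) by (auto simp: smooth_family_def)
  have g1: "g z \<in> family_domain \<epsilon> d e \<phi>" "(case g z of (t, x) \<Rightarrow> coord e (\<phi> t (inv_coord d x)))
      = (case z of (t, x) \<Rightarrow> coord e (\<phi> t (U t (inv_coord c x))))" if "z \<in> W" for z
    using that ad(5,6) by (auto simp: W_def g_def family_domain_def)
  have "smooth_on W (\<lambda>(t, x). coord e (\<phi> t (U t (inv_coord c x))))"
    by (rule smooth_on_cong[OF oW g1(2)
        smooth_on_compose[OF oW open_family_domain[OF A(2) d(1) A(3) e(1) c\<phi>] sg s\<phi> g1(1)]])
  moreover have "(t, coord c p) \<in> W"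
    using t c d e ac by (auto simp: W_def family_domain_def)
  ultimately show "\<exists>c\<in>charts M. \<exists>e\<in>charts P. \<exists>W. p \<in> dom_chart c \<and> open W \<and>
      (t, coord c p) \<in> W \<and> W \<subseteq> family_domain \<epsilon> c e (\<lambda>t p. \<phi> t (U t p)) \<and>
      smooth_on W (\<lambda>(t, x). coord e (\<phi> t (U t (inv_coord c x))))"
    using c(1) e(1) c(2) oW by (intro bexI[of _ c] bexI[of _ e] exI[of _ W]) (auto simp: W_def)
qed

lemma smooth_family_mono:
  assumes "smooth_family M N U \<epsilon>" "\<delta> \<le> \<epsilon>"
  shows "smooth_family M N U \<delta>"
proof -
  have 1: "{-\<delta><..<\<delta>} \<times> UNIV \<subseteq> {-\<epsilon><..<\<epsilon>} \<times> UNIV" using assms(2) by auto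
  have 2: "family_domain \<delta> c d U \<subseteq> family_domain \<epsilon> c d U" for c d
    using assms(2) by (auto simp: family_domain_def)
  show ?thesis
    using assms(1) continuous_on_subset[OF _ 1] smooth_on_subset[OF _ 2] unfolding smooth_family_def
    by blast
qed

lemma smooth_family_constant:
  assumes A: "smooth_atlas (charts M)" "smooth_atlas (charts N)" and u: "smooth_map M N u"
  shows "smooth_family M N (\<lambda>t. u) \<epsilon>"
  unfolding smooth_family_def
proof (intro conjI ballI)
  have cu: "continuous_on UNIV u" using u by (simp add: smooth_map_def)
  have "continuous_on ({-\<epsilon><..<\<epsilon>} \<times> UNIV) (\<lambda>z. u (snd z))"
    by (rule continuous_on_compose2[OF cu]) (auto intro: continuous_on_snd continuous_on_id)
  then show cc: "continuous_on ({-\<epsilon><..<\<epsilon>} \<times> UNIV) (\<lambda>(t, p). u p)" by (simp add: case_prod_beta')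
  fix c d assume cd: "c \<in> charts M" "d \<in> charts N"
  let ?Q = "coord c ` (dom_chart c \<inter> u -` dom_chart d)"
  have oQ: "open ?Q"
    by (intro open_chart_image[OF A(1) cd(1)] open_vimage atlas_chart(1)[OF A(2) cd(2)])
      (use cu in simp)
  have oF: "open (family_domain \<epsilon> c d (\<lambda>t. u))"
    by (rule open_family_domain[OF A(1) cd(1) A(2) cd(2) cc])
  have su: "smooth_on ?Q (\<lambda>x. coord d (u (inv_coord c x)))"
    using u cd by (auto simp: smooth_map_def o_def)
  have "smooth_on (family_domain \<epsilon> c d (\<lambda>t. u)) (\<lambda>z. coord d (u (inv_coord c (snd z))))"
    by (rule smooth_on_compose[OF oF oQ smooth_on_snd[OF oF smooth_on_id[OF oF]] su])
      (auto simp: family_domain_def chart_image_eq[OF A(1) cd(1)])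
  then show "smooth_on (family_domain \<epsilon> c d (\<lambda>t. u)) (\<lambda>(t, x). coord d (u (inv_coord c x)))"
    by (simp add: case_prod_beta')
qed

definition smooth_function ::
  "('a::{t2_space, second_countable_topology}, 'm::finite) mfd \<Rightarrow> ('a \<Rightarrow> 'v::euclidean_space) \<Rightarrow> bool" where
  "smooth_function M f \<longleftrightarrow> (\<forall>c\<in>charts M. smooth_on (codom_chart c) (\<lambda>x. f (inv_coord c x)))"

text \<open>Time-dependent functions with values in a Euclidean space: the densities on \<open>M\<close>, and the
  families of maps of \<open>N\<close> once they are composed with the immersion.\<close>

definition smooth_evolution ::
  "('a::{t2_space, second_countable_topology}, 'm::finite) mfd \<Rightarrow> (real \<Rightarrow> 'a \<Rightarrow> 'v::euclidean_space) \<Rightarrow> real \<Rightarrow> bool" where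
  "smooth_evolution M g \<epsilon> \<longleftrightarrow>
     (\<forall>c\<in>charts M. smooth_on ({-\<epsilon><..<\<epsilon>} \<times> codom_chart c) (\<lambda>(t, x). g t (inv_coord c x)))"

text \<open>Composition with a function on the target turns a family of maps into functions, after which charts of the
  target no longer occur.\<close>

lemma smooth_evolution_compose:
  fixes M :: "('a::{t2_space, second_countable_topology}, 'm::finite) mfd"
    and N :: "('b::{t2_space, second_countable_topology}, 'n::finite) mfd"
  assumes A: "smooth_atlas (charts M)" "smooth_atlas (charts N)"
    and U: "smooth_family M N U \<epsilon>" and f: "smooth_function N f"
  shows "smooth_evolution M (\<lambda>t p. f (U t p)) \<epsilon>"
  unfolding smooth_evolution_def
proof (intro ballI smooth_on_local)
  fix c z assume c: "c \<in> charts M" and z: "z \<in> {-\<epsilon><..<\<epsilon>} \<times> codom_chart c"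
  obtain d where d: "d \<in> charts N" "U (fst z) (inv_coord c (snd z)) \<in> dom_chart d" using atlas_cover[OF A(2)] .
  note ac = atlas_chart[OF A(1) c(1)] and ad = atlas_chart[OF A(2) d(1)]
  let ?W = "family_domain \<epsilon> c d U"
  have oW: "open ?W"
    using U by (intro open_family_domain[OF A(1) c(1) A(2) d(1)]) (simp add: smooth_family_def)
  have "smooth_on ?W (\<lambda>z. coord d (U (fst z) (inv_coord c (snd z))))"
    by (rule smooth_familyD(2)[OF U c(1) d(1)])
  moreover have "smooth_on (codom_chart d) (\<lambda>y. f (inv_coord d y))"
    using f d by (simp add: smooth_function_def)
  ultimately have "smooth_on ?W (\<lambda>z. f (inv_coord d (coord d (U (fst z) (inv_coord c (snd z))))))"
    by (rule smooth_on_compose[OF oW ad(2)]) (use ad in \<open>auto simp: family_domain_def\<close>)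
  from smooth_on_cong[OF oW _ this, of "\<lambda>(t, x). f (U t (inv_coord c x))"]
  have "smooth_on ?W (\<lambda>(t, x). f (U t (inv_coord c x)))"
    using ad(5) by (auto simp: family_domain_def)
  moreover have "z \<in> ?W" using z d by (auto simp: family_domain_def)
  ultimately show "\<exists>T. open T \<and> z \<in> T \<and> smooth_on T (\<lambda>(t, x). f (U t (inv_coord c x)))"
    using oW by blast
qed

lemma open_evolution_domain:
  "smooth_atlas A \<Longrightarrow> c \<in> A \<Longrightarrow> open ({-\<epsilon><..<\<epsilon>::real} \<times> codom_chart c)"
  by (simp add: open_Times atlas_chart(2))

lemma has_vector_derivative_partial:
  fixes g :: "real \<times> 'a::euclidean_space \<Rightarrow> 'v::euclidean_space"
  assumes "(g has_derivative g') (at (t, x))"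
  shows "((\<lambda>s. g (s, x)) has_vector_derivative g' (1, 0)) (at t)"
proof -
  have "((\<lambda>s. (s, x)) has_derivative (\<lambda>s. (s, 0))) (at t)"
    by (auto intro!: derivative_eq_intros)
  from has_derivative_compose[OF this assms]
  have "((\<lambda>s. g (s, x)) has_derivative (\<lambda>s. g' (s, 0))) (at t)" .
  moreover have "(\<lambda>s. g' (s, 0)) = (\<lambda>s. s *\<^sub>R g' (1, 0))"
  proof
    fix s
    have "g' (s *\<^sub>R (1, 0)) = s *\<^sub>R g' (1, 0)"
      by (rule linear_scale[OF has_derivative_linear[OF assms]])
    then show "g' (s, 0) = s *\<^sub>R g' (1, 0)" by (simp only: scaleR_Pair real_scaleR_def mult_1_right scaleR_zero_right)
  qed
  ultimately show ?thesis by (simp only: has_vector_derivative_def)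
qed

lemma smooth_evolution_has_time_derivative:
  fixes M :: "('a::{t2_space, second_countable_topology}, 'm::finite) mfd"
  assumes A: "smooth_atlas (charts M)" and g: "smooth_evolution M g \<epsilon>" and t: "t \<in> {-\<epsilon><..<\<epsilon>}"
  shows "((\<lambda>s. g s p) has_vector_derivative vector_derivative (\<lambda>s. g s p) (at t)) (at t)"
    and "c \<in> charts M \<Longrightarrow> x \<in> codom_chart c \<Longrightarrow> vector_derivative (\<lambda>s. g s (inv_coord c x)) (at t) =
      frechet_derivative (\<lambda>(t, x). g t (inv_coord c x)) (at (t, x)) (1, 0)"
proof -
  have *: "((\<lambda>s. g s (inv_coord c x)) has_vector_derivative
     frechet_derivative (\<lambda>(t, x). g t (inv_coord c x)) (at (t, x)) (1, 0)) (at t)"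
    if c: "c \<in> charts M" and x: "x \<in> codom_chart c" for c x
  proof -
    have "smooth_on ({-\<epsilon><..<\<epsilon>} \<times> codom_chart c) (\<lambda>(t, x). g t (inv_coord c x))"
      using g c by (simp add: smooth_evolution_def)
    from has_vector_derivative_partial[OF smooth_on_has_derivative[OF this, of "(t, x)"]] t x
    show ?thesis by simp
  qed
  obtain c0 where c0: "c0 \<in> charts M" "p \<in> dom_chart c0" using atlas_cover[OF A] .
  from *[OF c0(1) atlas_chart(6)[OF A c0]] show "((\<lambda>s. g s p) has_vector_derivative vector_derivative (\<lambda>s. g s p) (at t)) (at t)"
    unfolding atlas_chart(5)[OF A c0] by (simp add: vector_derivative_at)
  show "c \<in> charts M \<Longrightarrow> x \<in> codom_chart c \<Longrightarrow> vector_derivative (\<lambda>s. g s (inv_coord c x)) (at t) =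
      frechet_derivative (\<lambda>(t, x). g t (inv_coord c x)) (at (t, x)) (1, 0)"
    using * by (rule vector_derivative_at)
qed

lemma smooth_evolution_time_derivative:
  fixes M :: "('a::{t2_space, second_countable_topology}, 'm::finite) mfd"
  assumes A: "smooth_atlas (charts M)" and g: "smooth_evolution M g \<epsilon>"
  shows "smooth_evolution M (\<lambda>t p. vector_derivative (\<lambda>s. g s p) (at t)) \<epsilon>"
  unfolding smooth_evolution_def
proof
  fix c assume c: "c \<in> charts M"
  let ?S = "{-\<epsilon><..<\<epsilon>} \<times> codom_chart c"
  have "smooth_on ?S (\<lambda>(t, x). g t (inv_coord c x))"
    using g c by (simp add: smooth_evolution_def)
  from smooth_on_frechet[OF this, of "(1, 0)"]
  show "smooth_on ?S (\<lambda>(t, x). vector_derivative (\<lambda>s. g s (inv_coord c x)) (at t))"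
  proof (rule smooth_on_cong[OF open_evolution_domain[OF A c], rotated])
    fix z assume "z \<in> ?S"
    then obtain t x where z: "z = (t, x)" "t \<in> {-\<epsilon><..<\<epsilon>}" "x \<in> codom_chart c" by auto
    show "frechet_derivative (\<lambda>(t, x). g t (inv_coord c x)) (at z) (1, 0)
      = (case z of (t, x) \<Rightarrow> vector_derivative (\<lambda>s. g s (inv_coord c x)) (at t))"
      using smooth_evolution_has_time_derivative(2)[OF A g z(2) c z(3)] by (simp add: z(1))
  qed
qed

lemma smooth_evolution_at:
  fixes M :: "('a::{t2_space, second_countable_topology}, 'm::finite) mfd"
  assumes A: "smooth_atlas (charts M)" and g: "smooth_evolution M g \<epsilon>" and t: "t \<in> {-\<epsilon><..<\<epsilon>}"
  shows "smooth_function M (g t)"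
  unfolding smooth_function_def
proof
  fix c assume c: "c \<in> charts M"
  have oc: "open (codom_chart c)" using atlas_chart(2)[OF A c] .
  have "smooth_on ({-\<epsilon><..<\<epsilon>} \<times> codom_chart c) (\<lambda>(t, x). g t (inv_coord c x))"
    using g c by (simp add: smooth_evolution_def)
  from smooth_on_compose[OF oc open_evolution_domain[OF A c] _ this, of "\<lambda>x. (t, x)"]
  show "smooth_on (codom_chart c) (\<lambda>x. g t (inv_coord c x))"
    using t smooth_on_Pair[OF oc smooth_on_const smooth_on_id[OF oc]] by auto
qed

lemma smooth_evolution_continuous:
  fixes M :: "('a::{t2_space, second_countable_topology}, 'm::finite) mfd"
  assumes A: "smooth_atlas (charts M)" and g: "smooth_evolution M g \<epsilon>"
  shows "continuous_on ({-\<epsilon><..<\<epsilon>} \<times> UNIV) (\<lambda>(t, p). g t p)"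
proof -
  have "continuous_on (\<Union>c\<in>charts M. {-\<epsilon><..<\<epsilon>} \<times> dom_chart c) (\<lambda>(t, p). g t p)"
  proof (rule continuous_on_open_UN)
    fix c assume c: "c \<in> charts M"
    note ac = atlas_chart[OF A c]
    show "open ({-\<epsilon><..<\<epsilon>} \<times> dom_chart c)" using ac(1) by (simp add: open_Times)
    have "continuous_on ({-\<epsilon><..<\<epsilon>} \<times> codom_chart c) (\<lambda>(t, x). g t (inv_coord c x))"
      using g c smooth_on_continuous by (auto simp: smooth_evolution_def)
    moreover have "continuous_on ({-\<epsilon><..<\<epsilon>} \<times> dom_chart c) (\<lambda>z. (fst z, coord c (snd z)))"
      by (intro continuous_on_Pair continuous_on_fst continuous_on_id
        continuous_on_compose2[OF ac(3)] continuous_on_snd) auto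
    ultimately have "continuous_on ({-\<epsilon><..<\<epsilon>} \<times> dom_chart c)
        (\<lambda>z. case (fst z, coord c (snd z)) of (t, x) \<Rightarrow> g t (inv_coord c x))"
      by (rule continuous_on_compose2) (use ac in auto)
    then show "continuous_on ({-\<epsilon><..<\<epsilon>} \<times> dom_chart c) (\<lambda>(t, p). g t p)"
      by (rule continuous_on_eq) (use ac in auto)
  qed
  moreover have "(\<Union>c\<in>charts M. {-\<epsilon><..<\<epsilon>} \<times> dom_chart c) = {-\<epsilon><..<\<epsilon>} \<times> UNIV"
    using A unfolding smooth_atlas_def by blast
  ultimately show ?thesis by simp
qed

lemma smooth_function_continuous:
  fixes M :: "('a::{t2_space, second_countable_topology}, 'm::finite) mfd"
  assumes A: "smooth_atlas (charts M)" and g: "smooth_function M g"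
  shows "continuous_on UNIV g"
proof -
  have "continuous_on (\<Union>c\<in>charts M. dom_chart c) g"
  proof (rule continuous_on_open_UN)
    fix c assume c: "c \<in> charts M"
    note ac = atlas_chart[OF A c]
    show "open (dom_chart c)" by (rule ac)
    have "continuous_on (codom_chart c) (\<lambda>x. g (inv_coord c x))"
      using g c smooth_on_continuous by (auto simp: smooth_function_def)
    from continuous_on_compose2[OF this ac(3)] ac(6)
    have "continuous_on (dom_chart c) (\<lambda>p. g (inv_coord c (coord c p)))" by blast
    then show "continuous_on (dom_chart c) g" by (rule continuous_on_eq) (use ac in auto)
  qed
  moreover have "(\<Union>c\<in>charts M. dom_chart c) = UNIV"
    using A unfolding smooth_atlas_def by blast
  ultimately show ?thesis by simp
qed

text \<open>The chain rule for \<open>f \<circ> w\<close>; near the point, \<open>f \<circ> w\<close> factors through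
  the chart \<open>d\<close> because \<open>w\<close> is continuous.\<close>

lemma has_derivative_through_chart:
  fixes w :: "'a::{t2_space, second_countable_topology} \<Rightarrow> 'b::{t2_space, second_countable_topology}"
    and c :: "('a, 'm::finite) chart" and d :: "('b, 'n::finite) chart"
  assumes A: "smooth_atlas A" "c \<in> A" and A': "smooth_atlas A'" "d \<in> A'"
    and w: "continuous_on UNIV w" and p: "p \<in> dom_chart c" "w p \<in> dom_chart d"
    and dw: "(\<lambda>x. coord d (w (inv_coord c x))) differentiable (at (coord c p))"
    and f: "((\<lambda>y. f (inv_coord d y)) has_derivative f') (at (coord d (w p)))"
  shows "((\<lambda>x. f (w (inv_coord c x))) has_derivative (\<lambda>v. f' (differential c d w p v))) (at (coord c p))"
proof -
  note ac = atlas_chart[OF A] and ad = atlas_chart[OF A']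
  define S where "S = {x \<in> codom_chart c. w (inv_coord c x) \<in> dom_chart d}"
  have oS: "open S" unfolding S_def
    by (intro open_preimage_within ac ad continuous_on_compose2[OF w ac(4)]) auto
  have cp: "coord c p \<in> S" using p ac by (auto simp: S_def)
  have 1: "((\<lambda>x. coord d (w (inv_coord c x))) has_derivative differential c d w p) (at (coord c p))"
    using dw unfolding frechet_derivative_works differential_def by (simp add: o_def)
  have "((\<lambda>y. f (inv_coord d y)) has_derivative f') (at (coord d (w (inv_coord c (coord c p)))))"
    using f p ac by simp
  from has_derivative_compose[OF 1 this]
  have "((\<lambda>x. f (inv_coord d (coord d (w (inv_coord c x))))) has_derivative
    (\<lambda>v. f' (differential c d w p v))) (at (coord c p))" .
  then show ?thesis
    by (rule has_derivative_transform_within_open[OF _ oS cp]) (use ad in \<open>auto simp: S_def\<close>)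
qed

lemma transition_differentiable:
  assumes "smooth_atlas A" "c \<in> A" "d \<in> A" "p \<in> dom_chart c" "p \<in> dom_chart d"
  shows "(\<lambda>x. coord d (inv_coord c x)) differentiable (at (coord c p))"
    "((\<lambda>x. coord d (inv_coord c x)) has_derivative differential c d id p) (at (coord c p))"
proof -
  have "coord c p \<in> {x \<in> codom_chart c. inv_coord c x \<in> dom_chart d}"
    using assms atlas_chart[OF assms(1,2)] by auto
  from smooth_on_has_derivative[OF smooth_transition[OF assms(1-3)] this]
  show "((\<lambda>x. coord d (inv_coord c x)) has_derivative differential c d id p) (at (coord c p))"
    by (simp add: differential_def o_def)
  then show "(\<lambda>x. coord d (inv_coord c x)) differentiable (at (coord c p))"
    by (auto simp: differentiable_def)
qed

lemma has_derivative_change_chart: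
  fixes c :: "('a::{t2_space, second_countable_topology}, 'm::finite) chart"
  assumes A: "smooth_atlas A" "c \<in> A" "d \<in> A" and p: "p \<in> dom_chart c" "p \<in> dom_chart d"
    and f: "((\<lambda>y. f (inv_coord d y)) has_derivative f') (at (coord d p))"
  shows "((\<lambda>x. f (inv_coord c x)) has_derivative (\<lambda>v. f' (differential c d id p v))) (at (coord c p))"
  using has_derivative_through_chart[OF A(1,2) A(1,3) continuous_on_id', where f = f and p = p and f' = f'] f p
    transition_differentiable(1)[OF A p] by (simp add: id_def)

section \<open>The Riemannian measure\<close>

lemma borel_preimage_within:
  assumes "open S" "continuous_on S f" "A \<in> sets borel"
  shows "{x \<in> S. f x \<in> A} \<in> sets borel"
proof -
  have S: "S \<in> sets borel" using assms(1) by (rule borel_open)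
  have "f \<in> borel_measurable (restrict_space borel S)"
    by (rule borel_measurable_continuous_on_restrict[OF assms(2)])
  from measurable_sets[OF this assms(3)] have "f -` A \<inter> S \<in> sets (restrict_space borel S)"
    by (simp add: space_restrict_space)
  then have "f -` A \<inter> S \<in> sets borel" using S by (simp add: sets_restrict_space_iff)
  moreover have "f -` A \<inter> S = {x \<in> S. f x \<in> A}" by blast
  ultimately show ?thesis by simp
qed

text \<open>\<open>\<tau>\<close> carries the measure with density \<open>|det \<tau>'|\<close> on \<open>A\<close> to
  Lebesgue measure on \<open>\<tau> ` A\<close>: on Borel sets this is the formula for the measure of an
  image.\<close>

lemma nn_integral_change_of_variables:
  fixes \<tau> :: "real ^ 'm::finite \<Rightarrow> real ^ 'm"
  assumes S: "open S" "open S'" "\<And>x. x \<in> S \<Longrightarrow> \<tau> x \<in> S' \<and> \<sigma> (\<tau> x) = x" "\<And>y. y \<in> S' \<Longrightarrow> \<sigma> y \<in> S \<and> \<tau> (\<sigma> y) = y"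
    and cont: "continuous_on S \<tau>" "continuous_on S' \<sigma>" "continuous_on S (\<lambda>x. det (matrix (\<tau>' x)))"
    and der: "\<And>x. x \<in> S \<Longrightarrow> (\<tau> has_derivative \<tau>' x) (at x)"
    and A: "A \<in> sets borel" "A \<subseteq> S" and h: "h \<in> borel_measurable borel"
  shows "(\<integral>\<^sup>+y\<in>\<tau> ` A. h y \<partial>lborel) = (\<integral>\<^sup>+x\<in>A. h (\<tau> x) * ennreal \<bar>det (matrix (\<tau>' x))\<bar> \<partial>lborel)"
proof -
  define D where "D = (\<lambda>x. indicator S x *\<^sub>R det (matrix (\<tau>' x)))"
  have D [measurable]: "D \<in> borel_measurable borel"
    unfolding D_def
    by (rule borel_measurable_continuous_on_indicator[OF borel_open[OF S(1)] cont(3)])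
  have [measurable]: "A \<in> sets borel" "S \<in> sets borel" using A S by auto
  \<comment> \<open>A Borel measurable extension of \<open>\<tau>\<close> to the whole space.\<close>
  define T where "T x = (if x \<in> S then \<tau> x else 0)" for x
  have T [measurable]: "T \<in> borel_measurable borel"
  proof (rule measurableI)
    fix C :: "(real ^ 'm) set" assume "C \<in> sets borel"
    then have "{x \<in> S. \<tau> x \<in> C} \<in> sets borel" by (rule borel_preimage_within[OF S(1) cont(1)])
    moreover have "T -` C \<inter> space borel = {x \<in> S. \<tau> x \<in> C} \<union> (if 0 \<in> C then - S else {})"
      by (auto simp: T_def split: if_splits)
    ultimately show "T -` C \<inter> space borel \<in> sets borel" by auto
  qed simp
  have im: "\<tau> ` A' = {y \<in> S'. \<sigma> y \<in> A'}" if "A' \<subseteq> S" for A'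
  proof (intro equalityI subsetI)
    fix y assume "y \<in> \<tau> ` A'"
    then obtain x where "x \<in> A'" "y = \<tau> x" by blast
    then show "y \<in> {y \<in> S'. \<sigma> y \<in> A'}" using S(3)[of x] that by auto
  next
    fix y assume "y \<in> {y \<in> S'. \<sigma> y \<in> A'}"
    then have "y = \<tau> (\<sigma> y)" "\<sigma> y \<in> A'" using S(4)[of y] by auto
    then show "y \<in> \<tau> ` A'" by (rule image_eqI)
  qed
  have imb: "\<tau> ` A' \<in> sets borel" if "A' \<subseteq> S" "A' \<in> sets borel" for A'
    unfolding im[OF that(1)] by (rule borel_preimage_within[OF S(2) cont(2) that(2)])
  have [measurable]: "\<tau> ` A \<in> sets borel" by (rule imb[OF A(2,1)])
  have inj: "inj_on \<tau> S" by (rule inj_on_inverseI[of _ \<sigma>]) (use S(3) in blast)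
  define \<nu> where "\<nu> = density lborel (\<lambda>x. indicator A x * ennreal \<bar>D x\<bar>)"
  have eq: "distr \<nu> borel T = density lborel (indicator (\<tau> ` A))"
  proof (rule measure_eqI)
    fix C assume "C \<in> sets (distr \<nu> borel T)"
    then have C [measurable]: "C \<in> sets borel" by simp
    let ?A = "{x \<in> A. \<tau> x \<in> C}"
    have A': "?A \<in> sets borel" "?A \<subseteq> S"
    proof -
      have "?A = A \<inter> {x \<in> S. \<tau> x \<in> C}" using A(2) by blast
      then show "?A \<in> sets borel" using borel_preimage_within[OF S(1) cont(1) C] A(1) by simp
    qed (use A in blast)
    have eq2: "(\<lambda>x. indicator ?A x * \<bar>det (matrix (\<tau>' x))\<bar>) = (\<lambda>x. indicator ?A x * \<bar>D x\<bar>)"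
      using A' by (auto simp: fun_eq_iff indicator_def D_def)
    have "emeasure (distr \<nu> borel T) C = emeasure \<nu> (T -` C)"
      by (simp add: emeasure_distr \<nu>_def)
    also have "\<dots> = (\<integral>\<^sup>+x. indicator A x * ennreal \<bar>D x\<bar> * indicator (T -` C) x \<partial>lborel)"
      unfolding \<nu>_def by (rule emeasure_density) (use measurable_sets[OF T C] in simp_all)
    also have "\<dots> = (\<integral>\<^sup>+x\<in>?A. ennreal \<bar>det (matrix (\<tau>' x))\<bar> \<partial>lborel)"
      by (intro nn_integral_cong) (use A(2) in \<open>auto simp: indicator_def T_def D_def\<close>)
    also have "\<dots> = emeasure lborel (\<tau> ` ?A)"
    proof (rule emeasure_differentiable_image[symmetric])
      show "(\<lambda>x. indicator ?A x * \<bar>det (matrix (\<tau>' x))\<bar>) \<in> borel_measurable borel"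
        unfolding eq2 using A'(1) by measurable
    qed (use A' imb[OF A'(2,1)] der inj_on_subset[OF inj A'(2)] in auto)
    also have "\<tau> ` ?A = \<tau> ` A \<inter> C" by blast
    also have "emeasure lborel (\<tau> ` A \<inter> C) = emeasure (density lborel (indicator (\<tau> ` A))) C"
      by (simp add: emeasure_density flip: indicator_inter_arith)
    finally show "emeasure (distr \<nu> borel T) C = emeasure (density lborel (indicator (\<tau> ` A))) C" .
  qed simp
  have "(\<integral>\<^sup>+y\<in>\<tau> ` A. h y \<partial>lborel) = (\<integral>\<^sup>+y. h y \<partial>density lborel (indicator (\<tau> ` A)))"
    using h by (subst nn_integral_density) (simp_all add: mult.commute)
  also have "\<dots> = (\<integral>\<^sup>+x. h (T x) \<partial>\<nu>)"
    unfolding eq[symmetric] by (rule nn_integral_distr) (use h in \<open>simp_all add: \<nu>_def\<close>)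
  also have "\<dots> = (\<integral>\<^sup>+x. indicator A x * ennreal \<bar>D x\<bar> * h (T x) \<partial>lborel)"
    unfolding \<nu>_def by (subst nn_integral_density) (use h in simp_all)
  also have "\<dots> = (\<integral>\<^sup>+x\<in>A. h (\<tau> x) * ennreal \<bar>det (matrix (\<tau>' x))\<bar> \<partial>lborel)"
    by (intro nn_integral_cong) (use A(2) in \<open>auto simp: indicator_def T_def D_def mult.commute\<close>)
  finally show ?thesis .
qed

lemma bilinear_metric: "bilinear (metric M c p)"
  unfolding bilinear_def metric_def
  by (auto intro!: linearI simp: inner_left_distrib inner_right_distrib matrix_vector_right_distrib
      matrix_vector_mult_scaleR)

lemma riemannian_manifoldD:
  assumes "riemannian_manifold M"
  shows "smooth_atlas (charts M)"
    "c \<in> charts M \<Longrightarrow> smooth_on (codom_chart c) (\<lambda>x. gram M c (inv_coord c x))"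
    "c \<in> charts M \<Longrightarrow> p \<in> dom_chart c \<Longrightarrow> metric M c p v w = metric M c p w v"
    "c \<in> charts M \<Longrightarrow> p \<in> dom_chart c \<Longrightarrow> v \<noteq> 0 \<Longrightarrow> metric M c p v v > 0"
    "c \<in> charts M \<Longrightarrow> d \<in> charts M \<Longrightarrow> p \<in> dom_chart c \<Longrightarrow> p \<in> dom_chart d \<Longrightarrow>
       metric M d p (differential c d id p v) (differential c d id p w) = metric M c p v w"
  using assms unfolding riemannian_manifold_def by (auto simp: o_def)

lemma ex_diagonalising_frame:
  fixes M :: "('a::{t2_space, second_countable_topology}, 'm::finite) mfd"
  assumes "riemannian_manifold M" "c \<in> charts M" "p \<in> dom_chart c"
    and "bilinear K" "\<And>v w. K v w = K w v"
  obtains e where "orthonormal_frame M c p e" "\<And>i j. i \<noteq> j \<Longrightarrow> K (e i) (e j) = (0 :: real)"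
proof (rule simultaneous_diagonalisation[OF bilinear_metric[of M c p] _ _ assms(4,5)])
  show "metric M c p v w = metric M c p w v" for v w
    by (rule riemannian_manifoldD(3)[OF assms(1-3)])
  show "metric M c p v v > 0" if "v \<noteq> 0" for v
    by (rule riemannian_manifoldD(4)[OF assms(1-3) that])
  fix e :: "'m \<Rightarrow> real ^ 'm"
  assume e: "\<And>i j. metric M c p (e i) (e j) = (if i = j then 1 else 0)" "\<And>i j. i \<noteq> j \<Longrightarrow> K (e i) (e j) = 0"
  show ?thesis
  proof (rule that[of e])
    show "orthonormal_frame M c p e" unfolding orthonormal_frame_def by (intro allI e(1))
  qed (rule e(2))
qed

lemma ex_orthonormal_frame:
  fixes M :: "('a::{t2_space, second_countable_topology}, 'm::finite) mfd"
  assumes "riemannian_manifold M" "c \<in> charts M" "p \<in> dom_chart c"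
  obtains e where "orthonormal_frame M c p e"
  by (rule ex_diagonalising_frame[OF assms, of "\<lambda>v w. 0"]) (auto simp: bilinear_def intro: linearI)

lemma orthonormal_frame_gram:
  "orthonormal_frame M c p e \<Longrightarrow> e i \<bullet> (gram M c p *v e j) = (if i = j then 1 else 0)"
  by (simp add: orthonormal_frame_def metric_def)

text \<open>\<open>E E\<^sup>T g = 1\<close> for an orthonormal frame \<open>E\<close>, so \<open>(det E)\<^sup>2 det
  g = 1\<close>.\<close>

lemma gram_invertible:
  assumes "riemannian_manifold M" "c \<in> charts M" "p \<in> dom_chart c"
  shows "invertible (gram M c p)" "det (gram M c p) > 0"
proof -
  obtain e where e: "orthonormal_frame M c p e" using ex_orthonormal_frame[OF assms] .
  let ?E = "(\<chi> k i. e i $ k)"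
  have "?E ** transpose ?E ** gram M c p = mat 1"
    by (rule trace_in_orthonormal_frame(1)) (rule orthonormal_frame_gram[OF e])
  from arg_cong[OF this, of det] have "(det ?E)\<^sup>2 * det (gram M c p) = 1"
    by (simp add: det_mul det_transpose power2_eq_square)
  then show "det (gram M c p) > 0"
    by (metis mult_le_0_iff not_less zero_le_power2 zero_less_one less_le_not_le)
  then show "invertible (gram M c p)" by (simp add: invertible_det_nz)
qed

definition volume_density :: "('a, 'm::finite) mfd \<Rightarrow> ('a, 'm) chart \<Rightarrow> real ^ 'm \<Rightarrow> real" where
  "volume_density M c x = sqrt (det (gram M c (inv_coord c x)))"

definition chart_volume :: "('a, 'm::finite) mfd \<Rightarrow> ('a, 'm) chart \<Rightarrow> 'a set \<Rightarrow> ennreal" where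
  "chart_volume M c B = (\<integral>\<^sup>+x\<in>coord c ` B. ennreal (volume_density M c x) \<partial>lborel)"

lemma is_volume_measure_iff:
  "is_volume_measure M \<mu> \<longleftrightarrow> sets \<mu> = sets borel \<and>
     (\<forall>c\<in>charts M. \<forall>B\<in>sets borel. B \<subseteq> dom_chart c \<longrightarrow> emeasure \<mu> B = chart_volume M c B)"
  by (simp add: is_volume_measure_def chart_volume_def volume_density_def)

lemma volume_density_positive:
  assumes "riemannian_manifold M" "c \<in> charts M" "x \<in> codom_chart c"
  shows "volume_density M c x > 0"
  using gram_invertible(2)[OF assms(1,2)] atlas_chart(8)[OF riemannian_manifoldD(1)[OF assms(1)] assms(2,3)]
  by (simp add: volume_density_def)

lemma volume_density_continuous:
  assumes "riemannian_manifold M" "c \<in> charts M"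
  shows "continuous_on (codom_chart c) (volume_density M c)"
proof -
  note A = riemannian_manifoldD(1)[OF assms(1)]
  have "smooth_on (codom_chart c) (\<lambda>x. det (gram M c (inv_coord c x)))"
    by (intro smooth_on_det smooth_on_entry riemannian_manifoldD(2)[OF assms] atlas_chart(2)[OF A assms(2)])
  from smooth_on_continuous[OF this] show ?thesis
    unfolding volume_density_def[abs_def] by (rule continuous_on_real_sqrt)
qed

text \<open>The Gram matrices are related by \<open>g\<^sub>c = T\<^sup>t g\<^sub>d T\<close> with the Jacobian matrix
  \<open>T\<close> of the transition map.\<close>

lemma transition_det:
  fixes M :: "('a::{t2_space, second_countable_topology}, 'm::finite) mfd"
  assumes R: "riemannian_manifold M" and c: "c \<in> charts M" "d \<in> charts M" "p \<in> dom_chart c" "p \<in> dom_chart d"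
  shows "det (gram M c p) = (det (matrix (differential c d id p)))\<^sup>2 * det (gram M d p)"
proof -
  let ?T = "differential c d id p" and ?G = "gram M d p"
  have lin: "linear ?T"
    using transition_differentiable(2)[OF riemannian_manifoldD(1)[OF R] c] has_derivative_linear by blast
  have T: "matrix ?T *v v = ?T v" for v by (rule fun_cong[OF matrix_vector_mul(2)[OF lin]])
  have "v \<bullet> (gram M c p *v w) = v \<bullet> ((transpose (matrix ?T) ** ?G ** matrix ?T) *v w)" for v w
  proof -
    have "v \<bullet> (gram M c p *v w) = ?T v \<bullet> (?G *v ?T w)"
      using riemannian_manifoldD(5)[OF R c] by (simp add: metric_def)
    also have "\<dots> = v \<bullet> (transpose (matrix ?T) *v (?G *v (matrix ?T *v w)))"
      unfolding T by (metis T dot_lmul_matrix inner_commute transpose_matrix_vector)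
    finally show ?thesis by (simp add: matrix_vector_mul_assoc matrix_mul_assoc)
  qed
  then have "gram M c p *v w = (transpose (matrix ?T) ** ?G ** matrix ?T) *v w" for w
    by (rule vector_eq_ldot[THEN iffD1, rule_format])
  then have "gram M c p = transpose (matrix ?T) ** ?G ** matrix ?T"
    by (simp add: matrix_eq)
  then show ?thesis by (simp add: det_mul det_transpose power2_eq_square)
qed

lemma chart_image_borel:
  assumes "smooth_atlas A" "c \<in> A" "B \<in> sets borel" "B \<subseteq> dom_chart c"
  shows "coord c ` B \<in> sets borel"
proof -
  have "coord c ` B = {x \<in> codom_chart c. inv_coord c x \<in> B}"
    using chart_image_eq[OF assms(1,2), of B] assms(4) by (simp add: Int_absorb1)
  then show ?thesis
    using borel_preimage_within[OF atlas_chart(2,4)[OF assms(1,2)] assms(3)] by simp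
qed

text \<open>The factor \<open>|det T|\<close> by which the densities \<open>sqrt (det g)\<close> of two charts differ
  is the Jacobian in the change of variables.\<close>

lemma chart_volume_change:
  fixes M :: "('a::{t2_space, second_countable_topology}, 'm::finite) mfd"
  assumes R: "riemannian_manifold M" and c: "c \<in> charts M" "d \<in> charts M"
    and B: "B \<in> sets borel" "B \<subseteq> dom_chart c" "B \<subseteq> dom_chart d"
  shows "chart_volume M c B = chart_volume M d B"
proof -
  note A = riemannian_manifoldD(1)[OF R]
  note ac = atlas_chart[OF A c(1)] and ad = atlas_chart[OF A c(2)]
  let ?S = "{x \<in> codom_chart c. inv_coord c x \<in> dom_chart d}"
  let ?S' = "{x \<in> codom_chart d. inv_coord d x \<in> dom_chart c}"
  let ?\<tau> = "\<lambda>x. coord d (inv_coord c x)" and ?\<sigma> = "\<lambda>x. coord c (inv_coord d x)"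
  let ?T = "\<lambda>x. differential c d id (inv_coord c x)"
  have s: "smooth_on ?S ?\<tau>" "smooth_on ?S' ?\<sigma>"
    by (rule smooth_transition[OF A c] smooth_transition[OF A c(2,1)])+
  have oS: "open ?S" "open ?S'" by (intro open_preimage_within ac ad)+
  have T: "(?\<tau> has_derivative ?T x) (at x)" if "x \<in> ?S" for x
    using transition_differentiable(2)[OF A c, of "inv_coord c x"] that ac by auto
  have "continuous_on ?S (\<lambda>x. det (matrix (?T x)))"
  proof -
    have "smooth_on ?S (\<lambda>x. det (matrix (frechet_derivative ?\<tau> (at x))))"
      unfolding matrix_def
      by (rule smooth_on_det[OF oS(1)]) (simp add: smooth_on_nth[OF oS(1)] smooth_on_frechet[OF s(1)])
    then have "smooth_on ?S (\<lambda>x. det (matrix (?T x)))"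
      by (rule smooth_on_cong[OF oS(1), rotated]) (use frechet_derivative_at[OF T] in simp)
    then show ?thesis by (rule smooth_on_continuous)
  qed
  note cv = nn_integral_change_of_variables[OF oS _ _ smooth_on_continuous[OF s(1)]
      smooth_on_continuous[OF s(2)] this T]
  let ?h = "\<lambda>y. ennreal (indicator (codom_chart d) y *\<^sub>R volume_density M d y)"
  have h: "?h \<in> borel_measurable borel"
    using borel_measurable_continuous_on_indicator[OF borel_open[OF ad(2)] volume_density_continuous[OF R c(2)]]
    by simp
  let ?A = "coord c ` B"
  have Bc: "inv_coord c (coord c q) = q" "coord c q \<in> codom_chart c" "q \<in> dom_chart d" if "q \<in> B" for q
    using subsetD[OF B(2) that] subsetD[OF B(3) that] ac(5,6) by blast+
  have AS: "?A \<subseteq> ?S" by (auto simp: Bc)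
  have im: "?\<tau> ` ?A = coord d ` B" by (simp add: image_image Bc cong: image_cong_simp)
  have "chart_volume M d B = (\<integral>\<^sup>+y\<in>?\<tau> ` ?A. ?h y \<partial>lborel)"
    unfolding chart_volume_def im
    by (intro nn_integral_cong) (use B ad in \<open>auto simp: indicator_def\<close>)
  also have "\<dots> = (\<integral>\<^sup>+x\<in>?A. ?h (?\<tau> x) * ennreal \<bar>det (matrix (?T x))\<bar> \<partial>lborel)"
    by (rule cv) (use ac ad AS h chart_image_borel[OF A c(1) B(1,2)] in auto)
  also have "\<dots> = chart_volume M c B"
    unfolding chart_volume_def
  proof (intro nn_integral_cong)
    fix x
    show "?h (?\<tau> x) * ennreal \<bar>det (matrix (?T x))\<bar> * indicator ?A x
       = ennreal (volume_density M c x) * indicator ?A x"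
    proof (cases "x \<in> ?A")
      case True
      then have x: "x \<in> codom_chart c" "inv_coord c x \<in> dom_chart d" "inv_coord c x \<in> dom_chart c"
        using AS ac by auto
      have "volume_density M c x = volume_density M d (?\<tau> x) * \<bar>det (matrix (?T x))\<bar>"
        using x ad by (simp add: volume_density_def transition_det[OF R c x(3,2)] real_sqrt_mult mult.commute)
      moreover have "volume_density M d (?\<tau> x) \<ge> 0"
        using volume_density_positive[OF R c(2) ad(6)[OF x(2)]] by simp
      ultimately show ?thesis using x ad True by (simp add: ennreal_mult)
    qed simp
  qed
  finally show ?thesis by simp
qed

text \<open>The value \<open>undefined\<close> outside the codomain of the chart makes the map total and receives no
  mass, because the density vanishes there.\<close>

definition chart_measure :: "('a::topological_space, 'm::finite) mfd \<Rightarrow> ('a, 'm) chart \<Rightarrow> 'a measure" where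
  "chart_measure M c = distr
     (density lborel (\<lambda>x. ennreal (indicator (codom_chart c) x *\<^sub>R volume_density M c x)))
     borel (\<lambda>x. if x \<in> codom_chart c then inv_coord c x else undefined)"

lemma emeasure_chart_measure:
  assumes R: "riemannian_manifold M" and c: "c \<in> charts M" and B: "B \<in> sets borel" "B \<subseteq> dom_chart c"
  shows "emeasure (chart_measure M c) B = chart_volume M c B"
proof -
  note A = riemannian_manifoldD(1)[OF R] and ac = atlas_chart[OF riemannian_manifoldD(1)[OF R] c]
  let ?f = "\<lambda>x. if x \<in> codom_chart c then inv_coord c x else undefined"
  let ?\<rho> = "\<lambda>x. ennreal (indicator (codom_chart c) x *\<^sub>R volume_density M c x)"
  have \<rho>: "?\<rho> \<in> borel_measurable borel"
    using borel_measurable_continuous_on_indicator[OF borel_open[OF ac(2)] volume_density_continuous[OF R c]]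
    by simp
  have f: "?f \<in> borel_measurable borel"
  proof (rule measurableI)
    fix C :: "'a set" assume "C \<in> sets borel"
    then have "{x \<in> codom_chart c. inv_coord c x \<in> C} \<in> sets borel"
      by (rule borel_preimage_within[OF ac(2,4)])
    moreover have "codom_chart c \<in> sets borel" using ac(2) by simp
    moreover have "?f -` C \<inter> space borel = {x \<in> codom_chart c. inv_coord c x \<in> C} \<union>
        (if undefined \<in> C then - codom_chart c else {})"
      by (auto split: if_splits)
    ultimately show "?f -` C \<inter> space borel \<in> sets borel" by auto
  qed simp
  have "emeasure (chart_measure M c) B = emeasure (density lborel ?\<rho>) (?f -` B)"
    unfolding chart_measure_def using f B by (subst emeasure_distr) simp_all
  also have "\<dots> = (\<integral>\<^sup>+x. ?\<rho> x * indicator (?f -` B) x \<partial>lborel)"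
    by (rule emeasure_density) (use \<rho> measurable_sets[OF f B(1)] in simp_all)
  also have "\<dots> = chart_volume M c B"
    unfolding chart_volume_def
  proof (intro nn_integral_cong)
    fix x
    have "x \<in> coord c ` B \<longleftrightarrow> x \<in> codom_chart c \<and> inv_coord c x \<in> B"
      using chart_image_eq[OF A c, of B] B(2) by (simp add: Int_absorb1)
    then show "?\<rho> x * indicator (?f -` B) x = ennreal (volume_density M c x) * indicator (coord c ` B) x"
      by (auto simp: indicator_def)
  qed
  finally show ?thesis .
qed

text \<open>By compactness finitely many chart domains cover the manifold; from each of them the previous ones are
  removed.\<close>

lemma finite_chart_partition:
  fixes M :: "('a::{t2_space, second_countable_topology}, 'm::finite) mfd"
  assumes A: "smooth_atlas (charts M)" and cpt: "compact (UNIV :: 'a set)"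
  obtains C D where "finite C" "C \<subseteq> charts M" "\<And>c. c \<in> C \<Longrightarrow> D c \<in> sets borel" "\<And>c. c \<in> C \<Longrightarrow> D c \<subseteq> dom_chart c"
    "disjoint_family_on D C" "(\<Union>c\<in>C. D c) = UNIV"
proof -
  have "UNIV \<subseteq> (\<Union>c\<in>charts M. dom_chart c)" using A unfolding smooth_atlas_def by blast
  then obtain C where C: "C \<subseteq> charts M" "finite C" "UNIV \<subseteq> (\<Union>c\<in>C. dom_chart c)"
    using compactE_image[OF cpt, of "charts M" dom_chart] atlas_chart(1)[OF A] by metis
  obtain f and n :: nat where f: "C = f ` {i. i < n}" "inj_on f {i. i < n}"
    using finite_imp_nat_seg_image_inj_on[OF C(2)] by blast
  define idx where "idx = the_inv_into {i. i < n} f"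
  have idx: "idx (f i) = i" if "i < n" for i
    unfolding idx_def using f(2) that by (simp add: the_inv_into_f_f)
  define D where "D c = disjointed (\<lambda>i. dom_chart (f i)) (idx c)" for c
  have fC: "f i \<in> charts M" if "i < n" for i using that f C by auto
  show thesis
  proof (rule that[of C D])
    show "finite C" "C \<subseteq> charts M" by (rule C)+
    fix c assume "c \<in> C"
    then obtain i where i: "i < n" "c = f i" using f by auto
    then have D: "D c = dom_chart (f i) - (\<Union>j\<in>{0..<i}. dom_chart (f j))"
      by (simp add: D_def idx disjointed_def)
    show "D c \<in> sets borel" unfolding D
      using i fC atlas_chart(1)[OF A] by (intro sets.Diff sets.finite_UN borel_open) auto
    show "D c \<subseteq> dom_chart c" using D i(2) by blast
  next
    show "disjoint_family_on D C"
      unfolding disjoint_family_on_def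
    proof (intro ballI impI)
      fix c d assume "c \<in> C" "d \<in> C" "c \<noteq> d"
      then obtain i j where "c = f i" "d = f j" "i < n" "j < n" "i \<noteq> j" using f by auto
      then show "D c \<inter> D d = {}"
        using disjoint_family_disjointed[of "\<lambda>i. dom_chart (f i)"]
        by (simp add: D_def idx disjoint_family_on_def)
    qed
    have "\<exists>c\<in>C. p \<in> D c" for p
    proof -
      obtain i where i: "i < n" "p \<in> dom_chart (f i)" using C(3) f by auto
      define k where "k = (LEAST i. p \<in> dom_chart (f i))"
      have k: "p \<in> dom_chart (f k)" unfolding k_def by (rule LeastI[of "\<lambda>i. p \<in> dom_chart (f i)", OF i(2)])
      have ki: "k \<le> i" unfolding k_def by (rule Least_le) (rule i(2))
      have "p \<notin> dom_chart (f j)" if "j < k" for j using not_less_Least that unfolding k_def by blast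
      then have "p \<in> D (f k)" using k ki i by (auto simp: D_def idx disjointed_def)
      moreover have "f k \<in> C" using f ki i by auto
      ultimately show ?thesis by blast
    qed
    then show "(\<Union>c\<in>C. D c) = UNIV" by blast
  qed
qed

text \<open>The measure of \<open>B\<close> is the sum of the measures of its pieces in a partition subordinate to
  charts, each computed in its own chart. It has the right values in every chart because the local formulas agree on
  overlaps. Any other candidate agrees with it on the pieces, hence everywhere, so the definite description denotes
  this measure.\<close>

lemma volume_measure_is_volume_measure:
  fixes M :: "('a::{t2_space, second_countable_topology}, 'm::finite) mfd"
  assumes R: "riemannian_manifold M" and cpt: "compact (UNIV :: 'a set)"
  shows "is_volume_measure M (volume_measure M)"
proof -
  obtain C D where C: "finite C" "C \<subseteq> charts M" "\<And>c. c \<in> C \<Longrightarrow> D c \<in> sets borel"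
    "\<And>c. c \<in> C \<Longrightarrow> D c \<subseteq> dom_chart c" "disjoint_family_on D C" "(\<Union>c\<in>C. D c) = UNIV"
    by (rule finite_chart_partition[OF riemannian_manifoldD(1)[OF R] cpt]) (rule that; assumption)
  have split: "B = (\<Union>c\<in>C. B \<inter> D c)" for B using C(6) by blast
  have disj: "disjoint_family_on (\<lambda>c. B \<inter> D c) C" for B
    using C(5) unfolding disjoint_family_on_def by blast
  have sum_split: "(\<Sum>c\<in>C. emeasure \<nu> (B \<inter> D c)) = emeasure \<nu> B"
    if "sets \<nu> = sets borel" "B \<in> sets borel" for \<nu> B
    by (subst (2) split[of B], rule sum_emeasure[OF _ disj C(1)]) (use that C(3) in auto)
  define m where "m B = (\<Sum>c\<in>C. emeasure (chart_measure M c) (B \<inter> D c))" for B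
  define \<mu> where "\<mu> = measure_of UNIV (sets borel) m"
  have sets_ch: "sets (chart_measure M c) = sets borel" for c by (simp add: chart_measure_def)
  have sig: "sigma_sets UNIV (sets borel) = sets (borel :: 'a measure)"
    using sets.sigma_sets_eq[of "borel :: 'a measure"] by simp
  have sets_\<mu>: "sets \<mu> = sets borel" by (simp add: \<mu>_def sig)
  have em: "emeasure \<mu> B = m B" if "B \<in> sets borel" for B
  proof (rule emeasure_measure_of[OF \<mu>_def])
    show "positive (sets \<mu>) m" by (simp add: positive_def m_def)
    show "countably_additive (sets \<mu>) m"
    proof (rule countably_additiveI)
      fix F :: "nat \<Rightarrow> 'a set" assume F: "range F \<subseteq> sets \<mu>" "disjoint_family F"
      have "(\<Sum>i. m (F i)) = (\<Sum>c\<in>C. \<Sum>i. emeasure (chart_measure M c) (F i \<inter> D c))"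
        unfolding m_def by (rule suminf_sum) (rule summableI)
      also have "\<dots> = (\<Sum>c\<in>C. emeasure (chart_measure M c) (\<Union>i. F i \<inter> D c))"
        by (intro sum.cong refl suminf_emeasure)
          (use F C(3) in \<open>auto simp: sets_ch sets_\<mu> disjoint_family_on_def image_subset_iff\<close>)
      also have "\<dots> = m (\<Union>i. F i)" by (simp add: m_def)
      finally show "(\<Sum>i. m (F i)) = m (\<Union>i. F i)" .
    qed
  qed (use that sets_\<mu> in auto)
  have \<mu>: "is_volume_measure M \<mu>"
    unfolding is_volume_measure_iff
  proof (intro conjI ballI impI sets_\<mu>)
    fix c B assume c: "c \<in> charts M" and B: "B \<in> sets borel" "B \<subseteq> dom_chart c"
    have "emeasure \<mu> B = (\<Sum>c'\<in>C. emeasure (chart_measure M c) (B \<inter> D c'))"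
      unfolding em[OF B(1)] m_def
    proof (rule sum.cong[OF refl])
      fix c' assume c': "c' \<in> C"
      then have 1: "c' \<in> charts M" and 2: "B \<inter> D c' \<in> sets borel" "B \<inter> D c' \<subseteq> dom_chart c'" "B \<inter> D c' \<subseteq> dom_chart c"
        using C(2) C(3)[OF c'] C(4)[OF c'] B by auto
      show "emeasure (chart_measure M c') (B \<inter> D c') = emeasure (chart_measure M c) (B \<inter> D c')"
        using chart_volume_change[OF R 1 c 2] emeasure_chart_measure[OF R 1 2(1,2)]
          emeasure_chart_measure[OF R c 2(1,3)] by simp
    qed
    also have "\<dots> = chart_volume M c B"
      unfolding sum_split[OF sets_ch B(1)] by (rule emeasure_chart_measure[OF R c B])
    finally show "emeasure \<mu> B = chart_volume M c B" .
  qed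
  have unique: "\<nu> = \<mu>" if \<nu>: "is_volume_measure M \<nu>" for \<nu>
  proof (rule measure_eqI)
    show "sets \<nu> = sets \<mu>" using \<nu> sets_\<mu> by (simp add: is_volume_measure_iff)
    fix B assume "B \<in> sets \<nu>"
    then have B: "B \<in> sets borel" using \<nu> by (simp add: is_volume_measure_iff)
    have eq: "emeasure \<nu> (B \<inter> D c) = emeasure \<mu> (B \<inter> D c)" if c: "c \<in> C" for c
    proof -
      have "B \<inter> D c \<in> sets borel" "B \<inter> D c \<subseteq> dom_chart c" "c \<in> charts M"
        using B C(2) C(3)[OF c] C(4)[OF c] c by auto
      then show ?thesis using \<nu> \<mu> unfolding is_volume_measure_iff by metis
    qed
    have "emeasure \<nu> B = (\<Sum>c\<in>C. emeasure \<nu> (B \<inter> D c))"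
      using sum_split[OF _ B] \<nu> by (simp add: is_volume_measure_iff)
    also have "\<dots> = (\<Sum>c\<in>C. emeasure \<mu> (B \<inter> D c))" by (rule sum.cong[OF refl eq])
    also have "\<dots> = emeasure \<mu> B" by (rule sum_split[OF sets_\<mu> B])
    finally show "emeasure \<nu> B = emeasure \<mu> B" .
  qed
  have "volume_measure M = \<mu>" unfolding volume_measure_def
    by (rule the_equality, rule \<mu>, rule unique)
  with \<mu> show ?thesis by simp
qed

text \<open>Small coordinate balls have finite measure since the density is bounded on their closures, and finitely
  many of them cover \<open>M\<close>. A nonempty open set contains the image of an open set of a chart, on which the
  density is positive.\<close>

lemma volume_measure_finite_positive:
  fixes M :: "('a::{t2_space, second_countable_topology}, 'm::finite) mfd"
  assumes R: "riemannian_manifold M" and cpt: "compact (UNIV :: 'a set)"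
  shows "sets (volume_measure M) = sets borel" "space (volume_measure M) = UNIV"
    "finite_measure (volume_measure M)"
    "\<And>S. open S \<Longrightarrow> S \<noteq> {} \<Longrightarrow> emeasure (volume_measure M) S > 0"
proof -
  let ?\<mu> = "volume_measure M"
  note A = riemannian_manifoldD(1)[OF R]
  have sets: "sets ?\<mu> = sets borel" and em: "\<And>c B. c \<in> charts M \<Longrightarrow> B \<in> sets borel \<Longrightarrow> B \<subseteq> dom_chart c \<Longrightarrow>
      emeasure ?\<mu> B = chart_volume M c B"
    using volume_measure_is_volume_measure[OF R cpt] unfolding is_volume_measure_iff by blast+
  show "sets ?\<mu> = sets borel" by (rule sets)
  show space: "space ?\<mu> = UNIV" using sets_eq_imp_space_eq[OF sets] by simp
  have "\<exists>S. open S \<and> p \<in> S \<and> emeasure ?\<mu> S < \<infinity>" for p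
  proof -
    obtain c where c: "c \<in> charts M" "p \<in> dom_chart c" using atlas_cover[OF A] .
    note ac = atlas_chart[OF A c(1)]
    obtain r where r: "r > 0" "cball (coord c p) r \<subseteq> codom_chart c"
      using ac(2) ac(6)[OF c(2)] open_contains_cball by blast
    obtain b where b: "\<And>x. x \<in> cball (coord c p) r \<Longrightarrow> volume_density M c x \<le> b"
    proof -
      have "compact (volume_density M c ` cball (coord c p) r)"
        by (intro compact_continuous_image continuous_on_subset[OF volume_density_continuous[OF R c(1)] r(2)]
            compact_cball)
      from compact_imp_bounded[OF this] obtain b where "\<forall>y\<in>volume_density M c ` cball (coord c p) r. norm y \<le> b"
        unfolding bounded_iff by blast
      then show ?thesis by (intro that[of b]) force
    qed
    define S where "S = {q \<in> dom_chart c. coord c q \<in> ball (coord c p) r}"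
    have oS: "open S" unfolding S_def by (intro open_preimage_within ac open_ball)
    have "emeasure ?\<mu> S = chart_volume M c S"
      by (rule em[OF c(1) borel_open[OF oS]]) (auto simp: S_def)
    also have "\<dots> \<le> (\<integral>\<^sup>+x. ennreal b * indicator (ball (coord c p) r) x \<partial>lborel)"
      unfolding chart_volume_def
    proof (rule nn_integral_mono)
      fix x
      show "ennreal (volume_density M c x) * indicator (coord c ` S) x \<le> ennreal b * indicator (ball (coord c p) r) x"
        using b[of x] by (auto simp: indicator_def S_def intro!: ennreal_leI)
    qed
    also have "\<dots> = ennreal b * emeasure lborel (ball (coord c p) r)"
      by (rule nn_integral_cmult_indicator) simp
    also have "\<dots> < \<infinity>"
      using emeasure_bounded_finite[OF bounded_ball, of "coord c p" r] by (simp add: ennreal_mult_less_top)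
    finally have "emeasure ?\<mu> S < \<infinity>" .
    moreover have "p \<in> S" using c r by (simp add: S_def)
    ultimately show ?thesis using oS by blast
  qed
  then obtain S where S: "\<And>p. open (S p)" "\<And>p. p \<in> S p" "\<And>p. emeasure ?\<mu> (S p) < \<infinity>" by metis
  have "UNIV \<subseteq> (\<Union>p\<in>UNIV. S p)" using S(2) by blast
  then obtain F where F: "F \<subseteq> UNIV" "finite F" "UNIV \<subseteq> (\<Union>p\<in>F. S p)"
    using compactE_image[OF cpt, of UNIV S] S(1) by metis
  show "finite_measure ?\<mu>"
  proof (rule finite_measureI)
    have Sb: "S p \<in> sets ?\<mu>" for p using S(1) sets by simp
    have "emeasure ?\<mu> (space ?\<mu>) \<le> emeasure ?\<mu> (\<Union>p\<in>F. S p)"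
      by (rule emeasure_mono) (use F Sb in auto)
    also have "\<dots> \<le> (\<Sum>p\<in>F. emeasure ?\<mu> (S p))"
      by (rule emeasure_subadditive_finite[OF F(2)]) (use Sb in auto)
    also have "\<dots> < \<infinity>" using S(3) F(2) by (simp add: ennreal_sum_less_top)
    finally show "emeasure ?\<mu> (space ?\<mu>) \<noteq> \<infinity>" by simp
  qed
  fix S :: "'a set" assume S: "open S" "S \<noteq> {}"
  then obtain p where p: "p \<in> S" by blast
  obtain c where c: "c \<in> charts M" "p \<in> dom_chart c" using atlas_cover[OF A] .
  note ac = atlas_chart[OF A c(1)]
  let ?B = "dom_chart c \<inter> S"
  have oB: "open ?B" and oI: "open (coord c ` ?B)"
    using ac(1) S open_chart_image[OF A c(1)] by auto
  have "emeasure ?\<mu> ?B \<noteq> 0"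
  proof
    assume "emeasure ?\<mu> ?B = 0"
    then have "chart_volume M c ?B = 0" using em[OF c(1) borel_open[OF oB]] by simp
    then have "(\<integral>\<^sup>+x. ennreal (indicator (codom_chart c) x *\<^sub>R volume_density M c x) * indicator (coord c ` ?B) x \<partial>lborel) = 0"
      unfolding chart_volume_def
      by (rule trans[OF nn_integral_cong, rotated]) (use ac in \<open>auto simp: indicator_def\<close>)
    then have "emeasure lborel {x \<in> space lborel. ennreal (indicator (codom_chart c) x *\<^sub>R volume_density M c x) *
        indicator (coord c ` ?B) x \<noteq> 0} = 0"
      by (subst nn_integral_0_iff[symmetric])
        (use oI borel_measurable_continuous_on_indicator[OF borel_open[OF ac(2)] volume_density_continuous[OF R c(1)]]
          in auto)
    also have "{x \<in> space lborel. ennreal (indicator (codom_chart c) x *\<^sub>R volume_density M c x) *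
        indicator (coord c ` ?B) x \<noteq> 0} = coord c ` ?B"
      using volume_density_positive[OF R c(1)] ac(6)
      by (auto simp: indicator_def ennreal_eq_0_iff not_le split: if_splits)
    finally have "coord c ` ?B \<in> null_sets lborel" using oI by (auto simp: null_sets_def)
    then have "negligible (coord c ` ?B)"
      by (simp add: negligible_iff_null_sets null_sets_completionI)
    then show False using open_not_negligible[OF oI] p c by auto
  qed
  then have "0 < emeasure ?\<mu> ?B" by (simp add: zero_less_iff_neq_zero)
  also have "\<dots> \<le> emeasure ?\<mu> S" by (rule emeasure_mono) (use S sets in auto)
  finally show "emeasure ?\<mu> S > 0" .
qed

section \<open>Smooth cutoff functions\<close>

text \<open>The functions \<open>p(1/x) exp (-1/x)\<close>, extended by 0 to \<open>x \<le> 0\<close>. The polynomial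
  is a parameter because this class, unlike the single function \<open>exp (-1/x)\<close>, is closed under
  differentiation.\<close>

definition flat_exp :: "real poly \<Rightarrow> real \<Rightarrow> real" where
  "flat_exp p x = (if x > 0 then poly p (inverse x) * exp (- inverse x) else 0)"

lemma poly_times_exp_tendsto_0: "((\<lambda>y. poly p y * exp (- y)) \<longlongrightarrow> (0::real)) at_top"
proof -
  have "((\<lambda>y. coeff p i * (y ^ i / exp y)) \<longlongrightarrow> coeff p i * 0) at_top" for i
    by (intro tendsto_mult tendsto_const tendsto_power_div_exp_0)
  then have "((\<lambda>y. \<Sum>i\<le>degree p. coeff p i * (y ^ i / exp y)) \<longlongrightarrow> (\<Sum>i\<le>degree p. coeff p i * 0)) at_top"
    by (intro tendsto_sum)
  moreover have "(\<lambda>y. \<Sum>i\<le>degree p. coeff p i * (y ^ i / exp y)) = (\<lambda>y. poly p y * exp (- y))"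
    by (simp add: poly_altdef sum_distrib_right exp_minus divide_inverse mult.assoc)
  ultimately show ?thesis by simp
qed

text \<open>The new polynomial is \<open>y\<^sup>2 (p - p')\<close>, from the chain rule with \<open>y = 1/x\<close>.
  At 0 the difference quotient is of the form \<open>q(y) exp (-y)\<close> as well, with \<open>y\<close> tending to
  infinity.\<close>

lemma flat_exp_has_derivative:
  "(flat_exp p has_real_derivative flat_exp ([:0, 0, 1:] * (p - pderiv p)) x) (at x)"
proof -
  consider "x > 0" | "x < 0" | "x = 0" by linarith
  then show ?thesis
  proof cases
    case 1
    have "((\<lambda>x. poly p (inverse x) * exp (- inverse x)) has_real_derivative
      flat_exp ([:0, 0, 1:] * (p - pderiv p)) x) (at x)"
      using 1 by (auto intro!: derivative_eq_intros simp: flat_exp_def field_simps power2_eq_square)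
    then show ?thesis
      by (rule has_field_derivative_transform_within_open[of _ _ _ "{0<..}"]) (use 1 in \<open>auto simp: flat_exp_def\<close>)
  next
    case 2
    have "((\<lambda>x. 0) has_real_derivative 0) (at x)" by simp
    then have "(flat_exp p has_real_derivative 0) (at x)"
      by (rule has_field_derivative_transform_within_open[of _ _ _ "{..<0}"]) (use 2 in \<open>auto simp: flat_exp_def\<close>)
    then show ?thesis using 2 by (simp add: flat_exp_def)
  next
    case 3
    have "((\<lambda>h. poly (pCons 0 p) (inverse h) * exp (- inverse h)) \<longlongrightarrow> 0) (at_right (0::real))"
      by (rule filterlim_compose[OF poly_times_exp_tendsto_0 filterlim_inverse_at_top_right])
    then have r: "((\<lambda>h. flat_exp p h / h) \<longlongrightarrow> 0) (at_right 0)"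
      by (rule Lim_transform_eventually)
        (rule eventually_mono[OF eventually_at_right_less], simp add: flat_exp_def divide_inverse algebra_simps)
    have l: "((\<lambda>h. flat_exp p h / h) \<longlongrightarrow> 0) (at_left 0)"
      by (rule Lim_transform_eventually[OF tendsto_const])
        (rule eventually_mono[OF eventually_at_left_real[of "-1"]], auto simp: flat_exp_def)
    have "((\<lambda>h. flat_exp p h / h) \<longlongrightarrow> 0) (at 0)"
      using l r by (simp add: filterlim_at_split)
    then show ?thesis using 3 by (simp add: has_field_derivative_iff flat_exp_def)
  qed
qed

lemma Ck_on_flat_exp: "Ck_on k UNIV (flat_exp p)"
proof (induction k arbitrary: p)
  case 0
  have "isCont (flat_exp p) x" for x using flat_exp_has_derivative DERIV_isCont by blast
  then show ?case by (simp add: continuous_on_eq_continuous_at)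
next
  case (Suc k)
  show ?case
  proof (rule Ck_on_SucI)
    show "(flat_exp p has_derivative (\<lambda>v. flat_exp ([:0, 0, 1:] * (p - pderiv p)) x * v)) (at x)" for x
      using flat_exp_has_derivative by (simp only: has_field_derivative_def)
    show "Ck_on k UNIV (\<lambda>x. flat_exp ([:0, 0, 1:] * (p - pderiv p)) x * v)" for v
      by (intro Ck_on_bilinear[OF bounded_bilinear_mult] Ck_on_const Suc open_UNIV)
  qed simp
qed

definition bump :: "'a::euclidean_space \<Rightarrow> real \<Rightarrow> 'a \<Rightarrow> real" where
  "bump x0 r x = flat_exp 1 (r\<^sup>2 - (x - x0) \<bullet> (x - x0))"

lemma bump_pos_iff:
  assumes "r > 0"
  shows "bump x0 r x > 0 \<longleftrightarrow> x \<in> ball x0 r"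
proof -
  have "bump x0 r x > 0 \<longleftrightarrow> (norm (x - x0))\<^sup>2 < r\<^sup>2"
    by (simp add: bump_def flat_exp_def power2_norm_eq_inner)
  also have "\<dots> \<longleftrightarrow> norm (x - x0) < r"
    using assms power2_less_imp_less[of "norm (x - x0)" r] power_strict_mono[of "norm (x - x0)" r 2] by auto
  finally show ?thesis by (simp add: dist_norm norm_minus_commute)
qed

lemma bump_nonneg: "bump x0 r x \<ge> 0"
  by (simp add: bump_def flat_exp_def)

lemma smooth_bump: "smooth_on S (bump x0 r)"
proof -
  have "smooth_on UNIV (\<lambda>x. r\<^sup>2 - (x - x0) \<bullet> (x - x0))"
    by (intro smooth_on_diff smooth_on_inner smooth_on_const smooth_on_id open_UNIV)
  from smooth_on_compose[OF open_UNIV open_UNIV this, of "flat_exp 1"]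
  have "smooth_on UNIV (bump x0 r)"
    by (auto simp: bump_def[abs_def] smooth_on_def Ck_on_flat_exp)
  then show ?thesis by (rule smooth_on_subset) simp
qed

section \<open>Partitions of unity\<close>

lemma smooth_function_sum:
  assumes "smooth_atlas (charts N)" "\<And>i. i \<in> I \<Longrightarrow> smooth_function N (f i)"
  shows "smooth_function N (\<lambda>y. \<Sum>i\<in>I. f i y)"
  using assms(2) unfolding smooth_function_def
  by (intro ballI smooth_on_sum atlas_chart(2)[OF assms(1)]) auto

lemma smooth_function_scaleR:
  assumes "smooth_atlas (charts N)" "smooth_function N f" "smooth_function N g"
  shows "smooth_function N (\<lambda>y. f y *\<^sub>R g y)"
  using assms(2,3) unfolding smooth_function_def
  by (intro ballI smooth_on_scaleR atlas_chart(2)[OF assms(1)]) auto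

lemma smooth_function_inverse:
  assumes "smooth_atlas (charts N)" "smooth_function N f" "\<And>y. f y \<noteq> (0::real)"
  shows "smooth_function N (\<lambda>y. inverse (f y))"
  using assms(2,3) unfolding smooth_function_def
  by (intro ballI smooth_on_inverse atlas_chart(2)[OF assms(1)]) auto

lemma closed_chart_support:
  assumes A: "smooth_atlas (charts N)" and d: "d \<in> charts N" and K: "compact K" "K \<subseteq> codom_chart d"
  shows "closed (inv_coord d ` K)" "\<And>y. y \<in> dom_chart d \<Longrightarrow> y \<in> inv_coord d ` K \<longleftrightarrow> coord d y \<in> K"
    "inv_coord d ` K \<subseteq> dom_chart d"
proof -
  note ad = atlas_chart[OF A d]
  show "closed (inv_coord d ` K)"
    by (intro compact_imp_closed compact_continuous_image K(1) continuous_on_subset[OF ad(4) K(2)])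
  show "inv_coord d ` K \<subseteq> dom_chart d" using K(2) ad(8) by blast
  fix y assume y: "y \<in> dom_chart d"
  show "y \<in> inv_coord d ` K \<longleftrightarrow> coord d y \<in> K"
  proof
    assume "y \<in> inv_coord d ` K"
    then obtain x where "x \<in> K" "y = inv_coord d x" by blast
    then show "coord d y \<in> K" using ad(7)[of x] K(2) by (simp add: subsetD)
  next
    assume "coord d y \<in> K"
    then show "y \<in> inv_coord d ` K" using ad(5)[OF y] by (metis image_eqI)
  qed
qed

text \<open>The chart domain and the complement of the support are open, cover the manifold, and the function is
  smooth on either.\<close>

lemma smooth_function_extend_by_zero:
  fixes N :: "('b::{t2_space, second_countable_topology}, 'n::finite) mfd"
  assumes A: "smooth_atlas (charts N)" and d: "d \<in> charts N" and K: "compact K" "K \<subseteq> codom_chart d"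
    and w: "smooth_on (codom_chart d) w" "\<And>x. x \<in> codom_chart d \<Longrightarrow> x \<notin> K \<Longrightarrow> w x = 0"
  shows "smooth_function N (\<lambda>y. if y \<in> dom_chart d then w (coord d y) else 0)"
  unfolding smooth_function_def
proof (intro ballI smooth_on_local)
  let ?f = "\<lambda>y. if y \<in> dom_chart d then w (coord d y) else 0"
  note ad = atlas_chart[OF A d]
  note cl = closed_chart_support[OF A d K]
  fix c x assume c: "c \<in> charts N" and x: "x \<in> codom_chart c"
  note ac = atlas_chart[OF A c]
  show "\<exists>T. open T \<and> x \<in> T \<and> smooth_on T (\<lambda>x. ?f (inv_coord c x))"
  proof (cases "inv_coord c x \<in> dom_chart d")
    case True
    let ?T = "{x \<in> codom_chart c. inv_coord c x \<in> dom_chart d}"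
    have oT: "open ?T" by (intro open_preimage_within ac ad)
    have "smooth_on ?T (\<lambda>x. w (coord d (inv_coord c x)))"
      by (rule smooth_on_compose[OF oT ad(2) smooth_transition[OF A c d] w(1)]) (use ad in auto)
    then have "smooth_on ?T (\<lambda>x. ?f (inv_coord c x))" by (rule smooth_on_cong[OF oT, rotated]) auto
    then show ?thesis using True x oT by (intro exI[of _ ?T]) auto
  next
    case False
    let ?T = "{x \<in> codom_chart c. inv_coord c x \<in> - inv_coord d ` K}"
    have oT: "open ?T" by (intro open_preimage_within ac) (use cl(1) in auto)
    have "smooth_on ?T (\<lambda>x. ?f (inv_coord c x))"
    proof (rule smooth_on_cong[OF oT _ smooth_on_const[of _ 0]])
      fix z assume z: "z \<in> ?T"
      show "0 = ?f (inv_coord c z)"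
        using z cl(2)[of "inv_coord c z"] w(2)[of "coord d (inv_coord c z)"] ad(6) by auto
    qed
    moreover have "x \<in> ?T" using False x cl(3) by auto
    ultimately show ?thesis using oT by blast
  qed
qed

text \<open>Bump functions around the points of a finite set, divided by their sum.\<close>

lemma partition_of_unity:
  fixes N :: "('b::{t2_space, second_countable_topology}, 'n::finite) mfd"
  assumes A: "smooth_atlas (charts N)" and cpt: "compact (UNIV :: 'b set)"
  shows "\<exists>I d K \<theta>. finite (I :: 'b set) \<and> (\<forall>i\<in>I. d i \<in> charts N \<and> compact (K i) \<and> K i \<subseteq> codom_chart (d i) \<and>

      smooth_function N (\<theta> i :: 'b \<Rightarrow> real) \<and> (\<forall>y. \<theta> i y \<noteq> 0 \<longrightarrow> y \<in> dom_chart (d i) \<and> coord (d i) y \<in> K i)) \<and>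
      (\<forall>y. (\<Sum>i\<in>I. \<theta> i y) = 1)"
proof -
  have "\<exists>d r. d \<in> charts N \<and> y \<in> dom_chart d \<and> r > 0 \<and> cball (coord d y) r \<subseteq> codom_chart d" for y
  proof -
    obtain d where d: "d \<in> charts N" "y \<in> dom_chart d" using atlas_cover[OF A] .
    obtain r where "r > 0" "cball (coord d y) r \<subseteq> codom_chart d"
      using atlas_chart(2)[OF A d(1)] atlas_chart(6)[OF A d] open_contains_cball by blast
    then show ?thesis using d by blast
  qed
  then obtain d r where dr: "\<And>y. d y \<in> charts N" "\<And>y. y \<in> dom_chart (d y)" "\<And>y. r y > 0"
    "\<And>y. cball (coord (d y) y) (r y) \<subseteq> codom_chart (d y)" by metis
  define K where "K i = cball (coord (d i) i) (r i)" for i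
  define \<beta> where "\<beta> i y = (if y \<in> dom_chart (d i) then bump (coord (d i) i) (r i) (coord (d i) y) else 0)" for i y
  have b0: "bump (coord (d i) i) (r i) x = 0" if "x \<notin> K i" for i x
  proof -
    have "\<not> bump (coord (d i) i) (r i) x > 0"
      unfolding bump_pos_iff[OF dr(3)] using that ball_subset_cball by (auto simp: K_def)
    then show ?thesis using bump_nonneg[of "coord (d i) i" "r i" x] by linarith
  qed
  have s\<beta>: "smooth_function N (\<beta> i)" for i
    unfolding \<beta>_def
    by (rule smooth_function_extend_by_zero[OF A dr(1), of "K i"]) (use dr(4) b0 smooth_bump in \<open>auto simp: K_def\<close>)
  have \<beta>0: "\<beta> i y \<ge> 0" for i y by (simp add: \<beta>_def bump_nonneg)
  have \<beta>K: "y \<in> dom_chart (d i) \<and> coord (d i) y \<in> K i" if "\<beta> i y \<noteq> 0" for i y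
    using that b0 by (auto simp: \<beta>_def split: if_splits)
  have op: "open {y. \<beta> i y > 0}" for i
    using open_Collect_less[OF continuous_on_const smooth_function_continuous[OF A s\<beta>]] .
  have "i \<in> {y. \<beta> i y > 0}" for i
    using dr(2)[of i] bump_pos_iff[OF dr(3)[of i], of "coord (d i) i" "coord (d i) i"] dr(3)[of i]
    by (simp only: \<beta>_def if_True mem_Collect_eq centre_in_ball)
  then have "UNIV \<subseteq> (\<Union>i\<in>UNIV. {y. \<beta> i y > 0})" by blast
  then obtain I where I: "finite I" "UNIV \<subseteq> (\<Union>i\<in>I. {y. \<beta> i y > 0})"
    using compactE_image[OF cpt, of UNIV "\<lambda>i. {y. \<beta> i y > 0}"] op by metis
  define \<Sigma> where "\<Sigma> y = (\<Sum>i\<in>I. \<beta> i y)" for y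
  have \<Sigma>: "\<Sigma> y > 0" for y
  proof -
    obtain i where i: "i \<in> I" "\<beta> i y > 0" using I(2) by blast
    show ?thesis unfolding \<Sigma>_def 
      by (rule sum_pos2[where f = "\<lambda>i. \<beta> i y", OF I(1) i]) (rule \<beta>0)
  qed
  have s\<Sigma>: "smooth_function N \<Sigma>" unfolding \<Sigma>_def by (intro smooth_function_sum[OF A] s\<beta>)
  define \<theta> where "\<theta> i y = \<beta> i y *\<^sub>R inverse (\<Sigma> y)" for i y
  have \<Sigma>0: "\<Sigma> y \<noteq> 0" for y using \<Sigma>[of y] by simp
  have s\<theta>: "smooth_function N (\<theta> i)" for i
    unfolding \<theta>_def by (rule smooth_function_scaleR[OF A s\<beta> smooth_function_inverse[OF A s\<Sigma> \<Sigma>0]])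
  have sum1: "(\<Sum>i\<in>I. \<theta> i y) = 1" for y
  proof -
    have "(\<Sum>i\<in>I. \<theta> i y) = \<Sigma> y * inverse (\<Sigma> y)" by (simp only: \<theta>_def \<Sigma>_def real_scaleR_def sum_distrib_right)
    then show ?thesis using \<Sigma>0 by simp
  qed
  have supp: "y \<in> dom_chart (d i)" "coord (d i) y \<in> K i" if "\<theta> i y \<noteq> 0" for i y
  proof -
    have "\<beta> i y \<noteq> 0" using that unfolding \<theta>_def by auto
    from \<beta>K[OF this] show "y \<in> dom_chart (d i)" "coord (d i) y \<in> K i" by blast+
  qed
  have K: "compact (K i)" "K i \<subseteq> codom_chart (d i)" for i
    unfolding K_def by (rule compact_cball) (rule dr(4))
  show ?thesis
    by (intro exI[of _ I] exI[of _ d] exI[of _ K] exI[of _ \<theta>] conjI ballI allI impI I(1) dr(1) K s\<theta> supp sum1)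
qed

section \<open>Variations with prescribed velocity\<close>

text \<open>The support of \<open>w\<close> is compact, so it has positive distance from the complement of the
  codomain of the chart, and \<open>x + t w x\<close> stays inside for small \<open>t\<close>. Outside the support
  nothing moves, and this glues the move to the identity.\<close>

lemma local_move:
  fixes N :: "('b::{t2_space, second_countable_topology}, 'n::finite) mfd"
  assumes A: "smooth_atlas (charts N)" and d: "d \<in> charts N" and K: "compact K" "K \<subseteq> codom_chart d"
    and w: "smooth_on (codom_chart d) w" "\<And>x. x \<in> codom_chart d \<Longrightarrow> x \<notin> K \<Longrightarrow> w x = 0"
  defines "\<phi> \<equiv> \<lambda>t y. if y \<in> dom_chart d then inv_coord d (coord d y + t *\<^sub>R w (coord d y)) else y"
  shows "\<exists>\<epsilon>>0. smooth_family N N \<phi> \<epsilon> \<and> (\<forall>t\<in>{-\<epsilon><..<\<epsilon>}. \<forall>x\<in>codom_chart d. x + t *\<^sub>R w x \<in> codom_chart d)"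
proof -
  note ad = atlas_chart[OF A d]
  note cl = closed_chart_support[OF A d K]
  obtain e where e: "e > 0" "(\<Union>x\<in>K. ball x e) \<subseteq> codom_chart d"
    using compact_subset_open_imp_ball_epsilon_subset[OF K(1) ad(2) K(2)] .
  have "bounded (w ` K)"
    by (intro compact_imp_bounded compact_continuous_image K(1) continuous_on_subset[OF smooth_on_continuous[OF w(1)] K(2)])
  then obtain b where b: "b > 0" "\<And>x. x \<in> K \<Longrightarrow> norm (w x) \<le> b" unfolding bounded_pos by auto
  \<comment> \<open>For \<open>|t| < e / b\<close> no point of \<open>K\<close> moves by \<open>e\<close> or more.\<close>
  define \<epsilon> where "\<epsilon> = e / b"
  have \<epsilon>: "\<epsilon> > 0" using e b by (simp add: \<epsilon>_def)
  let ?I = "{-\<epsilon><..<\<epsilon>}"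
  have stay: "x + t *\<^sub>R w x \<in> codom_chart d" if t: "t \<in> ?I" and x: "x \<in> codom_chart d" for t x
  proof (cases "x \<in> K")
    case True
    have "norm (t *\<^sub>R w x) \<le> \<bar>t\<bar> * b" using b(2)[OF True] by (simp add: mult_left_mono)
    also have "\<dots> < \<epsilon> * b" using t b by (intro mult_strict_right_mono) auto
    also have "\<dots> = e" using b by (simp add: \<epsilon>_def)
    finally have "x + t *\<^sub>R w x \<in> ball x e" by (simp add: dist_norm)
    then show ?thesis using e(2) True by blast
  next
    case False
    then show ?thesis using w(2)[OF x] x by simp
  qed
  have still: "\<phi> t y = y" if "y \<notin> inv_coord d ` K" for t y
    using cl(2)[of y] w(2)[of "coord d y"] ad(5,6)[of y] that by (auto simp: \<phi>_def)
  have inside: "\<phi> t (inv_coord d x) = inv_coord d (x + t *\<^sub>R w x)" if "x \<in> codom_chart d" for t x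
    using ad(7,8)[OF that] by (simp add: \<phi>_def)
  have cont: "continuous_on (?I \<times> UNIV) (\<lambda>(t, y). \<phi> t y)"
  proof -
    have o: "open (?I \<times> dom_chart d)" "open (?I \<times> (- inv_coord d ` K))"
      using ad(1) cl(1) by (auto intro: open_Times)
    have "continuous_on (?I \<times> dom_chart d) (\<lambda>z. inv_coord d (coord d (snd z) + fst z *\<^sub>R w (coord d (snd z))))"
    proof (rule continuous_on_compose2[OF ad(4)])
      have c: "continuous_on (?I \<times> dom_chart d) (\<lambda>z. coord d (snd z))"
        by (intro continuous_on_compose2[OF ad(3)] continuous_on_snd continuous_on_id) auto
      have "continuous_on (?I \<times> dom_chart d) (\<lambda>z. w (coord d (snd z)))"
        by (rule continuous_on_compose2[OF smooth_on_continuous[OF w(1)] c]) (use ad in auto)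
      then show "continuous_on (?I \<times> dom_chart d) (\<lambda>z. coord d (snd z) + fst z *\<^sub>R w (coord d (snd z)))"
        by (intro continuous_on_add c continuous_on_scaleR continuous_on_fst continuous_on_id)
    qed (use stay ad(6) in auto)
    then have 1: "continuous_on (?I \<times> dom_chart d) (\<lambda>(t, y). \<phi> t y)"
      by (rule continuous_on_eq) (auto simp: \<phi>_def)
    have "continuous_on (?I \<times> (- inv_coord d ` K)) (\<lambda>z. snd z)"
      by (intro continuous_on_snd continuous_on_id)
    then have 2: "continuous_on (?I \<times> (- inv_coord d ` K)) (\<lambda>(t, y). \<phi> t y)"
      by (rule continuous_on_eq) (auto simp: still)
    have "continuous_on (?I \<times> dom_chart d \<union> ?I \<times> (- inv_coord d ` K)) (\<lambda>(t, y). \<phi> t y)"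
      by (rule continuous_on_open_Un[OF o 1 2])
    moreover have "?I \<times> dom_chart d \<union> ?I \<times> (- inv_coord d ` K) = ?I \<times> UNIV" using cl(3) by auto
    ultimately show ?thesis by simp
  qed
  have "smooth_family N N \<phi> \<epsilon>"
  proof (rule smooth_familyI_local[OF A A cont])
    fix t y assume t: "t \<in> ?I"
    show "\<exists>c\<in>charts N. \<exists>d\<in>charts N. \<exists>W. y \<in> dom_chart c \<and> open W \<and> (t, coord c y) \<in> W \<and>
        W \<subseteq> family_domain \<epsilon> c d \<phi> \<and> smooth_on W (\<lambda>(t, x). coord d (\<phi> t (inv_coord c x)))"
    proof (cases "y \<in> dom_chart d")
      case True
      let ?W = "?I \<times> codom_chart d"
      have oW: "open ?W" using ad(2) by (auto intro: open_Times)
      have sW: "smooth_on ?W (\<lambda>z. w (snd z))"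
        by (rule smooth_on_compose[OF oW ad(2) smooth_on_snd[OF oW smooth_on_id[OF oW]] w(1)]) auto
      have "smooth_on ?W (\<lambda>z. snd z + fst z *\<^sub>R w (snd z))"
        by (intro smooth_on_add smooth_on_scaleR oW smooth_on_fst smooth_on_snd smooth_on_id sW)
      then have "smooth_on ?W (\<lambda>(t, x). coord d (\<phi> t (inv_coord d x)))"
        by (rule smooth_on_cong[OF oW, rotated]) (auto simp: inside ad(7)[OF stay])
      moreover have "?W \<subseteq> family_domain \<epsilon> d d \<phi>"
        using ad(8)[OF stay] by (auto simp: family_domain_def inside)
      ultimately show ?thesis
        using t True d oW ad(6)[OF True] by (intro bexI[of _ d] exI[of _ ?W]) auto
    next
      case False
      obtain c where c: "c \<in> charts N" "y \<in> dom_chart c" using atlas_cover[OF A] .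
      note ac = atlas_chart[OF A c(1)]
      let ?T = "{x \<in> codom_chart c. inv_coord c x \<in> - inv_coord d ` K}"
      let ?W = "?I \<times> ?T"
      have oT: "open ?T" by (intro open_preimage_within ac) (use cl(1) in auto)
      then have oW: "open ?W" by (auto intro: open_Times)
      have "smooth_on ?W snd" using smooth_on_snd[OF oW smooth_on_id[OF oW]] by simp
      then have "smooth_on ?W (\<lambda>(t, x). coord c (\<phi> t (inv_coord c x)))"
        by (rule smooth_on_cong[OF oW, rotated]) (auto simp: still ac(7))
      moreover have "?W \<subseteq> family_domain \<epsilon> c c \<phi>"
        using ac(8) by (auto simp: family_domain_def still)
      moreover have "(t, coord c y) \<in> ?W" using t c ac(5,6)[OF c(2)] False cl(3) by auto
      ultimately show ?thesis
        using c oW by (intro bexI[of _ c] exI[of _ ?W]) auto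
    qed
  qed
  then show ?thesis using \<epsilon> stay by blast
qed

lemma chart_curve_derivative:
  fixes N :: "('b::{t2_space, second_countable_topology}, 'n::finite) mfd"
  assumes A: "smooth_atlas (charts M)" "smooth_atlas (charts N)" and U: "smooth_family M N U \<epsilon>" "\<epsilon> > 0"
    and d: "d \<in> charts N" "U 0 p \<in> dom_chart d"
  obtains v \<delta> where "((\<lambda>t. coord d (U t p)) has_vector_derivative v) (at 0)" "\<delta> > 0" "\<delta> \<le> \<epsilon>"
    "\<And>t. t \<in> {-\<delta><..<\<delta>} \<Longrightarrow> U t p \<in> dom_chart d"
proof -
  obtain c where c: "c \<in> charts M" "p \<in> dom_chart c" using atlas_cover[OF A(1)] .
  note ac = atlas_chart[OF A(1) c(1)]
  have oF: "open (family_domain \<epsilon> c d U)"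
    by (rule open_family_domain[OF A(1) c(1) A(2) d(1) smooth_familyD(1)[OF U(1)]])
  have 0: "(0, coord c p) \<in> family_domain \<epsilon> c d U"
    using U(2) d(2) ac(5,6)[OF c(2)] by (simp add: family_domain_def)
  from has_vector_derivative_partial[OF smooth_on_has_derivative[OF smooth_familyD(2)[OF U(1) c(1) d(1)] 0]]
  obtain v where v: "((\<lambda>t. coord d (U t p)) has_vector_derivative v) (at 0)"
    unfolding fst_conv snd_conv ac(5)[OF c(2)] by blast
  obtain e where e: "e > 0" "ball (0, coord c p) e \<subseteq> family_domain \<epsilon> c d U"
    using oF 0 openE by blast
  have "U t p \<in> dom_chart d" if "t \<in> {-min e \<epsilon><..<min e \<epsilon>}" for t
  proof -
    have "(t, coord c p) \<in> ball (0, coord c p) e"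
      using that by (auto simp add: dist_Pair_Pair dist_real_def abs_less_iff min_def split: if_splits)
    then have "(t, coord c p) \<in> family_domain \<epsilon> c d U" using e(2) by blast
    then show ?thesis using ac(5)[OF c(2)] by (simp add: family_domain_def)
  qed
  with v e(1) U(2) show thesis by (intro that[of v "min e \<epsilon>"]) auto
qed

text \<open>The chain rule for the curve \<open>(t, U t p)\<close>: the velocity is the sum of the velocity at a fixed
  point and the derivative along the curve at time 0.\<close>

lemma velocity_along_family:
  fixes N :: "('b::{t2_space, second_countable_topology}, 'n::finite) mfd"
    and g :: "real \<Rightarrow> 'b \<Rightarrow> 'v::euclidean_space"
  assumes A: "smooth_atlas (charts M)" "smooth_atlas (charts N)" and U: "smooth_family M N U \<epsilon>" "\<epsilon> > 0"
    and g: "smooth_evolution N g \<epsilon>" and d: "d \<in> charts N" "U 0 p \<in> dom_chart d"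
    and v: "((\<lambda>t. coord d (U t p)) has_vector_derivative v) (at 0)"
    and X: "((\<lambda>t. g t (U 0 p)) has_vector_derivative X) (at 0)"
  shows "((\<lambda>t. g t (U t p)) has_vector_derivative
     X + frechet_derivative (\<lambda>y. g 0 (inv_coord d y)) (at (coord d (U 0 p))) v) (at 0)"
proof -
  note ad = atlas_chart[OF A(2) d(1)]
  let ?G = "\<lambda>z. g (fst z) (inv_coord d (snd z))" and ?y = "coord d (U 0 p)"
  obtain \<delta> where \<delta>: "\<delta> > 0" "\<And>t. t \<in> {-\<delta><..<\<delta>} \<Longrightarrow> U t p \<in> dom_chart d"
    using chart_curve_derivative[OF A U d] by metis
  have sG: "smooth_on ({-\<epsilon><..<\<epsilon>} \<times> codom_chart d) ?G"
    using g d(1) by (simp add: smooth_evolution_def case_prod_beta')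
  have in_S: "(0, ?y) \<in> {-\<epsilon><..<\<epsilon>} \<times> codom_chart d" using U(2) ad(6)[OF d(2)] by simp
  define G' where "G' = frechet_derivative ?G (at (0, ?y))"
  have G': "(?G has_derivative G') (at (0, ?y))"
    unfolding G'_def by (rule smooth_on_has_derivative[OF sG in_S])
  have lin: "linear G'" using G' has_derivative_linear by blast
  have "((\<lambda>t. (t, coord d (U t p))) has_vector_derivative (1, v)) (at 0)"
    by (rule has_vector_derivative_Pair[OF has_vector_derivative_id v])
  then have "((\<lambda>t. (t, coord d (U t p))) has_derivative (\<lambda>s. s *\<^sub>R (1, v))) (at 0)"
    by (simp only: has_vector_derivative_def)
  from has_derivative_compose[OF this, of ?G G'] G'
  have "((\<lambda>t. g t (inv_coord d (coord d (U t p)))) has_derivative (\<lambda>s. G' (s *\<^sub>R (1, v)))) (at 0)" by simp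
  then have "((\<lambda>t. g t (inv_coord d (coord d (U t p)))) has_vector_derivative G' (1, v)) (at 0)"
    by (simp only: has_vector_derivative_def linear_scale[OF lin])
  then have 1: "((\<lambda>t. g t (U t p)) has_vector_derivative G' (1, v)) (at 0)"
    by (rule has_vector_derivative_transform_within_open[of _ _ _ "{-\<delta><..<\<delta>}"]) (use \<delta> ad(5) in auto)
  have "((\<lambda>t. g t (U 0 p)) has_vector_derivative G' (1, 0)) (at 0)"
    using has_vector_derivative_partial[OF G'] ad(5)[OF d(2)] by simp
  then have 2: "G' (1, 0) = X" using X vector_derivative_unique_at by blast
  have "((\<lambda>y. (0, y)) has_derivative (\<lambda>w. (0, w))) (at ?y)"
    by (auto intro!: derivative_eq_intros)
  from has_derivative_compose[OF this, of ?G G'] G'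
  have "((\<lambda>y. g 0 (inv_coord d y)) has_derivative (\<lambda>w. G' (0, w))) (at ?y)" by simp
  from frechet_derivative_at[OF this]
  have 3: "frechet_derivative (\<lambda>y. g 0 (inv_coord d y)) (at ?y) v = G' (0, v)" by (metis)
  have "G' (1, v) = G' (1, 0) + G' (0, v)" using linear_add[OF lin, of "(1, 0)" "(0, v)"] by simp
  then show ?thesis using 1 2 3 by simp
qed

text \<open>Velocities add under composition, because both families start at the identity.\<close>

lemma compose_moves:
  fixes N :: "('b::{t2_space, second_countable_topology}, 'n::finite) mfd"
    and F :: "'b \<Rightarrow> 'v::euclidean_space"
  assumes A: "smooth_atlas (charts N)" and F: "smooth_function N F"
    and \<phi>: "smooth_family N N \<phi> \<epsilon>" "\<epsilon> > 0" "\<And>y. \<phi> 0 y = y" "\<And>y. ((\<lambda>t. F (\<phi> t y)) has_vector_derivative X y) (at 0)"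
    and \<psi>: "smooth_family N N \<psi> \<epsilon>" "\<And>y. \<psi> 0 y = y" "\<And>y. ((\<lambda>t. F (\<psi> t y)) has_vector_derivative Y y) (at 0)"
  shows "((\<lambda>t. F (\<phi> t (\<psi> t y))) has_vector_derivative X y + Y y) (at 0)"
proof -
  obtain d where d: "d \<in> charts N" "y \<in> dom_chart d" using atlas_cover[OF A] .
  have d0: "\<psi> 0 y \<in> dom_chart d" using d \<psi>(2) by simp
  obtain v where v: "((\<lambda>t. coord d (\<psi> t y)) has_vector_derivative v) (at 0)"
    using chart_curve_derivative[OF A A \<psi>(1) \<phi>(2) d(1) d0] by metis
  have e\<phi>: "smooth_evolution N (\<lambda>t y. F (\<phi> t y)) \<epsilon>" by (rule smooth_evolution_compose[OF A A \<phi>(1) F])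
  have eF: "smooth_evolution N (\<lambda>t y. F y) \<epsilon>"
    using smooth_evolution_compose[OF A A _ F, of "\<lambda>t y. y" \<epsilon>]
      smooth_family_constant[OF A A, of "\<lambda>y. y" \<epsilon>] A
    unfolding smooth_map_def
    by (auto simp: vimage_def o_def chart_image_eq[OF A] intro!: continuous_on_id smooth_transition[OF A])
  let ?D = "frechet_derivative (\<lambda>z. F (inv_coord d z)) (at (coord d y)) v"
  have "((\<lambda>t. F (\<psi> t y)) has_vector_derivative 0 + ?D) (at 0)"
    using velocity_along_family[OF A A \<psi>(1) \<phi>(2) eF d(1) d0 v, of 0] \<psi>(2) by simp
  then have "?D = Y y" using \<psi>(3)[of y] vector_derivative_unique_at by fastforce
  moreover have "((\<lambda>t. F (\<phi> t (\<psi> t y))) has_vector_derivative X y + ?D) (at 0)"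
    using velocity_along_family[OF A A \<psi>(1) \<phi>(2) e\<phi> d(1) d0 v] \<phi>(3,4) \<psi>(2) by simp
  ultimately show ?thesis by simp
qed

lemma local_move_velocity:
  fixes N :: "('b::{t2_space, second_countable_topology}, 'n::finite) mfd"
    and F :: "'b \<Rightarrow> 'v::euclidean_space"
  assumes A: "smooth_atlas (charts N)" and F: "smooth_function N F" and d: "d \<in> charts N" and y: "y \<in> dom_chart d"
    and \<epsilon>: "\<epsilon> > 0" "\<And>t. t \<in> {-\<epsilon><..<\<epsilon>} \<Longrightarrow> coord d y + t *\<^sub>R w \<in> codom_chart d"
  shows "((\<lambda>t. F (inv_coord d (coord d y + t *\<^sub>R w))) has_vector_derivative
     frechet_derivative (\<lambda>x. F (inv_coord d x)) (at (coord d y)) w) (at 0)"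
proof -
  have "smooth_on (codom_chart d) (\<lambda>x. F (inv_coord d x))" using F d by (simp add: smooth_function_def)
  from smooth_on_has_derivative[OF this atlas_chart(6)[OF A d y]]
  have D: "((\<lambda>x. F (inv_coord d x)) has_derivative frechet_derivative (\<lambda>x. F (inv_coord d x)) (at (coord d y)))
    (at (coord d y + 0 *\<^sub>R w))" by simp
  have "((\<lambda>t. coord d y + t *\<^sub>R w) has_derivative (\<lambda>t. t *\<^sub>R w)) (at 0)"
    by (auto intro!: derivative_eq_intros)
  from has_derivative_compose[OF this D] show ?thesis
    by (simp only: has_vector_derivative_def linear_scale[OF has_derivative_linear[OF D]])
qed

text \<open>A partition of unity writes the field as a sum of fields with compact support in charts. Each of them is
  the velocity of a local move, and the composition of these moves has the sum of the velocities. The velocity is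
  measured after composing with \<open>F\<close>, so that it is a vector field in Euclidean space.\<close>

lemma ex_family_with_velocity:
  fixes N :: "('b::{t2_space, second_countable_topology}, 'n::finite) mfd"
    and F X :: "'b \<Rightarrow> 'v::euclidean_space" and V :: "('b, 'n) chart \<Rightarrow> 'b \<Rightarrow> real ^ 'n"
  assumes A: "smooth_atlas (charts N)" and cpt: "compact (UNIV :: 'b set)" and F: "smooth_function N F"
    and V: "\<And>d. d \<in> charts N \<Longrightarrow> smooth_on (codom_chart d) (\<lambda>x. V d (inv_coord d x))"
      "\<And>d y. d \<in> charts N \<Longrightarrow> y \<in> dom_chart d \<Longrightarrow>
        frechet_derivative (\<lambda>x. F (inv_coord d x)) (at (coord d y)) (V d y) = X y"
  shows "\<exists>\<phi> \<epsilon>. \<epsilon> > 0 \<and> smooth_family N N \<phi> \<epsilon> \<and> (\<forall>y. \<phi> 0 y = y) \<and>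
     (\<forall>y. ((\<lambda>t. F (\<phi> t y)) has_vector_derivative X y) (at 0))"
proof -
  obtain I d K and \<theta> :: "'b \<Rightarrow> 'b \<Rightarrow> real" where "finite (I :: 'b set)" and
    P: "\<forall>i\<in>I. d i \<in> charts N \<and> compact (K i) \<and> K i \<subseteq> codom_chart (d i) \<and>
      smooth_function N (\<theta> i) \<and> (\<forall>y. \<theta> i y \<noteq> 0 \<longrightarrow> y \<in> dom_chart (d i) \<and> coord (d i) y \<in> K i)"
    and P1: "\<forall>y. (\<Sum>i\<in>I. \<theta> i y) = 1"
    using partition_of_unity[OF A cpt] by (elim exE conjE) (rule that; assumption)
  have I: "\<And>i. i \<in> I \<Longrightarrow> d i \<in> charts N" "\<And>i. i \<in> I \<Longrightarrow> compact (K i)" "\<And>i. i \<in> I \<Longrightarrow> K i \<subseteq> codom_chart (d i)"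
      "\<And>i. i \<in> I \<Longrightarrow> smooth_function N (\<theta> i)"
      "\<And>i y. i \<in> I \<Longrightarrow> \<theta> i y \<noteq> 0 \<Longrightarrow> y \<in> dom_chart (d i)"
      "\<And>i y. i \<in> I \<Longrightarrow> \<theta> i y \<noteq> 0 \<Longrightarrow> coord (d i) y \<in> K i"
      "\<And>y. (\<Sum>i\<in>I. \<theta> i y) = 1"
    using P P1 by blast+
  have single: "\<exists>\<phi> \<epsilon>. \<epsilon> > 0 \<and> smooth_family N N \<phi> \<epsilon> \<and> (\<forall>y. \<phi> 0 y = y) \<and>
     (\<forall>y. ((\<lambda>t. F (\<phi> t y)) has_vector_derivative \<theta> i y *\<^sub>R X y) (at 0))" if i: "i \<in> I" for i
  proof -
    let ?d = "d i"
    note ad = atlas_chart[OF A I(1)[OF i]]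
    define w where "w x = \<theta> i (inv_coord ?d x) *\<^sub>R V ?d (inv_coord ?d x)" for x
    have w: "smooth_on (codom_chart ?d) w"
      unfolding w_def using I(4)[OF i] I(1)[OF i]
      by (intro smooth_on_scaleR ad V) (auto simp: smooth_function_def)
    have w0: "w x = 0" if "x \<in> codom_chart ?d" "x \<notin> K i" for x
      using I(6)[OF i, of "inv_coord ?d x"] ad(7)[OF that(1)] that by (auto simp: w_def)
    let ?\<phi> = "\<lambda>t y. if y \<in> dom_chart ?d then inv_coord ?d (coord ?d y + t *\<^sub>R w (coord ?d y)) else y"
    obtain \<epsilon> where \<epsilon>: "\<epsilon> > 0" "smooth_family N N ?\<phi> \<epsilon>"
      "\<forall>t\<in>{-\<epsilon><..<\<epsilon>}. \<forall>x\<in>codom_chart ?d. x + t *\<^sub>R w x \<in> codom_chart ?d"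
      using local_move[OF A I(1-3)[OF i] w w0] by blast
    have "((\<lambda>t. F (?\<phi> t y)) has_vector_derivative \<theta> i y *\<^sub>R X y) (at 0)" for y
    proof (cases "y \<in> dom_chart ?d")
      case True
      have D: "linear (frechet_derivative (\<lambda>x. F (inv_coord ?d x)) (at (coord ?d y)))"
      proof -
        have "smooth_on (codom_chart ?d) (\<lambda>x. F (inv_coord ?d x))"
          using F I(1)[OF i] by (simp add: smooth_function_def)
        from smooth_on_has_derivative[OF this ad(6)[OF True]] show ?thesis by (rule has_derivative_linear)
      qed
      have "((\<lambda>t. F (inv_coord ?d (coord ?d y + t *\<^sub>R w (coord ?d y)))) has_vector_derivative
         frechet_derivative (\<lambda>x. F (inv_coord ?d x)) (at (coord ?d y)) (w (coord ?d y))) (at 0)"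
        by (rule local_move_velocity[OF A F I(1)[OF i] True \<epsilon>(1)]) (use \<epsilon>(3) ad(6)[OF True] in blast)
      then show ?thesis
        using True V(2)[OF I(1)[OF i] True] by (simp add: w_def ad(5) linear_scale[OF D])
    next
      case False
      then have "\<theta> i y = 0" using I(5)[OF i] by blast
      then show ?thesis using False by simp
    qed
    moreover have "\<forall>y. ?\<phi> 0 y = y" using ad(5) by simp
    ultimately show ?thesis using \<epsilon> by (intro exI[of _ ?\<phi>] exI[of _ \<epsilon>]) auto
  qed
  \<comment> \<open>Induction on the number of cutoff functions already dealt with.\<close>
  have "J \<subseteq> I \<Longrightarrow> \<exists>\<phi> \<epsilon>. \<epsilon> > 0 \<and> smooth_family N N \<phi> \<epsilon> \<and> (\<forall>y. \<phi> 0 y = y) \<and>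
     (\<forall>y. ((\<lambda>t. F (\<phi> t y)) has_vector_derivative (\<Sum>i\<in>J. \<theta> i y *\<^sub>R X y)) (at 0))" if "finite J" for J
    using that
  proof (induction J rule: finite_induct)
    case empty
    have "smooth_map N N (\<lambda>y. y)"
      using A unfolding smooth_map_def
      by (auto simp: vimage_def o_def chart_image_eq[OF A] intro!: continuous_on_id smooth_transition[OF A])
    then have "smooth_family N N (\<lambda>t y. y) 1" by (rule smooth_family_constant[OF A A])
    then show ?case by (intro exI[of _ "\<lambda>t y. y"] exI[of _ 1]) auto
  next
    case (insert i J)
    then obtain \<psi> \<delta> where \<psi>: "\<delta> > 0" "smooth_family N N \<psi> \<delta>" "\<And>y. \<psi> 0 y = y"
       "\<And>y. ((\<lambda>t. F (\<psi> t y)) has_vector_derivative (\<Sum>i\<in>J. \<theta> i y *\<^sub>R X y)) (at 0)" by auto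
    obtain \<phi> \<epsilon> where \<phi>: "\<epsilon> > 0" "smooth_family N N \<phi> \<epsilon>" "\<And>y. \<phi> 0 y = y"
       "\<And>y. ((\<lambda>t. F (\<phi> t y)) has_vector_derivative \<theta> i y *\<^sub>R X y) (at 0)"
      using single[of i] insert.prems by auto
    let ?\<epsilon> = "min \<epsilon> \<delta>"
    have m: "smooth_family N N \<phi> ?\<epsilon>" "smooth_family N N \<psi> ?\<epsilon>" "?\<epsilon> > 0"
      using smooth_family_mono[OF \<phi>(2)] smooth_family_mono[OF \<psi>(2)] \<phi>(1) \<psi>(1) by auto
    have "smooth_family N N (\<lambda>t y. \<phi> t (\<psi> t y)) ?\<epsilon>" by (rule smooth_family_compose[OF A A A m(2,1)])
    moreover have "((\<lambda>t. F (\<phi> t (\<psi> t y))) has_vector_derivative (\<Sum>i\<in>insert i J. \<theta> i y *\<^sub>R X y)) (at 0)" for y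
      using compose_moves[OF A F m(1,3) \<phi>(3,4) m(2) \<psi>(3,4)] insert(1,2) by simp
    ultimately show ?case using m(3) \<phi>(3) \<psi>(3)
      by (intro exI[of _ "\<lambda>t y. \<phi> t (\<psi> t y)"] exI[of _ ?\<epsilon>]) auto
  qed
  from this[OF \<open>finite I\<close>] show ?thesis
    by (simp add: scaleR_sum_left[symmetric] I(7))
qed

section \<open>The energy density\<close>

definition pullback_gram ::
  "('a, 'm::finite) chart \<Rightarrow> ('a \<Rightarrow> real ^ ('q::finite)) \<Rightarrow> 'a \<Rightarrow> real ^ 'm ^ 'm" where
  "pullback_gram c \<Psi> p =
     (\<chi> k l. differential_euclidean c \<Psi> p (axis k 1) \<bullet> differential_euclidean c \<Psi> p (axis l 1))"

text \<open>The trace of the cube of \<open>g\<inverse> \<Psi>\<^sup>*\<langle>_,_\<rangle>\<close>: the frame-free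
  form of the energy density of a map \<open>\<Psi>\<close> into Euclidean space.\<close>

definition energy_density ::
  "('a, 'm::finite) mfd \<Rightarrow> ('a, 'm) chart \<Rightarrow> ('a \<Rightarrow> real ^ ('q::finite)) \<Rightarrow> 'a \<Rightarrow> real" where
  "energy_density M c \<Psi> p =
     (let L = matrix_inv (gram M c p) ** pullback_gram c \<Psi> p in trace (L ** L ** L))"

definition cubic_sum :: "('m::finite \<Rightarrow> 'm \<Rightarrow> real) \<Rightarrow> real" where
  "cubic_sum G = (\<Sum>i\<in>UNIV. \<Sum>j\<in>UNIV. \<Sum>k\<in>UNIV. G i j * G j k * G k i)"

lemma smooth_function_has_derivative:
  fixes M :: "('a::{t2_space, second_countable_topology}, 'm::finite) mfd"
  assumes A: "smooth_atlas (charts M)" and f: "smooth_function M f" and c: "c \<in> charts M" "p \<in> dom_chart c"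
  shows "((\<lambda>x. f (inv_coord c x)) has_derivative differential_euclidean c f p) (at (coord c p))"
proof -
  have "smooth_on (codom_chart c) (\<lambda>x. f (inv_coord c x))" using f c by (simp add: smooth_function_def)
  from smooth_on_has_derivative[OF this atlas_chart(6)[OF A c]]
  show ?thesis by (simp add: differential_euclidean_def o_def)
qed

lemma pullback_gram_apply:
  assumes "linear (differential_euclidean c \<Psi> p)"
  shows "v \<bullet> (pullback_gram c \<Psi> p *v w) =
    differential_euclidean c \<Psi> p v \<bullet> differential_euclidean c \<Psi> p w"
proof -
  let ?D = "differential_euclidean c \<Psi> p"
  have D: "?D v = (\<Sum>k\<in>UNIV. (v $ k) *\<^sub>R ?D (axis k 1))" for v
    by (subst basis_expansion[of v, symmetric])
      (simp add: linear_sum[OF assms] scalar_mult_eq_scaleR linear_scale[OF assms])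
  let ?S = "\<Sum>k\<in>UNIV. \<Sum>l\<in>UNIV. (v $ k) * ((w $ l) * (?D (axis k 1) \<bullet> ?D (axis l 1)))"
  have "v \<bullet> (pullback_gram c \<Psi> p *v w) = ?S"
    by (simp add: pullback_gram_def matrix_vector_mult_def inner_vec_def sum_distrib_left mult.commute mult.left_commute)
  also have "?S = (\<Sum>k\<in>UNIV. (v $ k) *\<^sub>R ?D (axis k 1)) \<bullet> (\<Sum>l\<in>UNIV. (w $ l) *\<^sub>R ?D (axis l 1))"
    by (simp only: inner_sum_left) (simp add: inner_sum_right sum_distrib_left mult.left_commute)
  also have "\<dots> = ?D v \<bullet> ?D w" using D[of v] D[of w] by simp
  finally show ?thesis .
qed

lemma energy_density_in_frame:
  assumes "orthonormal_frame M c p e" "linear (differential_euclidean c \<Psi> p)"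
  shows "cubic_sum (\<lambda>i j. differential_euclidean c \<Psi> p (e i) \<bullet> differential_euclidean c \<Psi> p (e j))
    = energy_density M c \<Psi> p"
  unfolding cubic_sum_def energy_density_def Let_def
  using trace_cube_in_orthonormal_frame[OF orthonormal_frame_gram[OF assms(1)], of "pullback_gram c \<Psi> p"]
  by (simp only: pullback_gram_apply[OF assms(2)])

lemma differential_euclidean_change_chart:
  fixes M :: "('a::{t2_space, second_countable_topology}, 'm::finite) mfd"
  assumes A: "smooth_atlas (charts M)" and f: "smooth_function M f"
    and c: "c \<in> charts M" "d \<in> charts M" "p \<in> dom_chart c" "p \<in> dom_chart d"
  shows "differential_euclidean c f p v = differential_euclidean d f p (differential c d id p v)"
proof -
  have "((\<lambda>x. f (inv_coord c x)) has_derivative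
      (\<lambda>v. differential_euclidean d f p (differential c d id p v))) (at (coord c p))"
    by (rule has_derivative_change_chart[OF A c smooth_function_has_derivative[OF A f c(2,4)]])
  from has_derivative_unique[OF smooth_function_has_derivative[OF A f c(1,3)] this] show ?thesis
    by (rule fun_cong)
qed

text \<open>An orthonormal frame in one chart is carried to one in the other chart, and both expressions are the same
  sum over that frame.\<close>

lemma energy_density_change_chart:
  fixes M :: "('a::{t2_space, second_countable_topology}, 'm::finite) mfd"
  assumes R: "riemannian_manifold M" and f: "smooth_function M f"
    and c: "c \<in> charts M" "d \<in> charts M" "p \<in> dom_chart c" "p \<in> dom_chart d"
  shows "energy_density M c f p = energy_density M d f p"
proof -
  note A = riemannian_manifoldD(1)[OF R]
  obtain e where e: "orthonormal_frame M c p e" using ex_orthonormal_frame[OF R c(1,3)] .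
  have e': "orthonormal_frame M d p (\<lambda>i. differential c d id p (e i))"
    using e riemannian_manifoldD(5)[OF R c] by (simp add: orthonormal_frame_def)
  have lin: "linear (differential_euclidean c f p)" "linear (differential_euclidean d f p)"
    using smooth_function_has_derivative[OF A f] c has_derivative_linear by blast+
  show ?thesis
    unfolding energy_density_in_frame[OF e lin(1), symmetric] energy_density_in_frame[OF e' lin(2), symmetric]
    by (simp only: differential_euclidean_change_chart[OF A f c])
qed

lemma isometric_immersionD:
  assumes "isometric_immersion N F"
  shows "smooth_function N F"
    "d \<in> charts N \<Longrightarrow> y \<in> dom_chart d \<Longrightarrow>
      differential_euclidean d F y v \<bullet> differential_euclidean d F y w = metric N d y v w"
  using assms unfolding isometric_immersion_def smooth_function_def by (auto simp: o_def)

lemma smooth_map_differentiable: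
  assumes A: "smooth_atlas (charts M)" and w: "smooth_map M N w"
    and c: "c \<in> charts M" "p \<in> dom_chart c" and d: "d \<in> charts N" "w p \<in> dom_chart d"
  shows "(\<lambda>x. coord d (w (inv_coord c x))) differentiable (at (coord c p))"
proof -
  have "smooth_on (coord c ` (dom_chart c \<inter> w -` dom_chart d)) (\<lambda>x. coord d (w (inv_coord c x)))"
    using w c d by (auto simp: smooth_map_def o_def)
  moreover have "coord c p \<in> coord c ` (dom_chart c \<inter> w -` dom_chart d)" using c d by blast
  ultimately show ?thesis unfolding differentiable_def by (blast intro: smooth_on_has_derivative)
qed

lemma differential_euclidean_compose:
  fixes M :: "('a::{t2_space, second_countable_topology}, 'm::finite) mfd"
    and N :: "('b::{t2_space, second_countable_topology}, 'n::finite) mfd"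
  assumes A: "smooth_atlas (charts M)" "smooth_atlas (charts N)" and w: "smooth_map M N w"
    and f: "smooth_function N f"
    and c: "c \<in> charts M" "p \<in> dom_chart c" and d: "d \<in> charts N" "w p \<in> dom_chart d"
  shows "((\<lambda>x. f (w (inv_coord c x))) has_derivative
      (\<lambda>v. differential_euclidean d f (w p) (differential c d w p v))) (at (coord c p))"
    "differential_euclidean c (\<lambda>p. f (w p)) p v = differential_euclidean d f (w p) (differential c d w p v)"
proof -
  have cw: "continuous_on UNIV w" using w by (simp add: smooth_map_def)
  show 1: "((\<lambda>x. f (w (inv_coord c x))) has_derivative
      (\<lambda>v. differential_euclidean d f (w p) (differential c d w p v))) (at (coord c p))"
    by (rule has_derivative_through_chart[OF A(1) c(1) A(2) d(1) cw c(2) d(2)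
          smooth_map_differentiable[OF A(1) w c d] smooth_function_has_derivative[OF A(2) f d]])
  show "differential_euclidean c (\<lambda>p. f (w p)) p v = differential_euclidean d f (w p) (differential c d w p v)"
    using frechet_derivative_at[OF 1] by (simp add: differential_euclidean_def o_def fun_eq_iff)
qed

lemma smooth_function_compose:
  assumes A: "smooth_atlas (charts M)" "smooth_atlas (charts N)" and w: "smooth_map M N w" and f: "smooth_function N f"
  shows "smooth_function M (\<lambda>p. f (w p))"
  using smooth_evolution_at[OF A(1) smooth_evolution_compose[OF A smooth_family_constant[OF A w, of 1] f], of 0]
  by simp

text \<open>As \<open>F\<close> is isometric, the metric of the target, evaluated on the differential of
  \<open>w\<close>, is the Euclidean product of the derivatives of \<open>F \<circ> w\<close>. So every chart and
  frame that the choice operator may pick gives the same value.\<close>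

lemma d3_norm_sq_eq_energy_density:
  fixes M :: "('a::{t2_space, second_countable_topology}, 'm::finite) mfd"
    and N :: "('b::{t2_space, second_countable_topology}, 'n::finite) mfd"
  assumes R: "riemannian_manifold M" "riemannian_manifold N" and F: "isometric_immersion N F"
    and w: "smooth_map M N w" and c: "c \<in> charts M" "p \<in> dom_chart c"
  shows "d3_norm_sq M N w p = energy_density M c (\<lambda>p. F (w p)) p"
proof -
  note A = riemannian_manifoldD(1)[OF R(1)] riemannian_manifoldD(1)[OF R(2)]
  note f = isometric_immersionD(1)[OF F]
  have sf: "smooth_function M (\<lambda>p. F (w p))" by (rule smooth_function_compose[OF A w f])
  let ?P = "\<lambda>s. \<exists>c\<in>charts M. \<exists>d\<in>charts N. \<exists>e. p \<in> dom_chart c \<and> w p \<in> dom_chart d \<and> orthonormal_frame M c p e \<and>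
      s = (let du = differential c d w p; h = metric N d (w p) in cubic_sum (\<lambda>i j. h (du (e i)) (du (e j))))"
  have d3: "d3_norm_sq M N w p = (SOME s. ?P s)"
    unfolding d3_norm_sq_def cubic_sum_def Let_def ..
  have val: "s = energy_density M c (\<lambda>p. F (w p)) p" if s: "?P s" for s
  proof -
    from s obtain c' d e where c': "c' \<in> charts M" "p \<in> dom_chart c'" and d: "d \<in> charts N" "w p \<in> dom_chart d"
      and e: "orthonormal_frame M c' p e"
      and s: "s = cubic_sum (\<lambda>i j. metric N d (w p) (differential c' d w p (e i)) (differential c' d w p (e j)))"
      unfolding Let_def by blast
    have lin: "linear (differential_euclidean c' (\<lambda>p. F (w p)) p)"
      using smooth_function_has_derivative[OF A(1) sf c'] has_derivative_linear by blast
    have "s = cubic_sum (\<lambda>i j. differential_euclidean c' (\<lambda>p. F (w p)) p (e i) \<bullet>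
        differential_euclidean c' (\<lambda>p. F (w p)) p (e j))"
      unfolding s isometric_immersionD(2)[OF F d, symmetric] differential_euclidean_compose(2)[OF A w f c' d] ..
    also have "\<dots> = energy_density M c (\<lambda>p. F (w p)) p"
      unfolding energy_density_in_frame[OF e lin] by (rule energy_density_change_chart[OF R(1) sf c'(1) c(1) c'(2) c(2)])
    finally show ?thesis .
  qed
  obtain d where d: "d \<in> charts N" "w p \<in> dom_chart d" using atlas_cover[OF A(2)] .
  obtain e where e: "orthonormal_frame M c p e" using ex_orthonormal_frame[OF R(1) c] .
  have "\<exists>s. ?P s" using c d e unfolding Let_def by blast
  from someI_ex[OF this] show ?thesis unfolding d3 by (rule val)
qed

lemma smooth_family_at:
  fixes M :: "('a::{t2_space, second_countable_topology}, 'm::finite) mfd"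
    and N :: "('b::{t2_space, second_countable_topology}, 'n::finite) mfd"
  assumes A: "smooth_atlas (charts M)" "smooth_atlas (charts N)" and U: "smooth_family M N U \<epsilon>"
    and t: "t \<in> {-\<epsilon><..<\<epsilon>}"
  shows "smooth_map M N (U t)"
  unfolding smooth_map_def
proof (intro conjI ballI)
  have "continuous_on UNIV (\<lambda>p. (t, p))" by (intro continuous_intros)
  from continuous_on_compose2[OF smooth_familyD(1)[OF U] this] t
  show cU: "continuous_on UNIV (U t)" by (auto simp: image_subset_iff)
  fix c d assume cd: "c \<in> charts M" "d \<in> charts N"
  let ?S = "coord c ` (dom_chart c \<inter> U t -` dom_chart d)"
  have oS: "open ?S"
    by (intro open_chart_image[OF A(1) cd(1)] open_vimage atlas_chart(1)[OF A(2) cd(2)]) (use cU in simp)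
  have in_dom: "(t, x) \<in> family_domain \<epsilon> c d U" if "x \<in> ?S" for x
    using that t atlas_chart(5,6)[OF A(1) cd(1)] by (auto simp: family_domain_def)
  have "smooth_on ?S (\<lambda>x. (t, x))" by (intro smooth_on_Pair oS smooth_on_const smooth_on_id)
  from smooth_on_compose[OF oS open_family_domain[OF A(1) cd(1) A(2) cd(2) smooth_familyD(1)[OF U]] this
      smooth_familyD(2)[OF U cd] in_dom]
  show "smooth_on ?S (coord d \<circ> U t \<circ> inv_coord c)" by (simp add: o_def)
qed

lemma smooth_on_matrix_mult:
  fixes A :: "'a::euclidean_space \<Rightarrow> real ^ 'n ^ 'm" and B :: "'a \<Rightarrow> real ^ 'k ^ 'n"
  assumes "open S" "smooth_on S A" "smooth_on S B"
  shows "smooth_on S (\<lambda>x. A x ** B x)"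
  by (intro smooth_on_vec assms(1))
    (simp add: matrix_matrix_mult_def smooth_on_sum smooth_on_mult smooth_on_entry assms)

text \<open>The spatial derivative at a fixed time is a partial derivative of the joint function, which makes it
  smooth in time.\<close>

lemma evolution_partial_derivative:
  fixes M :: "('a::{t2_space, second_countable_topology}, 'm::finite) mfd"
  assumes A: "smooth_atlas (charts M)" and g: "smooth_evolution M g \<epsilon>" and c: "c \<in> charts M"
    and t: "t \<in> {-\<epsilon><..<\<epsilon>}" and x: "x \<in> codom_chart c"
  shows "differential_euclidean c (g t) (inv_coord c x) v =
    frechet_derivative (\<lambda>(t, x). g t (inv_coord c x)) (at (t, x)) (0, v)"
proof -
  have "smooth_on ({-\<epsilon><..<\<epsilon>} \<times> codom_chart c) (\<lambda>(t, x). g t (inv_coord c x))"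
    using g c by (simp add: smooth_evolution_def)
  from smooth_on_has_derivative[OF this, of "(t, x)"] t x
  have D: "((\<lambda>(t, x). g t (inv_coord c x)) has_derivative
     frechet_derivative (\<lambda>(t, x). g t (inv_coord c x)) (at (t, x))) (at (t, x))" by simp
  have "((\<lambda>y. (t, y)) has_derivative (\<lambda>w. (0, w))) (at x)"
    by (auto intro!: derivative_eq_intros)
  from has_derivative_compose[OF this D]
  have "((\<lambda>y. g t (inv_coord c y)) has_derivative
     (\<lambda>w. frechet_derivative (\<lambda>(t, x). g t (inv_coord c x)) (at (t, x)) (0, w))) (at x)" by simp
  from frechet_derivative_at[OF this]
  show ?thesis
    by (simp add: differential_euclidean_def o_def atlas_chart(7)[OF A c x] fun_eq_iff)
qed

lemma smooth_evolution_energy_density: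
  fixes M :: "('a::{t2_space, second_countable_topology}, 'm::finite) mfd"
    and N :: "('b::{t2_space, second_countable_topology}, 'n::finite) mfd"
  assumes R: "riemannian_manifold M" "riemannian_manifold N" and F: "isometric_immersion N F"
    and U: "smooth_family M N U \<epsilon>"
  shows "smooth_evolution M (\<lambda>t p. d3_norm_sq M N (U t) p) \<epsilon>"
  unfolding smooth_evolution_def
proof
  fix c assume c: "c \<in> charts M"
  note A = riemannian_manifoldD(1)[OF R(1)] riemannian_manifoldD(1)[OF R(2)]
  note ac = atlas_chart[OF A(1) c]
  let ?S = "{-\<epsilon><..<\<epsilon>} \<times> codom_chart c"
  have oS: "open ?S" by (rule open_evolution_domain[OF A(1) c])
  let ?g = "\<lambda>t p. F (U t p)"
  have eg: "smooth_evolution M ?g \<epsilon>"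
    by (rule smooth_evolution_compose[OF A U isometric_immersionD(1)[OF F]])
  have sg: "smooth_on ?S (\<lambda>(t, x). ?g t (inv_coord c x))"
    using eg c by (simp add: smooth_evolution_def)
  have 1: "smooth_on ?S (\<lambda>z. matrix_inv (gram M c (inv_coord c (snd z))))"
  proof (rule smooth_on_matrix_inv[OF oS])
    show "smooth_on ?S (\<lambda>z. gram M c (inv_coord c (snd z)))"
      by (rule smooth_on_compose[OF oS ac(2) smooth_on_snd[OF oS smooth_on_id[OF oS]] riemannian_manifoldD(2)[OF R(1) c]])
        auto
    show "invertible (gram M c (inv_coord c (snd z)))" if "z \<in> ?S" for z
      using gram_invertible(1)[OF R(1) c ac(8)] that by auto
  qed
  have 2: "smooth_on ?S (\<lambda>z. pullback_gram c (?g (fst z)) (inv_coord c (snd z)))"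
  proof (intro smooth_on_vec oS)
    fix k l
    have "smooth_on ?S (\<lambda>z. differential_euclidean c (?g (fst z)) (inv_coord c (snd z)) v)" for v
      by (rule smooth_on_cong[OF oS _ smooth_on_frechet[OF sg, of "(0, v)"]])
        (use evolution_partial_derivative[OF A(1) eg c] in auto)
    then show "smooth_on ?S (\<lambda>z. pullback_gram c (?g (fst z)) (inv_coord c (snd z)) $ k $ l)"
      unfolding pullback_gram_def by (simp add: smooth_on_inner[OF oS])
  qed
  have 3: "smooth_on ?S (\<lambda>z. energy_density M c (?g (fst z)) (inv_coord c (snd z)))"
    unfolding energy_density_def Let_def trace_def
    by (intro smooth_on_sum smooth_on_entry smooth_on_matrix_mult oS 1 2)
  show "smooth_on ?S (\<lambda>(t, x). d3_norm_sq M N (U t) (inv_coord c x))"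
  proof (rule smooth_on_cong[OF oS _ 3])
    fix z assume "z \<in> ?S"
    then have z: "fst z \<in> {-\<epsilon><..<\<epsilon>}" "snd z \<in> codom_chart c" by auto
    show "energy_density M c (?g (fst z)) (inv_coord c (snd z)) =
       (case z of (t, x) \<Rightarrow> d3_norm_sq M N (U t) (inv_coord c x))"
      using d3_norm_sq_eq_energy_density[OF R F smooth_family_at[OF A U z(1)] c ac(8)[OF z(2)]]
      by (simp add: case_prod_beta')
  qed
qed

section \<open>Differentiation under the integral sign\<close>

lemma compact_manifold_integrable:
  fixes M :: "('a::{t2_space, second_countable_topology}, 'm::finite) mfd" and f :: "'a \<Rightarrow> real"
  assumes R: "riemannian_manifold M" and cpt: "compact (UNIV :: 'a set)" and f: "continuous_on UNIV f"
  shows "integrable (volume_measure M) f"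
proof -
  note V = volume_measure_finite_positive[OF R cpt]
  interpret finite_measure "volume_measure M" by (rule V(3))
  have "compact (f ` UNIV)" by (rule compact_continuous_image[OF f cpt])
  from compact_imp_bounded[OF this] obtain b where b: "\<And>p. norm (f p) \<le> b" by (auto simp: bounded_iff)
  have "f \<in> borel_measurable borel" by (rule borel_measurable_continuous_onI[OF f])
  then have "f \<in> borel_measurable (volume_measure M)" by (simp add: measurable_cong_sets[OF V(1) refl])
  then show ?thesis by (rule integrable_const_bound[rotated, of _ b]) (use b in auto)
qed

lemma evolution_continuous_at:
  fixes M :: "('a::{t2_space, second_countable_topology}, 'm::finite) mfd"
  assumes "smooth_atlas (charts M)" "smooth_evolution M g \<epsilon>" "t \<in> {-\<epsilon><..<\<epsilon>}"
  shows "continuous_on UNIV (g t)"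
  by (rule smooth_function_continuous[OF assms(1) smooth_evolution_at[OF assms]])

text \<open>Dominated convergence for the difference quotients. By the mean value theorem they are bounded by the
  maximum of the time derivative over the compact product of a closed time interval with \<open>M\<close>.\<close>

lemma integral_has_time_derivative:
  fixes M :: "('a::{t2_space, second_countable_topology}, 'm::finite) mfd" and D :: "real \<Rightarrow> 'a \<Rightarrow> real"
  assumes R: "riemannian_manifold M" and cpt: "compact (UNIV :: 'a set)"
    and D: "smooth_evolution M D \<epsilon>" and t: "t \<in> {-\<epsilon><..<\<epsilon>}"
  shows "((\<lambda>t. \<integral>p. D t p \<partial>volume_measure M) has_real_derivative
     (\<integral>p. vector_derivative (\<lambda>s. D s p) (at t) \<partial>volume_measure M)) (at t)"
proof -
  note A = riemannian_manifoldD(1)[OF R] and V = volume_measure_finite_positive[OF R cpt]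
  interpret finite_measure "volume_measure M" by (rule V(3))
  let ?\<mu> = "volume_measure M" and ?D' = "\<lambda>s p. vector_derivative (\<lambda>s. D s p) (at s)"
  have eD': "smooth_evolution M ?D' \<epsilon>" by (rule smooth_evolution_time_derivative[OF A D])
  have der: "((\<lambda>s. D s p) has_real_derivative ?D' s p) (at s)" if "s \<in> {-\<epsilon><..<\<epsilon>}" for s p
    using smooth_evolution_has_time_derivative(1)[OF A D that]
    by (simp add: has_real_derivative_iff_has_vector_derivative)
  have meas: "D s \<in> borel_measurable ?\<mu>" "?D' s \<in> borel_measurable ?\<mu>" "integrable ?\<mu> (D s)" if "s \<in> {-\<epsilon><..<\<epsilon>}" for s
    using compact_manifold_integrable[OF R cpt evolution_continuous_at[OF A D that]]
      compact_manifold_integrable[OF R cpt evolution_continuous_at[OF A eD' that]]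
    by (auto intro: borel_measurable_integrable)
  \<comment> \<open>A closed interval around \<open>t\<close> on which the time derivative is bounded.\<close>
  define \<delta> where "\<delta> = (\<epsilon> - \<bar>t\<bar>) / 2"
  have \<delta>: "\<delta> > 0" "cball t \<delta> \<subseteq> {-\<epsilon><..<\<epsilon>}"
    using t by (auto simp: \<delta>_def dist_real_def abs_if field_simps split: if_splits)
  have "compact ((\<lambda>(s, p). ?D' s p) ` (cball t \<delta> \<times> UNIV))"
    by (intro compact_continuous_image continuous_on_subset[OF smooth_evolution_continuous[OF A eD']] compact_Times cpt compact_cball)
      (use \<delta> in auto)
  from compact_imp_bounded[OF this] obtain b where b: "\<And>s p. s \<in> cball t \<delta> \<Longrightarrow> norm (?D' s p) \<le> b"
    unfolding bounded_iff by force
  have quot: "norm ((D s p - D t p) / (s - t)) \<le> b" if s: "s \<in> cball t \<delta>" "s \<noteq> t" for s p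
  proof -
    have "norm (D s p - D t p) \<le> b * norm (s - t)"
    proof (rule field_differentiable_bound[where S = "cball t \<delta>" and f' = "\<lambda>s. ?D' s p"])
      show "((\<lambda>s. D s p) has_field_derivative ?D' z p) (at z within cball t \<delta>)" if "z \<in> cball t \<delta>" for z
        using der[of z p] that \<delta>(2) by (blast intro: has_field_derivative_at_within)
    qed (use b s \<delta> in auto)
    then show ?thesis using s by (simp add: field_simps norm_divide)
  qed
  show ?thesis
    unfolding has_field_derivative_iff tendsto_at_iff_sequentially
  proof (intro allI impI)
    fix X :: "nat \<Rightarrow> real" assume X: "\<forall>i. X i \<in> UNIV - {t}" "X \<longlonglongrightarrow> t"
    have "eventually (\<lambda>i. X i \<in> cball t \<delta>) sequentially"
      using tendstoD[OF X(2) \<delta>(1)] by (rule eventually_mono) (simp add: dist_commute)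
    then obtain n0 where n0: "\<And>i. i \<ge> n0 \<Longrightarrow> X i \<in> cball t \<delta>" by (auto simp: eventually_sequentially)
    let ?X = "\<lambda>i. X (i + n0)"
    have X': "?X i \<in> cball t \<delta>" "?X i \<noteq> t" "?X i \<in> {-\<epsilon><..<\<epsilon>}" for i using n0[of "i + n0"] X(1) \<delta>(2) by auto
    have lim: "?X \<longlonglongrightarrow> t" by (rule LIMSEQ_ignore_initial_segment[OF X(2)])
    have "(\<lambda>i. \<integral>p. (D (?X i) p - D t p) / (?X i - t) \<partial>?\<mu>) \<longlonglongrightarrow> (\<integral>p. ?D' t p \<partial>?\<mu>)"
    proof (rule integral_dominated_convergence[where w = "\<lambda>_. b"])
      show "AE p in ?\<mu>. (\<lambda>i. (D (?X i) p - D t p) / (?X i - t)) \<longlonglongrightarrow> ?D' t p"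
      proof (rule AE_I2)
        fix p
        from der[OF t, of p] have "((\<lambda>y. (D y p - D t p) / (y - t)) \<longlongrightarrow> ?D' t p) (at t)"
          by (simp only: has_field_derivative_iff)
        then show "(\<lambda>i. (D (?X i) p - D t p) / (?X i - t)) \<longlonglongrightarrow> ?D' t p"
          unfolding tendsto_at_iff_sequentially using X'(2) lim by (auto simp: o_def dest: spec[of _ ?X])
      qed
    qed (use meas(1)[OF X'(3)] meas(1,2)[OF t] quot X' in auto)
    moreover have eq: "(\<integral>p. (D (?X i) p - D t p) / (?X i - t) \<partial>?\<mu>) = ((\<integral>p. D (?X i) p \<partial>?\<mu>) - (\<integral>p. D t p \<partial>?\<mu>)) / (?X i - t)" for i
      using meas(3)[OF X'(3)] meas(3)[OF t] by simp
    ultimately have "(\<lambda>i. ((\<integral>p. D (?X i) p \<partial>?\<mu>) - (\<integral>p. D t p \<partial>?\<mu>)) / (?X i - t)) \<longlonglongrightarrow> (\<integral>p. ?D' t p \<partial>?\<mu>)"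
      by (simp only: eq)
    then show "((\<lambda>s. ((\<integral>p. D s p \<partial>?\<mu>) - (\<integral>p. D t p \<partial>?\<mu>)) / (s - t)) \<circ> X) \<longlonglongrightarrow> (\<integral>p. ?D' t p \<partial>?\<mu>)"
      unfolding o_def by (rule LIMSEQ_offset)
  qed
qed

section \<open>Stability along smooth families\<close>

text \<open>The compact set outside which nothing moves is \<open>M\<close> itself. The velocity obeys the
  transformation law by the chain rule for the transition maps, and it is smooth as a partial derivative of a jointly
  smooth function.\<close>

lemma smooth_family_variation_field:
  fixes M :: "('a::{t2_space, second_countable_topology}, 'm::finite) mfd"
    and N :: "('b::{t2_space, second_countable_topology}, 'n::finite) mfd"
  assumes A: "smooth_atlas (charts M)" "smooth_atlas (charts N)" and cpt: "compact (UNIV :: 'a set)"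
    and U: "smooth_family M N U \<epsilon>" "\<epsilon> > 0"
  defines "V \<equiv> \<lambda>d p. vector_derivative (\<lambda>t. coord d (U t p)) (at 0)"
  shows "smooth_variation M N (U 0) U" "has_variation_field N U V" "compact_vector_field_along M N (U 0) V"
proof -
  show "smooth_variation M N (U 0) U"
    using U cpt unfolding smooth_variation_def smooth_family_def family_domain_def
    by (intro conjI refl exI[of _ \<epsilon>] exI[of _ UNIV]) auto
  have hV: "((\<lambda>t. coord d (U t p)) has_vector_derivative V d p) (at 0)" if d: "d \<in> charts N" "U 0 p \<in> dom_chart d" for d p
    using chart_curve_derivative[OF A U d] unfolding V_def by (metis vector_derivative_at)
  then show "has_variation_field N U V" by (simp add: has_variation_field_def)
  show "compact_vector_field_along M N (U 0) V"
    unfolding compact_vector_field_along_def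
  proof (intro conjI ballI allI impI exI[of _ UNIV] cpt)
    fix d d' p assume d: "d \<in> charts N" "d' \<in> charts N" "U 0 p \<in> dom_chart d \<inter> dom_chart d'"
    obtain \<delta> where \<delta>: "\<delta> > 0" "\<And>t. t \<in> {-\<delta><..<\<delta>} \<Longrightarrow> U t p \<in> dom_chart d"
      using chart_curve_derivative[OF A U d(1)] d(3) by (metis IntD1)
    have T: "((\<lambda>x. coord d' (inv_coord d x)) has_derivative differential d d' id (U 0 p)) (at (coord d (U 0 p)))"
      by (rule transition_differentiable(2)[OF A(2) d(1,2)]) (use d(3) in auto)
    have "((\<lambda>t. coord d (U t p)) has_derivative (\<lambda>s. s *\<^sub>R V d p)) (at 0)"
      using hV[OF d(1)] d(3) by (simp add: has_vector_derivative_def)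
    from has_derivative_compose[OF this T]
    have "((\<lambda>t. coord d' (inv_coord d (coord d (U t p)))) has_vector_derivative differential d d' id (U 0 p) (V d p)) (at 0)"
      by (simp only: has_vector_derivative_def linear_scale[OF has_derivative_linear[OF T]])
    then have "((\<lambda>t. coord d' (U t p)) has_vector_derivative differential d d' id (U 0 p) (V d p)) (at 0)"
      by (rule has_vector_derivative_transform_within_open[of _ _ _ "{-\<delta><..<\<delta>}"])
        (use \<delta> atlas_chart(5)[OF A(2) d(1)] in auto)
    then show "V d' p = differential d d' id (U 0 p) (V d p)" unfolding V_def by (rule vector_derivative_at)
  next
    fix c d assume c: "c \<in> charts M" and d: "d \<in> charts N"
    note ac = atlas_chart[OF A(1) c]
    let ?S = "coord c ` (dom_chart c \<inter> U 0 -` dom_chart d)"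
    have cU: "continuous_on UNIV (U 0)"
      using smooth_family_at[OF A U(1), of 0] U(2) by (simp add: smooth_map_def)
    have oS: "open ?S"
      by (intro open_chart_image[OF A(1) c] open_vimage atlas_chart(1)[OF A(2) d]) (use cU in simp)
    have in_dom: "(0, x) \<in> family_domain \<epsilon> c d U" if "x \<in> ?S" for x
      using that U(2) ac(5,6) by (auto simp: family_domain_def)
    let ?G = "\<lambda>z. coord d (U (fst z) (inv_coord c (snd z)))"
    have sG: "smooth_on (family_domain \<epsilon> c d U) ?G" by (rule smooth_familyD(2)[OF U(1) c d])
    have "smooth_on ?S (\<lambda>x. (0, x))" by (intro smooth_on_Pair oS smooth_on_const smooth_on_id)
    from smooth_on_compose[OF oS open_family_domain[OF A(1) c A(2) d smooth_familyD(1)[OF U(1)]] this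
      smooth_on_frechet[OF sG, of "(1, 0)"] in_dom]
    have "smooth_on ?S (\<lambda>x. frechet_derivative ?G (at (0, x)) (1, 0))" by blast
    then show "smooth_on ?S (V d \<circ> inv_coord c)"
    proof (rule smooth_on_cong[OF oS, rotated])
      fix x assume x: "x \<in> ?S"
      from has_vector_derivative_partial[OF smooth_on_has_derivative[OF sG in_dom[OF x]]]
      show "frechet_derivative ?G (at (0, x)) (1, 0) = (V d \<circ> inv_coord c) x"
        by (simp add: V_def vector_derivative_at)
    qed
  qed auto
qed

text \<open>Criticality and stability, expressed by the time derivatives of the density instead of the energy.\<close>

lemma stable_family_derivatives:
  fixes M :: "('a::{t2_space, second_countable_topology}, 'm::finite) mfd"
    and N :: "('b::{t2_space, second_countable_topology}, 'n::finite) mfd"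
  assumes R: "riemannian_manifold M" "riemannian_manifold N" and cpt: "compact (UNIV :: 'a set)"
    and F: "isometric_immersion N F" and st: "stable_phi3_harmonic M N u"
    and U: "smooth_family M N U \<epsilon>" "\<epsilon> > 0" "U 0 = u"
  defines "D \<equiv> \<lambda>t p. d3_norm_sq M N (U t) p"
  defines "D' \<equiv> \<lambda>t p. vector_derivative (\<lambda>s. D s p) (at t)"
  defines "D'' \<equiv> \<lambda>t p. vector_derivative (\<lambda>s. D' s p) (at t)"
  shows "(\<integral>p. D' 0 p \<partial>volume_measure M) = 0" "(\<integral>p. D'' 0 p \<partial>volume_measure M) \<ge> 0"
    "continuous_on UNIV (D' 0)" "continuous_on UNIV (D'' 0)"
proof -
  note A = riemannian_manifoldD(1)[OF R(1)] riemannian_manifoldD(1)[OF R(2)]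
  let ?\<mu> = "volume_measure M"
  have eD: "smooth_evolution M D \<epsilon>" unfolding D_def by (rule smooth_evolution_energy_density[OF R F U(1)])
  have eD': "smooth_evolution M D' \<epsilon>" unfolding D'_def by (rule smooth_evolution_time_derivative[OF A(1) eD])
  have eD'': "smooth_evolution M D'' \<epsilon>" unfolding D''_def by (rule smooth_evolution_time_derivative[OF A(1) eD'])
  have 0: "0 \<in> {-\<epsilon><..<\<epsilon>}" using U(2) by simp
  show "continuous_on UNIV (D' 0)" "continuous_on UNIV (D'' 0)"
    by (rule evolution_continuous_at[OF A(1) eD' 0] evolution_continuous_at[OF A(1) eD'' 0])+
  have E: "phi3_energy M N (U t) = (\<integral>p. D t p \<partial>?\<mu>) / 6" for t
    by (simp add: phi3_energy_def D_def)
  have E1: "((\<lambda>t. phi3_energy M N (U t)) has_real_derivative (\<integral>p. D' t p \<partial>?\<mu>) / 6) (at t)"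
    if "t \<in> {-\<epsilon><..<\<epsilon>}" for t
    unfolding E D'_def by (rule DERIV_cdivide[OF integral_has_time_derivative[OF R(1) cpt eD that]])
  have "((\<lambda>t. (\<integral>p. D' t p \<partial>?\<mu>) / 6) has_real_derivative (\<integral>p. D'' 0 p \<partial>?\<mu>) / 6) (at 0)"
    unfolding D''_def by (rule DERIV_cdivide[OF integral_has_time_derivative[OF R(1) cpt eD' 0]])
  then have "(deriv (\<lambda>t. phi3_energy M N (U t)) has_real_derivative (\<integral>p. D'' 0 p \<partial>?\<mu>) / 6) (at 0)"
    by (rule has_field_derivative_transform_within_open[OF _ open_greaterThanLessThan 0])
      (rule DERIV_imp_deriv[OF E1, symmetric])
  then have E2: "deriv (deriv (\<lambda>t. phi3_energy M N (U t))) 0 = (\<integral>p. D'' 0 p \<partial>?\<mu>) / 6"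
    by (rule DERIV_imp_deriv)
  note sv = smooth_family_variation_field[OF A cpt U(1,2), unfolded U(3)]
  have "((\<lambda>t. phi3_energy M N (U t)) has_real_derivative 0) (at 0)"
    using st sv(1) unfolding stable_phi3_harmonic_def phi3_harmonic_def by blast
  from DERIV_unique[OF this E1[OF 0]] show "(\<integral>p. D' 0 p \<partial>?\<mu>) = 0" by simp
  have "deriv (deriv (\<lambda>t. phi3_energy M N (U t))) 0 \<ge> 0"
    using st sv unfolding stable_phi3_harmonic_def by blast
  then show "(\<integral>p. D'' 0 p \<partial>?\<mu>) \<ge> 0" unfolding E2 by simp
qed

section \<open>Derivatives of the energy density\<close>

text \<open>The sums that arise from the first two derivatives of \<open>cubic_sum\<close> at a diagonal
  matrix.\<close>

lemma cubic_sum_diagonal: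
  fixes A B g :: "'m::finite \<Rightarrow> _"
  assumes G: "\<And>i j. G i j = (if i = j then g i else (0::real))"
  shows "(\<Sum>i\<in>UNIV. \<Sum>j\<in>UNIV. \<Sum>k\<in>UNIV. A i j * G j k * G k i) = (\<Sum>i\<in>UNIV. (g i)\<^sup>2 * A i i)"
    "(\<Sum>i\<in>UNIV. \<Sum>j\<in>UNIV. \<Sum>k\<in>UNIV. G i j * A j k * G k i) = (\<Sum>i\<in>UNIV. (g i)\<^sup>2 * A i i)"
    "(\<Sum>i\<in>UNIV. \<Sum>j\<in>UNIV. \<Sum>k\<in>UNIV. G i j * G j k * A k i) = (\<Sum>i\<in>UNIV. (g i)\<^sup>2 * A i i)"
    "(\<Sum>i\<in>UNIV. \<Sum>j\<in>UNIV. \<Sum>k\<in>UNIV. A i j * B j k * G k i) = (\<Sum>i\<in>UNIV. \<Sum>j\<in>UNIV. g i * (A i j * B j i))"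
    "(\<Sum>i\<in>UNIV. \<Sum>j\<in>UNIV. \<Sum>k\<in>UNIV. A i j * G j k * B k i) = (\<Sum>i\<in>UNIV. \<Sum>j\<in>UNIV. g j * (A i j * B j i))"
    "(\<Sum>i\<in>UNIV. \<Sum>j\<in>UNIV. \<Sum>k\<in>UNIV. G i j * A j k * B k i) = (\<Sum>i\<in>UNIV. \<Sum>j\<in>UNIV. g i * (A i j * B j i))"
proof -
  have pull: "(\<Sum>k\<in>UNIV. if P then f k else 0) = (if P then \<Sum>k\<in>UNIV. f k else 0)"
    for P and f :: "'m \<Rightarrow> real" by simp
  show "(\<Sum>i\<in>UNIV. \<Sum>j\<in>UNIV. \<Sum>k\<in>UNIV. A i j * G j k * G k i) = (\<Sum>i\<in>UNIV. (g i)\<^sup>2 * A i i)"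
    "(\<Sum>i\<in>UNIV. \<Sum>j\<in>UNIV. \<Sum>k\<in>UNIV. G i j * A j k * G k i) = (\<Sum>i\<in>UNIV. (g i)\<^sup>2 * A i i)"
    "(\<Sum>i\<in>UNIV. \<Sum>j\<in>UNIV. \<Sum>k\<in>UNIV. G i j * G j k * A k i) = (\<Sum>i\<in>UNIV. (g i)\<^sup>2 * A i i)"
    "(\<Sum>i\<in>UNIV. \<Sum>j\<in>UNIV. \<Sum>k\<in>UNIV. A i j * B j k * G k i) = (\<Sum>i\<in>UNIV. \<Sum>j\<in>UNIV. g i * (A i j * B j i))"
    "(\<Sum>i\<in>UNIV. \<Sum>j\<in>UNIV. \<Sum>k\<in>UNIV. A i j * G j k * B k i) = (\<Sum>i\<in>UNIV. \<Sum>j\<in>UNIV. g j * (A i j * B j i))"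
    "(\<Sum>i\<in>UNIV. \<Sum>j\<in>UNIV. \<Sum>k\<in>UNIV. G i j * A j k * B k i) = (\<Sum>i\<in>UNIV. \<Sum>j\<in>UNIV. g i * (A i j * B j i))"
    by (simp_all add: G if_distrib[of "\<lambda>x. _ * x"] if_distrib[of "\<lambda>x. x * _"] pull sum.delta sum.delta'
        power2_eq_square mult_ac cong: if_cong)
qed

text \<open>The product rule yields three terms with one factor \<open>G''\<close> and six with two factors
  \<open>G'\<close>. At a diagonal \<open>G\<close> the former coincide, and so do the latter because
  \<open>G'\<close> is symmetric.\<close>

lemma cubic_sum_derivatives:
  fixes G G' :: "real \<Rightarrow> 'm::finite \<Rightarrow> 'm \<Rightarrow> real"
  assumes \<epsilon>: "\<epsilon> > 0"
    and 1: "\<And>t i j. t \<in> {-\<epsilon><..<\<epsilon>} \<Longrightarrow> ((\<lambda>t. G t i j) has_real_derivative G' t i j) (at t)"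
    and 2: "\<And>i j. ((\<lambda>t. G' t i j) has_real_derivative G'' i j) (at 0)"
    and D: "\<And>t. t \<in> {-\<epsilon><..<\<epsilon>} \<Longrightarrow> D t = cubic_sum (G t)"
    and G: "\<And>i j. G 0 i j = (if i = j then g i else 0)" and sym: "\<And>i j. G' 0 i j = G' 0 j i"
  defines "D' \<equiv> \<lambda>t. vector_derivative D (at t)"
  shows "D' 0 = 3 * (\<Sum>i\<in>UNIV. (g i)\<^sup>2 * G' 0 i i)"
    "vector_derivative D' (at 0) = 3 * (\<Sum>i\<in>UNIV. (g i)\<^sup>2 * G'' i i) + 6 * (\<Sum>i\<in>UNIV. \<Sum>j\<in>UNIV. g i * (G' 0 i j)\<^sup>2)"
proof -
  let ?I = "{-\<epsilon><..<\<epsilon>}"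
  let ?E = "\<lambda>t. (\<Sum>i\<in>UNIV. \<Sum>j\<in>UNIV. \<Sum>k\<in>UNIV. G' t i j * G t j k * G t k i)
     + (\<Sum>i\<in>UNIV. \<Sum>j\<in>UNIV. \<Sum>k\<in>UNIV. G t i j * G' t j k * G t k i)
     + (\<Sum>i\<in>UNIV. \<Sum>j\<in>UNIV. \<Sum>k\<in>UNIV. G t i j * G t j k * G' t k i)"
  have 0: "0 \<in> ?I" using \<epsilon> by simp
  have E: "D' t = ?E t" if t: "t \<in> ?I" for t
  proof -
    have "((\<lambda>t. cubic_sum (G t)) has_real_derivative ?E t) (at t)"
      unfolding cubic_sum_def sum.distrib[symmetric]
      by (auto intro!: derivative_eq_intros 1[OF t] sum.cong simp: algebra_simps)
    then have "(D has_real_derivative ?E t) (at t)"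
      by (rule has_field_derivative_transform_within_open[OF _ open_greaterThanLessThan t]) (simp only: D)
    then show ?thesis
      unfolding D'_def has_real_derivative_iff_has_vector_derivative by (rule vector_derivative_at)
  qed
  show "D' 0 = 3 * (\<Sum>i\<in>UNIV. (g i)\<^sup>2 * G' 0 i i)"
    unfolding E[OF 0] by (simp only: cubic_sum_diagonal[OF G])
  note G0 = 1[OF 0]
  let ?S = "\<lambda>f. \<Sum>i\<in>UNIV. \<Sum>j\<in>UNIV. \<Sum>k\<in>UNIV. f i j k"
  have "(?E has_real_derivative
       (?S (\<lambda>i j k. G'' i j * G 0 j k * G 0 k i) + ?S (\<lambda>i j k. G' 0 i j * G' 0 j k * G 0 k i)
         + ?S (\<lambda>i j k. G' 0 i j * G 0 j k * G' 0 k i))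
     + (?S (\<lambda>i j k. G' 0 i j * G' 0 j k * G 0 k i) + ?S (\<lambda>i j k. G 0 i j * G'' j k * G 0 k i)
         + ?S (\<lambda>i j k. G 0 i j * G' 0 j k * G' 0 k i))
     + (?S (\<lambda>i j k. G' 0 i j * G 0 j k * G' 0 k i) + ?S (\<lambda>i j k. G 0 i j * G' 0 j k * G' 0 k i)
         + ?S (\<lambda>i j k. G 0 i j * G 0 j k * G'' k i))) (at 0)"
    (is "(_ has_real_derivative ?R) _")
    unfolding sum.distrib[symmetric]
    by (auto intro!: derivative_eq_intros G0 2 sum.cong simp: algebra_simps)
  then have "(D' has_real_derivative ?R) (at 0)"
    by (rule has_field_derivative_transform_within_open[OF _ open_greaterThanLessThan 0]) (simp only: E)
  then have R: "vector_derivative D' (at 0) = ?R"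
    unfolding has_real_derivative_iff_has_vector_derivative by (rule vector_derivative_at)
  have sq: "G' 0 i j * G' 0 j i = (G' 0 i j)\<^sup>2" for i j using sym[of j i] by (simp add: power2_eq_square)
  have sw: "(\<Sum>i\<in>UNIV. \<Sum>j\<in>UNIV. g j * (G' 0 i j)\<^sup>2) = (\<Sum>i\<in>UNIV. \<Sum>j\<in>UNIV. g i * (G' 0 i j)\<^sup>2)"
    by (subst sum.swap) (simp only: sym)
  show "vector_derivative D' (at 0) = 3 * (\<Sum>i\<in>UNIV. (g i)\<^sup>2 * G'' i i) + 6 * (\<Sum>i\<in>UNIV. \<Sum>j\<in>UNIV. g i * (G' 0 i j)\<^sup>2)"
    unfolding R by (simp only: cubic_sum_diagonal[OF G] sq sw)
qed

text \<open>Time and space derivatives commute.\<close>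

lemma differential_has_time_derivative:
  fixes M :: "('a::{t2_space, second_countable_topology}, 'm::finite) mfd"
  assumes A: "smooth_atlas (charts M)" and g: "smooth_evolution M g \<epsilon>" and t: "t \<in> {-\<epsilon><..<\<epsilon>}"
    and c: "c \<in> charts M" "p \<in> dom_chart c"
  shows "((\<lambda>s. differential_euclidean c (g s) p v) has_vector_derivative
     differential_euclidean c (\<lambda>p. vector_derivative (\<lambda>s. g s p) (at t)) p v) (at t)"
proof -
  note ac = atlas_chart[OF A c(1)]
  let ?S = "{-\<epsilon><..<\<epsilon>} \<times> codom_chart c" and ?x = "coord c p"
  let ?G = "\<lambda>(t, x). g t (inv_coord c x)"
  have oS: "open ?S" by (rule open_evolution_domain[OF A c(1)])
  have sG: "smooth_on ?S ?G" using g c by (simp add: smooth_evolution_def)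
  have x: "?x \<in> codom_chart c" "inv_coord c ?x = p" using ac c by auto
  have tx: "(t, ?x) \<in> ?S" using t x by simp
  let ?H = "\<lambda>z. frechet_derivative ?G (at z) (0, v)"
  have "((\<lambda>s. ?H (s, ?x)) has_vector_derivative frechet_derivative ?H (at (t, ?x)) (1, 0)) (at t)"
    by (rule has_vector_derivative_partial[OF smooth_on_has_derivative[OF smooth_on_frechet[OF sG] tx]])
  then have 1: "((\<lambda>s. differential_euclidean c (g s) p v) has_vector_derivative
     frechet_derivative ?H (at (t, ?x)) (1, 0)) (at t)"
    by (rule has_vector_derivative_transform_within_open[OF _ open_greaterThanLessThan t])
      (use evolution_partial_derivative[OF A g c(1) _ x(1)] x(2) in simp)
  have "frechet_derivative ?H (at (t, ?x)) (1, 0)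
      = frechet_derivative (\<lambda>z. frechet_derivative ?G (at z) (1, 0)) (at (t, ?x)) (0, v)"
    by (rule smooth_on_mixed_derivatives[OF oS sG tx])
  also have "\<dots> = frechet_derivative (\<lambda>(t, x). vector_derivative (\<lambda>s. g s (inv_coord c x)) (at t)) (at (t, ?x)) (0, v)"
  proof -
    have "frechet_derivative ?G (at z) (1, 0) = (case z of (t, x) \<Rightarrow> vector_derivative (\<lambda>s. g s (inv_coord c x)) (at t))"
      if "z \<in> ?S" for z
      using that smooth_evolution_has_time_derivative(2)[OF A g _ c(1)] by auto
    from frechet_derivative_cong_open[OF oS tx this] show ?thesis by simp
  qed
  also have "\<dots> = differential_euclidean c (\<lambda>p. vector_derivative (\<lambda>s. g s p) (at t)) p v"
    using evolution_partial_derivative[OF A smooth_evolution_time_derivative[OF A g] c(1) t x(1)] x(2) by simp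
  finally show ?thesis using 1 by simp
qed

text \<open>The case \<open>G\<^sub>i\<^sub>j = b\<^sub>i \<bullet> b\<^sub>j\<close> of the derivatives of the cubic
  sum. The frame does not depend on time, so only the derivatives of the map enter.\<close>

lemma energy_density_derivatives:
  fixes M :: "('a::{t2_space, second_countable_topology}, 'm::finite) mfd" and g :: "real \<Rightarrow> 'a \<Rightarrow> real ^ 'q::finite"
  assumes A: "smooth_atlas (charts M)" and g: "smooth_evolution M g \<epsilon>" "\<epsilon> > 0" and c: "c \<in> charts M" "p \<in> dom_chart c"
    and D: "\<And>t. t \<in> {-\<epsilon><..<\<epsilon>} \<Longrightarrow> D t = energy_density M c (g t) p" and e: "orthonormal_frame M c p e"
  defines "g' \<equiv> \<lambda>t p. vector_derivative (\<lambda>s. g s p) (at t)"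
  defines "g'' \<equiv> \<lambda>t p. vector_derivative (\<lambda>s. g' s p) (at t)"
  defines "b \<equiv> \<lambda>i. differential_euclidean c (g 0) p (e i)"
  defines "b' \<equiv> \<lambda>i. differential_euclidean c (g' 0) p (e i)"
  defines "b'' \<equiv> \<lambda>i. differential_euclidean c (g'' 0) p (e i)"
  defines "D' \<equiv> \<lambda>t. vector_derivative D (at t)"
  assumes diag: "\<And>i j. i \<noteq> j \<Longrightarrow> b i \<bullet> b j = 0"
  shows "D' 0 = 6 * (\<Sum>i\<in>UNIV. (b i \<bullet> b i)\<^sup>2 * (b' i \<bullet> b i))"
    "vector_derivative D' (at 0) = 6 * (\<Sum>i\<in>UNIV. (b i \<bullet> b i)\<^sup>2 * (b'' i \<bullet> b i + b' i \<bullet> b' i))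
      + 6 * (\<Sum>i\<in>UNIV. \<Sum>j\<in>UNIV. (b i \<bullet> b i) * (b' i \<bullet> b j + b i \<bullet> b' j)\<^sup>2)"
proof -
  let ?I = "{-\<epsilon><..<\<epsilon>}"
  have 0: "0 \<in> ?I" using g by simp
  have eg': "smooth_evolution M g' \<epsilon>" unfolding g'_def by (rule smooth_evolution_time_derivative[OF A g(1)])
  let ?b = "\<lambda>t i. differential_euclidean c (g t) p (e i)" and ?b' = "\<lambda>t i. differential_euclidean c (g' t) p (e i)"
  define G where "G t i j = ?b t i \<bullet> ?b t j" for t i j
  define G' where "G' t i j = ?b' t i \<bullet> ?b t j + ?b t i \<bullet> ?b' t j" for t i j
  define G'' where "G'' i j = (b'' i \<bullet> b j + b' i \<bullet> b' j) + (b' i \<bullet> b' j + b i \<bullet> b'' j)" for i j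
  have d1: "((\<lambda>t. ?b t i) has_vector_derivative ?b' t i) (at t)" if "t \<in> ?I" for t i
    using differential_has_time_derivative[OF A g(1) that c] by (simp add: g'_def[abs_def])
  have d2: "((\<lambda>t. ?b' t i) has_vector_derivative b'' i) (at 0)" for i
    using differential_has_time_derivative[OF A eg' 0 c] by (simp add: g''_def[abs_def] b''_def)
  have inner: "((\<lambda>t. x t \<bullet> y t) has_real_derivative (x' \<bullet> y t + x t \<bullet> y')) (at t)"
    if "(x has_vector_derivative x') (at t)" "(y has_vector_derivative y') (at t)" for x y :: "real \<Rightarrow> real ^ 'q" and x' y' t
    using bounded_bilinear.has_vector_derivative[OF bounded_bilinear_inner that]
    by (simp add: has_real_derivative_iff_has_vector_derivative add.commute)
  have c1: "((\<lambda>t. G t i j) has_real_derivative G' t i j) (at t)" if "t \<in> ?I" for t i j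
    unfolding G_def G'_def by (rule inner[OF d1[OF that] d1[OF that]])
  have c2: "((\<lambda>t. G' t i j) has_real_derivative G'' i j) (at 0)" for i j
    unfolding G'_def G''_def b_def b'_def
    by (rule DERIV_add[OF inner[OF d2 d1[OF 0]] inner[OF d1[OF 0] d2]])
  have c3: "D t = cubic_sum (G t)" if t: "t \<in> ?I" for t
  proof -
    have "linear (differential_euclidean c (g t) p)"
      using smooth_function_has_derivative[OF A smooth_evolution_at[OF A g(1) t] c] has_derivative_linear by blast
    from energy_density_in_frame[OF e this] show ?thesis unfolding D[OF t] G_def[abs_def] by simp
  qed
  have c4: "G 0 i j = (if i = j then b i \<bullet> b i else 0)" for i j using diag[of i j] by (simp add: G_def b_def)
  have c5: "G' 0 i j = G' 0 j i" for i j by (simp add: G'_def inner_commute add.commute)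
  note res = cubic_sum_derivatives[OF g(2) c1 c2 c3 c4 c5]
  have G'b: "G' 0 i j = b' i \<bullet> b j + b i \<bullet> b' j" for i j by (simp add: G'_def b_def b'_def)
  show "D' 0 = 6 * (\<Sum>i\<in>UNIV. (b i \<bullet> b i)\<^sup>2 * (b' i \<bullet> b i))"
    using res(1) unfolding D'_def G'b by (simp add: sum_distrib_left inner_commute)
  show "vector_derivative D' (at 0) = 6 * (\<Sum>i\<in>UNIV. (b i \<bullet> b i)\<^sup>2 * (b'' i \<bullet> b i + b' i \<bullet> b' i))
      + 6 * (\<Sum>i\<in>UNIV. \<Sum>j\<in>UNIV. (b i \<bullet> b i) * (b' i \<bullet> b j + b i \<bullet> b' j)\<^sup>2)"
  proof -
    have "(\<Sum>i\<in>UNIV. (b i \<bullet> b i)\<^sup>2 * G'' i i) = 2 * (\<Sum>i\<in>UNIV. (b i \<bullet> b i)\<^sup>2 * (b'' i \<bullet> b i + b' i \<bullet> b' i))"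
      by (simp add: G''_def sum_distrib_left inner_commute algebra_simps)
    then show ?thesis using res(2) unfolding D'_def G'b by simp
  qed
qed

section \<open>Geometry of an isometric immersion\<close>

locale isometrically_immersed =
  fixes N :: "('b::{t2_space, second_countable_topology}, 'n::finite) mfd" and F :: "'b \<Rightarrow> real ^ 'q::finite"
  assumes riem: "riemannian_manifold N" and iso: "isometric_immersion N F"
begin

abbreviation dF :: "('b, 'n) chart \<Rightarrow> 'b \<Rightarrow> real ^ 'n \<Rightarrow> real ^ 'q" where
  "dF d y \<equiv> differential_euclidean d F y"

abbreviation sff :: "('b, 'n) chart \<Rightarrow> 'b \<Rightarrow> real ^ 'n \<Rightarrow> real ^ 'n \<Rightarrow> real ^ 'q" where
  "sff d y \<equiv> second_fundamental_form d F y"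

lemmas atlas = riemannian_manifoldD(1)[OF riem]
lemmas smooth_F = isometric_immersionD(1)[OF iso]
lemmas dF_inner = isometric_immersionD(2)[OF iso]

lemma linear_differential:
  "smooth_function N f \<Longrightarrow> d \<in> charts N \<Longrightarrow> y \<in> dom_chart d \<Longrightarrow> linear (differential_euclidean d f y)"
  using smooth_function_has_derivative[OF atlas] has_derivative_linear by blast

lemmas linear_dF = linear_differential[OF smooth_F]

lemma dF_injective:
  assumes "d \<in> charts N" "y \<in> dom_chart d" "dF d y v = dF d y w"
  shows "v = w"
proof (rule ccontr)
  assume "v \<noteq> w"
  then have "metric N d y (v - w) (v - w) > 0" by (intro riemannian_manifoldD(4)[OF riem assms(1,2)]) simp
  moreover have "dF d y (v - w) = 0" using assms(3) by (simp add: linear_diff[OF linear_dF[OF assms(1,2)]])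
  ultimately show False using dF_inner[OF assms(1,2), of "v - w" "v - w"] by simp
qed

lemma dF_expand:
  assumes "d \<in> charts N" "y \<in> dom_chart d"
  shows "dF d y v = (\<Sum>k\<in>UNIV. (v $ k) *\<^sub>R dF d y (axis k 1))"
  by (subst basis_expansion[of v, symmetric])
    (simp add: linear_sum[OF linear_dF[OF assms]] scalar_mult_eq_scaleR linear_scale[OF linear_dF[OF assms]])

text \<open>The components in the chart \<open>d\<close> of the tangential part of \<open>\<xi>\<close>: with the
  Jacobian matrix \<open>J\<close> of \<open>F\<close> this is \<open>g\<inverse> J\<^sup>T \<xi>\<close>.\<close>

definition lift :: "('b, 'n) chart \<Rightarrow> 'b \<Rightarrow> real ^ 'q \<Rightarrow> real ^ 'n" where
  "lift d y \<xi> = matrix_inv (gram N d y) *v (\<chi> k. \<xi> \<bullet> dF d y (axis k 1))"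

lemma inner_lift:
  assumes d: "d \<in> charts N" "y \<in> dom_chart d"
  shows "dF d y (lift d y \<xi>) \<bullet> dF d y b = \<xi> \<bullet> dF d y b"
proof -
  have "dF d y (lift d y \<xi>) \<bullet> dF d y b = metric N d y b (lift d y \<xi>)"
    unfolding dF_inner[OF d] by (rule riemannian_manifoldD(3)[OF riem d])
  also have "\<dots> = b \<bullet> (\<chi> k. \<xi> \<bullet> dF d y (axis k 1))"
    unfolding metric_def lift_def
    by (simp add: matrix_vector_mul_assoc matrix_inv_works(1)[OF gram_invertible(1)[OF riem d]])
  also have "\<dots> = \<xi> \<bullet> dF d y b"
    by (subst dF_expand[OF d, of b]) (simp add: inner_vec_def[of b] inner_sum_right)
  finally show ?thesis .
qed

definition proj :: "'b \<Rightarrow> real ^ 'q \<Rightarrow> real ^ 'q" where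
  "proj y \<xi> = (let d = SOME d. d \<in> charts N \<and> y \<in> dom_chart d in dF d y (lift d y \<xi>))"

text \<open>The vectors obtained in two charts are both tangent, and both have the same products with all tangent
  vectors as \<open>\<xi>\<close>; their difference is orthogonal to itself.\<close>

lemma proj_eq:
  assumes d: "d \<in> charts N" "y \<in> dom_chart d"
  shows "proj y \<xi> = dF d y (lift d y \<xi>)"
proof -
  define d0 where "d0 = (SOME d. d \<in> charts N \<and> y \<in> dom_chart d)"
  have d0: "d0 \<in> charts N" "y \<in> dom_chart d0"
    using someI[of "\<lambda>d. d \<in> charts N \<and> y \<in> dom_chart d" d] d unfolding d0_def by blast+
  have p: "proj y \<xi> = dF d0 y (lift d0 y \<xi>)" by (simp add: proj_def d0_def Let_def)
  define w where "w = lift d y \<xi> - differential d0 d id y (lift d0 y \<xi>)"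
  have ch: "dF d0 y v = dF d y (differential d0 d id y v)" for v
    by (rule differential_euclidean_change_chart[OF atlas smooth_F d0(1) d(1) d0(2) d(2)])
  have ch': "dF d y v = dF d0 y (differential d d0 id y v)" for v
    by (rule differential_euclidean_change_chart[OF atlas smooth_F d(1) d0(1) d(2) d0(2)])
  have w: "dF d y (lift d y \<xi>) - proj y \<xi> = dF d y w"
    by (simp add: w_def p ch linear_diff[OF linear_dF[OF d]])
  have "(dF d y (lift d y \<xi>) - proj y \<xi>) \<bullet> dF d y b = 0" for b
  proof -
    have "proj y \<xi> \<bullet> dF d y b = \<xi> \<bullet> dF d y b" unfolding p ch' by (rule inner_lift[OF d0])
    then show ?thesis using inner_lift[OF d, of \<xi> b] by (simp add: inner_diff_left)
  qed
  from this[of w] have "dF d y w = 0" unfolding w by simp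
  with w show ?thesis by simp
qed

lemma proj_inner:
  assumes "d \<in> charts N" "y \<in> dom_chart d"
  shows "proj y \<xi> \<bullet> dF d y b = \<xi> \<bullet> dF d y b"
  unfolding proj_eq[OF assms] by (rule inner_lift[OF assms])

lemma smooth_dF: "d \<in> charts N \<Longrightarrow> smooth_on (codom_chart d) (\<lambda>x. dF d (inv_coord d x) v)"
proof -
  assume d: "d \<in> charts N"
  note ad = atlas_chart[OF atlas d]
  have "smooth_on (codom_chart d) (\<lambda>x. F (inv_coord d x))" using smooth_F d by (simp add: smooth_function_def)
  from smooth_on_cong[OF ad(2) _ smooth_on_frechet[OF this, of v], of "\<lambda>x. dF d (inv_coord d x) v"]
  show ?thesis by (simp add: differential_euclidean_def o_def ad(7))
qed

lemma smooth_lift: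
  assumes W: "smooth_function N W" and d: "d \<in> charts N"
  shows "smooth_on (codom_chart d) (\<lambda>x. lift d (inv_coord d x) (W (inv_coord d x)))"
proof -
  note ad = atlas_chart[OF atlas d]
  have i: "smooth_on (codom_chart d) (\<lambda>x. matrix_inv (gram N d (inv_coord d x)))"
    by (rule smooth_on_matrix_inv[OF ad(2) riemannian_manifoldD(2)[OF riem d]])
      (rule gram_invertible(1)[OF riem d ad(8)])
  have W': "smooth_on (codom_chart d) (\<lambda>x. W (inv_coord d x))" using W d by (simp add: smooth_function_def)
  show ?thesis
  proof (rule smooth_on_vec[OF ad(2)])
    fix k
    have "smooth_on (codom_chart d) (\<lambda>x. \<Sum>j\<in>UNIV. matrix_inv (gram N d (inv_coord d x)) $ k $ j *
       (W (inv_coord d x) \<bullet> dF d (inv_coord d x) (axis j 1)))"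
      by (intro smooth_on_sum smooth_on_mult smooth_on_inner smooth_on_entry[OF _ i] smooth_dF W' d ad(2))
    then show "smooth_on (codom_chart d) (\<lambda>x. lift d (inv_coord d x) (W (inv_coord d x)) $ k)"
      by (simp add: lift_def matrix_vector_mult_def)
  qed
qed

lemma smooth_proj:
  assumes W: "smooth_function N W"
  shows "smooth_function N (\<lambda>y. proj y (W y))"
  unfolding smooth_function_def
proof
  fix d assume d: "d \<in> charts N"
  note ad = atlas_chart[OF atlas d]
  have s: "smooth_on (codom_chart d) (\<lambda>x. \<Sum>k\<in>UNIV. (lift d (inv_coord d x) (W (inv_coord d x)) $ k) *\<^sub>R
      dF d (inv_coord d x) (axis k 1))"
    by (intro smooth_on_sum smooth_on_scaleR smooth_on_nth smooth_lift[OF W d] smooth_dF d ad(2))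
  show "smooth_on (codom_chart d) (\<lambda>x. proj (inv_coord d x) (W (inv_coord d x)))"
  proof (rule smooth_on_cong[OF ad(2) _ s])
    fix x assume x: "x \<in> codom_chart d"
    show "(\<Sum>k\<in>UNIV. (lift d (inv_coord d x) (W (inv_coord d x)) $ k) *\<^sub>R dF d (inv_coord d x) (axis k 1))
      = proj (inv_coord d x) (W (inv_coord d x))"
      unfolding proj_eq[OF d ad(8)[OF x]] by (rule dF_expand[OF d ad(8)[OF x], symmetric])
  qed
qed

text \<open>This is applied to constant fields \<open>W\<close>, whose projections are the fields
  \<open>X\<^sub>E\<close>, and to the accelerations of the resulting families.\<close>

lemma ex_tangential_family:
  assumes cpt: "compact (UNIV :: 'b set)" and W: "smooth_function N W"
  shows "\<exists>\<phi> \<epsilon>. \<epsilon> > 0 \<and> smooth_family N N \<phi> \<epsilon> \<and> (\<forall>y. \<phi> 0 y = y) \<and>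
     (\<forall>y. ((\<lambda>t. F (\<phi> t y)) has_vector_derivative proj y (W y)) (at 0))"
proof (rule ex_family_with_velocity[OF atlas cpt smooth_F, where V = "\<lambda>d y. lift d y (W y)"])
  show "smooth_on (codom_chart d) (\<lambda>x. lift d (inv_coord d x) (W (inv_coord d x)))" if "d \<in> charts N" for d
    by (rule smooth_lift[OF W that])
  show "frechet_derivative (\<lambda>x. F (inv_coord d x)) (at (coord d y)) (lift d y (W y)) = proj y (W y)"
    if "d \<in> charts N" "y \<in> dom_chart d" for d y
    using proj_eq[OF that] by (simp add: differential_euclidean_def o_def)
qed

text \<open>The second derivative of \<open>F\<close> in the chart \<open>d\<close>, whose normal part is the second
  fundamental form.\<close>

definition hess :: "('b, 'n) chart \<Rightarrow> 'b \<Rightarrow> real ^ 'n \<Rightarrow> real ^ 'n \<Rightarrow> real ^ 'q" where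
  "hess d y v w = frechet_derivative (\<lambda>x. dF d (inv_coord d x) w) (at (coord d y)) v"

lemma hess_has_derivative:
  assumes "d \<in> charts N" "y \<in> dom_chart d"
  shows "((\<lambda>x. dF d (inv_coord d x) w) has_derivative (\<lambda>v. hess d y v w)) (at (coord d y))"
  using smooth_on_has_derivative[OF smooth_dF[OF assms(1)] atlas_chart(6)[OF atlas assms]]
  by (simp add: hess_def[abs_def])

lemma hess_symmetric:
  assumes d: "d \<in> charts N" "y \<in> dom_chart d"
  shows "hess d y v w = hess d y w v"
proof -
  note ad = atlas_chart[OF atlas d(1)]
  have s: "smooth_on (codom_chart d) (\<lambda>x. F (inv_coord d x))" using smooth_F d by (simp add: smooth_function_def)
  have "hess d y v w = frechet_derivative (\<lambda>x. frechet_derivative (\<lambda>x. F (inv_coord d x)) (at x) w) (at (coord d y)) v" for v w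
    unfolding hess_def
    by (rule fun_cong[OF frechet_derivative_cong_open[OF ad(2) ad(6)[OF d(2)]]])
      (simp add: differential_euclidean_def o_def ad(7))
  then show ?thesis using smooth_on_mixed_derivatives[OF ad(2) s ad(6)[OF d(2)]] by simp
qed

lemma bilinear_hess:
  assumes d: "d \<in> charts N" "y \<in> dom_chart d"
  shows "bilinear (hess d y)"
  unfolding bilinear_def
proof (intro conjI allI)
  show l: "linear (\<lambda>v. hess d y v w)" for w by (rule has_derivative_linear[OF hess_has_derivative[OF d]])
  have eq: "hess d y v = (\<lambda>w. hess d y w v)" for v using hess_symmetric[OF d] by blast
  show "linear (hess d y v)" for v by (subst eq) (rule l)
qed

text \<open>The normal part of the second derivative is the unique normal vector that differs from it by a tangent
  vector.\<close>

lemma sff_eq: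
  assumes d: "d \<in> charts N" "y \<in> dom_chart d"
  shows "sff d y v w = hess d y v w - proj y (hess d y v w)"
  unfolding second_fundamental_form_def hess_def[symmetric]
proof (rule the_equality)
  let ?h = "hess d y v w"
  show "?h - proj y ?h \<in> orthogonal_comp (range (dF d y)) \<and> ?h - (?h - proj y ?h) \<in> range (dF d y)"
    using proj_inner[OF d, of ?h] proj_eq[OF d, of ?h]
    by (auto simp: orthogonal_comp_def orthogonal_def inner_diff_left inner_diff_right inner_commute)
  fix b assume b: "b \<in> orthogonal_comp (range (dF d y)) \<and> ?h - b \<in> range (dF d y)"
  then obtain z where z: "?h - b = dF d y z" by blast
  have bn: "b \<bullet> dF d y x = 0" for x
    using b by (auto simp: orthogonal_comp_def orthogonal_def inner_commute)
  have "dF d y (z - lift d y ?h) \<bullet> dF d y x = 0" for x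
    using inner_lift[OF d, of ?h x] bn[of x] z[symmetric]
    by (simp add: linear_diff[OF linear_dF[OF d]] inner_diff_left)
  then have "dF d y (z - lift d y ?h) = 0" using inner_eq_zero_iff by blast
  then have "dF d y z = proj y ?h" by (simp add: linear_diff[OF linear_dF[OF d]] proj_eq[OF d])
  then show "b = ?h - proj y ?h" using z by (simp add: algebra_simps)
qed

lemma sff_normal:
  assumes "d \<in> charts N" "y \<in> dom_chart d"
  shows "sff d y v w \<bullet> dF d y b = 0"
  using proj_inner[OF assms] by (simp add: sff_eq[OF assms] inner_diff_left)

lemma sff_symmetric:
  "d \<in> charts N \<Longrightarrow> y \<in> dom_chart d \<Longrightarrow> sff d y v w = sff d y w v"
  by (simp only: sff_eq hess_symmetric)

lemma hess_decompose:
  assumes "d \<in> charts N" "y \<in> dom_chart d"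
  shows "hess d y v w = sff d y v w + dF d y (lift d y (hess d y v w))"
  by (simp add: sff_eq[OF assms] proj_eq[OF assms])

lemma linear_proj: "linear (proj y)"
proof -
  obtain d where d: "d \<in> charts N" "y \<in> dom_chart d" using atlas_cover[OF atlas] .
  have "linear (lift d y)"
  proof (rule linearI)
    have "(\<chi> k. (\<xi> + \<eta>) \<bullet> dF d y (axis k 1)) = (\<chi> k. \<xi> \<bullet> dF d y (axis k 1)) + (\<chi> k. \<eta> \<bullet> dF d y (axis k 1))"
      for \<xi> \<eta> by (simp add: vec_eq_iff inner_left_distrib)
    then show "lift d y (\<xi> + \<eta>) = lift d y \<xi> + lift d y \<eta>" for \<xi> \<eta>
      by (simp add: lift_def matrix_vector_right_distrib)
    have "(\<chi> k. (r *\<^sub>R \<xi>) \<bullet> dF d y (axis k 1)) = r *\<^sub>R (\<chi> k. \<xi> \<bullet> dF d y (axis k 1))" for r \<xi>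
      by (simp add: vec_eq_iff)
    then show "lift d y (r *\<^sub>R \<xi>) = r *\<^sub>R lift d y \<xi>" for r \<xi>
      by (simp add: lift_def matrix_vector_mult_scaleR)
  qed
  from linear_compose[OF this linear_dF[OF d]] show ?thesis
    by (simp add: o_def proj_eq[OF d, abs_def])
qed

lemma bilinear_sff:
  assumes d: "d \<in> charts N" "y \<in> dom_chart d"
  shows "bilinear (sff d y)"
proof -
  have "linear (\<lambda>h. h - proj y h)" by (intro linear_compose_sub linear_proj linear_ident)
  from linear_compose[OF _ this] bilinear_hess[OF d] show ?thesis
    unfolding bilinear_def o_def sff_eq[OF d, abs_def] by blast
qed

lemma normal_inner_hess:
  assumes d: "d \<in> charts N" "y \<in> dom_chart d" and "\<And>b. \<nu> \<bullet> dF d y b = 0"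
  shows "\<nu> \<bullet> hess d y v w = \<nu> \<bullet> sff d y v w"
  by (subst hess_decompose[OF d]) (simp add: inner_right_distrib assms(3))

text \<open>Differentiate \<open>proj W \<bullet> dF b = W \<bullet> dF b\<close> for a vector \<open>b\<close> with
  constant components.\<close>

lemma proj_derivative_tangential:
  assumes W: "smooth_function N W" and d: "d \<in> charts N" "y \<in> dom_chart d"
  shows "differential_euclidean d (\<lambda>y. proj y (W y)) y a \<bullet> dF d y b
    = differential_euclidean d W y a \<bullet> dF d y b + (W y - proj y (W y)) \<bullet> sff d y a b"
proof -
  note ad = atlas_chart[OF atlas d(1)]
  let ?X = "\<lambda>y. proj y (W y)"
  have inv: "inv_coord d (coord d y) = y" by (rule ad(5)[OF d(2)])
  have prod: "((\<lambda>x. f (inv_coord d x) \<bullet> dF d (inv_coord d x) b) has_derivative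
      (\<lambda>a. f y \<bullet> hess d y a b + differential_euclidean d f y a \<bullet> dF d y b)) (at (coord d y))"
    if "smooth_function N f" for f
    using has_derivative_inner[OF smooth_function_has_derivative[OF atlas that d] hess_has_derivative[OF d]]
    unfolding inv .
  have "((\<lambda>x. ?X (inv_coord d x) \<bullet> dF d (inv_coord d x) b) has_derivative
      (\<lambda>a. W y \<bullet> hess d y a b + differential_euclidean d W y a \<bullet> dF d y b)) (at (coord d y))"
    by (rule has_derivative_transform_within_open[OF prod[OF W] ad(2) ad(6)[OF d(2)]])
      (simp add: proj_inner[OF d(1) ad(8)])
  from fun_cong[OF has_derivative_unique[OF prod[OF smooth_proj[OF W]] this], of a]
  have "?X y \<bullet> hess d y a b + differential_euclidean d ?X y a \<bullet> dF d y b
     = W y \<bullet> hess d y a b + differential_euclidean d W y a \<bullet> dF d y b" .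
  moreover have "(W y - ?X y) \<bullet> hess d y a b = (W y - ?X y) \<bullet> sff d y a b"
    by (rule normal_inner_hess[OF d]) (simp add: inner_diff_left proj_inner[OF d])
  ultimately show ?thesis by (simp add: inner_diff_left)
qed

text \<open>The product rule for \<open>dF\<close> at a moving point, applied to a moving vector.\<close>

lemma dF_along_curve:
  assumes d: "d \<in> charts N" "y \<in> dom_chart d"
    and z: "(z has_derivative z') (at s)" "z s = coord d y"
    and v: "(v has_derivative v') (at s)"
    and T: "open T" "s \<in> T" "\<And>t. t \<in> T \<Longrightarrow> z t \<in> codom_chart d"
  shows "((\<lambda>t. dF d (inv_coord d (z t)) (v t)) has_derivative
     (\<lambda>r. dF d y (v' r) + hess d y (z' r) (v s))) (at s)"
proof -
  note ad = atlas_chart[OF atlas d(1)]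
  have inv: "inv_coord d (z s) = y" using ad(5)[OF d(2)] z(2) by simp
  let ?E = "\<lambda>k x. dF d (inv_coord d x) (axis k 1)"
  have E: "((\<lambda>t. ?E k (z t)) has_derivative (\<lambda>r. hess d y (z' r) (axis k 1))) (at s)" for k
    using has_derivative_compose[OF z(1), of "?E k" "\<lambda>v. hess d y v (axis k 1)"] hess_has_derivative[OF d] z(2) by simp
  have vk: "((\<lambda>t. v t $ k) has_derivative (\<lambda>r. v' r $ k)) (at s)" for k
    by (rule bounded_linear.has_derivative[OF bounded_linear_vec_nth v])
  have "((\<lambda>t. \<Sum>k\<in>UNIV. (v t $ k) *\<^sub>R ?E k (z t)) has_derivative
     (\<lambda>r. \<Sum>k\<in>UNIV. (v s $ k) *\<^sub>R hess d y (z' r) (axis k 1) + (v' r $ k) *\<^sub>R ?E k (z s))) (at s)"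
    by (intro has_derivative_sum has_derivative_scaleR vk E)
  moreover have "(\<lambda>r. \<Sum>k\<in>UNIV. (v s $ k) *\<^sub>R hess d y (z' r) (axis k 1) + (v' r $ k) *\<^sub>R ?E k (z s))
    = (\<lambda>r. dF d y (v' r) + hess d y (z' r) (v s))"
  proof
    fix r
    have lin: "linear (hess d y (z' r))" using bilinear_hess[OF d] by (simp add: bilinear_def)
    have "hess d y (z' r) (v s) = (\<Sum>k\<in>UNIV. (v s $ k) *\<^sub>R hess d y (z' r) (axis k 1))"
      by (subst basis_expansion[of "v s", symmetric])
        (simp add: linear_sum[OF lin] scalar_mult_eq_scaleR linear_scale[OF lin])
    then show "(\<Sum>k\<in>UNIV. (v s $ k) *\<^sub>R hess d y (z' r) (axis k 1) + (v' r $ k) *\<^sub>R ?E k (z s))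
      = dF d y (v' r) + hess d y (z' r) (v s)"
      using dF_expand[OF d, of "v' r"] by (simp add: sum.distrib inv)
  qed
  ultimately have 1: "((\<lambda>t. \<Sum>k\<in>UNIV. (v t $ k) *\<^sub>R ?E k (z t)) has_derivative
     (\<lambda>r. dF d y (v' r) + hess d y (z' r) (v s))) (at s)" by simp
  show ?thesis
    by (rule has_derivative_transform_within_open[OF 1 T(1,2)])
      (rule dF_expand[OF d(1) ad(8)[OF T(3)], symmetric])
qed

text \<open>The projection is \<open>dF\<close> applied to the lift; differentiating the lift gives a tangent vector,
  and differentiating \<open>dF\<close> gives the second derivative of \<open>F\<close>.\<close>

lemma proj_derivative_normal:
  assumes W: "smooth_function N W" and d: "d \<in> charts N" "y \<in> dom_chart d"
  shows "\<exists>z. differential_euclidean d (\<lambda>y. proj y (W y)) y a = sff d y a (lift d y (W y)) + dF d y z"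
proof -
  note ad = atlas_chart[OF atlas d(1)]
  have inv: "inv_coord d (coord d y) = y" by (rule ad(5)[OF d(2)])
  let ?v = "\<lambda>x. lift d (inv_coord d x) (W (inv_coord d x))"
  define v' where "v' = frechet_derivative ?v (at (coord d y))"
  have v: "(?v has_derivative v') (at (coord d y))"
    unfolding v'_def by (rule smooth_on_has_derivative[OF smooth_lift[OF W d(1)] ad(6)[OF d(2)]])
  have "((\<lambda>x. dF d (inv_coord d x) (?v x)) has_derivative
     (\<lambda>r. dF d y (v' r) + hess d y r (?v (coord d y)))) (at (coord d y))"
    by (rule dF_along_curve[OF d has_derivative_ident refl v ad(2) ad(6)[OF d(2)]])
  then have "((\<lambda>x. proj (inv_coord d x) (W (inv_coord d x))) has_derivative
     (\<lambda>r. dF d y (v' r) + hess d y r (lift d y (W y)))) (at (coord d y))"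
    unfolding inv
    by (rule has_derivative_transform_within_open[OF _ ad(2) ad(6)[OF d(2)]])
      (rule proj_eq[OF d(1) ad(8), symmetric])
  from fun_cong[OF has_derivative_unique[OF smooth_function_has_derivative[OF atlas smooth_proj[OF W] d] this], of a]
  have "differential_euclidean d (\<lambda>y. proj y (W y)) y a = dF d y (v' a) + hess d y a (lift d y (W y))" .
  also have "\<dots> = sff d y a (lift d y (W y)) + dF d y (v' a + lift d y (hess d y a (lift d y (W y))))"
    by (subst hess_decompose[OF d]) (simp add: linear_add[OF linear_dF[OF d]] add.assoc add.commute)
  finally show ?thesis by blast
qed

text \<open>In a chart the curve is \<open>F \<circ> z\<close>, and its acceleration is the second derivative of
  \<open>F\<close> on \<open>z'\<close> plus \<open>dF z''\<close>. The normal part thus depends on the velocity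
  alone.\<close>

lemma acceleration_normal:
  assumes \<phi>: "smooth_family N N \<phi> \<epsilon>" "\<epsilon> > 0" "\<And>y. \<phi> 0 y = y" and d: "d \<in> charts N" "y \<in> dom_chart d"
    and X: "((\<lambda>t. F (\<phi> t y)) has_vector_derivative dF d y V) (at 0)"
  shows "\<exists>z. vector_derivative (\<lambda>s. vector_derivative (\<lambda>r. F (\<phi> r y)) (at s)) (at 0) = sff d y V V + dF d y z"
proof -
  note ad = atlas_chart[OF atlas d(1)]
  have inv: "inv_coord d (coord d y) = y" by (rule ad(5)[OF d(2)])
  let ?x = "coord d y" and ?S = "family_domain \<epsilon> d d \<phi>"
  let ?G = "\<lambda>z. coord d (\<phi> (fst z) (inv_coord d (snd z)))"
  have sG: "smooth_on ?S ?G" by (rule smooth_familyD(2)[OF \<phi>(1) d(1,1)])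
  have d0: "\<phi> 0 y \<in> dom_chart d" using \<phi>(3) d(2) by simp
  obtain \<delta> where \<delta>: "\<delta> > 0" "\<delta> \<le> \<epsilon>" "\<And>t. t \<in> {-\<delta><..<\<delta>} \<Longrightarrow> \<phi> t y \<in> dom_chart d"
    using chart_curve_derivative[OF atlas atlas \<phi>(1,2) d(1) d0] by metis
  let ?T = "{-\<delta><..<\<delta>}"
  have 0: "0 \<in> ?T" using \<delta> by simp
  have tS: "(t, ?x) \<in> ?S" if "t \<in> ?T" for t
    using that \<delta>(2) \<delta>(3)[OF that] ad(6)[OF d(2)] by (auto simp: family_domain_def inv)
  define z where "z t = coord d (\<phi> t y)" for t
  define z' where "z' t = frechet_derivative ?G (at (t, ?x)) (1, 0)" for t
  define z'' where "z'' = frechet_derivative (\<lambda>z. frechet_derivative ?G (at z) (1, 0)) (at (0, ?x)) (1, 0)"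
  have z: "(z has_vector_derivative z' t) (at t)" if "t \<in> ?T" for t
    using has_vector_derivative_partial[OF smooth_on_has_derivative[OF sG tS[OF that]]]
    by (simp add: z_def[abs_def] z'_def inv)
  have z2: "(z' has_vector_derivative z'') (at 0)"
    using has_vector_derivative_partial[OF smooth_on_has_derivative[OF smooth_on_frechet[OF sG] tS[OF 0]]]
    unfolding z'_def[abs_def] z''_def .
  have zc: "z t \<in> codom_chart d" "inv_coord d (z t) = \<phi> t y" if "t \<in> ?T" for t
    using ad(5,6)[OF \<delta>(3)[OF that]] by (auto simp: z_def)
  have vel: "vector_derivative (\<lambda>r. F (\<phi> r y)) (at t) = dF d (inv_coord d (z t)) (z' t)" if t: "t \<in> ?T" for t
  proof -
    let ?D = "dF d (\<phi> t y)"
    have D: "((\<lambda>x. F (inv_coord d x)) has_derivative ?D) (at (z t))"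
      unfolding z_def by (rule smooth_function_has_derivative[OF atlas smooth_F d(1) \<delta>(3)[OF t]])
    have "(z has_derivative (\<lambda>s. s *\<^sub>R z' t)) (at t)"
      using z[OF t] by (simp add: has_vector_derivative_def)
    from has_derivative_compose[OF this D]
    have "((\<lambda>s. F (inv_coord d (z s))) has_vector_derivative ?D (z' t)) (at t)"
      by (simp only: has_vector_derivative_def linear_scale[OF has_derivative_linear[OF D]])
    then have "((\<lambda>s. F (\<phi> s y)) has_vector_derivative ?D (z' t)) (at t)"
      by (rule has_vector_derivative_transform_within_open[OF _ open_greaterThanLessThan t]) (simp only: zc(2))
    then show ?thesis unfolding zc(2)[OF t] by (rule vector_derivative_at)
  qed
  have z0: "z 0 = coord d y" by (simp add: z_def \<phi>(3))
  have lin: "linear (dF d y)" by (rule linear_dF[OF d])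
  have V: "z' 0 = V"
  proof (rule dF_injective[OF d])
    have "dF d y (z' 0) = vector_derivative (\<lambda>r. F (\<phi> r y)) (at 0)" using vel[OF 0] by (simp add: z0 inv)
    then show "dF d y (z' 0) = dF d y V" using vector_derivative_at[OF X] by simp
  qed
  have "((\<lambda>t. dF d (inv_coord d (z t)) (z' t)) has_derivative
     (\<lambda>r. dF d y (r *\<^sub>R z'') + hess d y (r *\<^sub>R z' 0) (z' 0))) (at 0)"
  proof (rule dF_along_curve[where z = z and v = z' and s = 0 and T = ?T, OF d])
    show "(z has_derivative (\<lambda>r. r *\<^sub>R z' 0)) (at 0)" "(z' has_derivative (\<lambda>r. r *\<^sub>R z'')) (at 0)"
      using z[OF 0] z2 by (simp_all add: has_vector_derivative_def)
  qed (use z0 0 zc(1) in simp_all)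
  moreover have "(\<lambda>r. dF d y (r *\<^sub>R z'') + hess d y (r *\<^sub>R z' 0) (z' 0))
     = (\<lambda>r. r *\<^sub>R (dF d y z'' + hess d y V V))"
    by (simp add: V linear_scale[OF lin] bilinear_lmul[OF bilinear_hess[OF d]] scaleR_add_right)
  ultimately have "((\<lambda>t. dF d (inv_coord d (z t)) (z' t)) has_vector_derivative dF d y z'' + hess d y V V) (at 0)"
    by (simp only: has_vector_derivative_def)
  then have "((\<lambda>s. vector_derivative (\<lambda>r. F (\<phi> r y)) (at s)) has_vector_derivative dF d y z'' + hess d y V V) (at 0)"
    by (rule has_vector_derivative_transform_within_open[OF _ open_greaterThanLessThan 0]) (simp only: vel)
  from vector_derivative_at[OF this]
  have "vector_derivative (\<lambda>s. vector_derivative (\<lambda>r. F (\<phi> r y)) (at s)) (at 0) = dF d y z'' + hess d y V V" .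
  also have "\<dots> = sff d y V V + dF d y (z'' + lift d y (hess d y V V))"
    by (subst hess_decompose[OF d]) (simp add: linear_add[OF lin] add.assoc add.commute)
  finally show ?thesis by blast
qed

lemma frame_expansion:
  assumes "orthonormal_frame N d y f"
  shows "v = (\<Sum>k\<in>UNIV. metric N d y (f k) v *\<^sub>R f k)"
  unfolding metric_def by (rule orthonormal_frame_expansion[OF orthonormal_frame_gram[OF assms]])

text \<open>The lift of \<open>E\<close> is the sum of \<open>(E \<bullet> dF f\<^sub>k) f\<^sub>k\<close>, and by
  Parseval's identity in the ambient space the coefficients are orthonormal when \<open>E\<close> runs through the
  basis.\<close>

lemma trace_over_ambient_basis:
  assumes d: "d \<in> charts N" "y \<in> dom_chart d" and f: "orthonormal_frame N d y f" and S: "bilinear S"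
  shows "(\<Sum>E\<in>Basis. S (lift d y E) (lift d y E)) = (\<Sum>k\<in>UNIV. S (f k) (f k))"
proof -
  have l: "lift d y E = (\<Sum>k\<in>UNIV. (E \<bullet> dF d y (f k)) *\<^sub>R f k)" for E
  proof -
    have "metric N d y (f k) (lift d y E) = E \<bullet> dF d y (f k)" for k
      using dF_inner[OF d, of "f k" "lift d y E"] inner_lift[OF d, of E "f k"] by (simp add: inner_commute)
    then show ?thesis by (subst frame_expansion[OF f]) simp
  qed
  have Sl: "S (lift d y E) (lift d y E) =
      (\<Sum>k\<in>UNIV. \<Sum>l\<in>UNIV. ((E \<bullet> dF d y (f k)) * (E \<bullet> dF d y (f l))) *\<^sub>R S (f k) (f l))" for E
    unfolding l bilinear_sum[OF S]
    by (simp add: sum.cartesian_product bilinear_lmul[OF S] bilinear_rmul[OF S] mult.commute)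
  have "(\<Sum>E\<in>Basis. S (lift d y E) (lift d y E)) = (\<Sum>k\<in>UNIV. \<Sum>l\<in>UNIV. \<Sum>E\<in>Basis.
      ((E \<bullet> dF d y (f k)) * (E \<bullet> dF d y (f l))) *\<^sub>R S (f k) (f l))"
    unfolding Sl by (subst sum.swap) (intro sum.cong refl sum.swap)
  also have "\<dots> = (\<Sum>k\<in>UNIV. \<Sum>l\<in>UNIV. (dF d y (f k) \<bullet> dF d y (f l)) *\<^sub>R S (f k) (f l))"
    unfolding scaleR_sum_left[symmetric]
    by (subst euclidean_inner) (simp add: inner_commute)
  also have "\<dots> = (\<Sum>k\<in>UNIV. \<Sum>l\<in>UNIV. if k = l then S (f k) (f l) else 0)"
    using f by (intro sum.cong refl) (simp add: dF_inner[OF d] orthonormal_frame_def)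
  finally show ?thesis by simp
qed

text \<open>Pythagoras, with the tangential part expanded in the orthonormal vectors \<open>dF
  f\<^sub>k\<close>.\<close>

lemma norm_tangential_normal:
  assumes d: "d \<in> charts N" "y \<in> dom_chart d" and f: "orthonormal_frame N d y f"
    and \<nu>: "\<And>b. \<nu> \<bullet> dF d y b = 0" and \<eta>: "\<eta> = \<nu> + dF d y z"
  shows "\<eta> \<bullet> \<eta> = \<nu> \<bullet> \<nu> + (\<Sum>k\<in>UNIV. (\<eta> \<bullet> dF d y (f k))\<^sup>2)"
proof -
  have m: "\<eta> \<bullet> dF d y (f k) = metric N d y (f k) z" for k
    unfolding \<eta> inner_left_distrib \<nu> using dF_inner[OF d, of "f k" z] by (simp add: inner_commute)
  have "dF d y z \<bullet> dF d y z = metric N d y z z" by (rule dF_inner[OF d])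
  also have "\<dots> = metric N d y (\<Sum>k\<in>UNIV. metric N d y (f k) z *\<^sub>R f k) z"
    by (rule arg_cong[OF frame_expansion[OF f], of "\<lambda>v. metric N d y v z"])
  also have "\<dots> = (\<Sum>k\<in>UNIV. metric N d y (f k) z * metric N d y (f k) z)"
  proof -
    have lin: "linear (\<lambda>x. metric N d y x z)" using bilinear_metric[of N d y] unfolding bilinear_def by blast
    show ?thesis by (simp add: linear_sum[OF lin] linear_scale[OF lin])
  qed
  finally have "dF d y z \<bullet> dF d y z = (\<Sum>k\<in>UNIV. (\<eta> \<bullet> dF d y (f k))\<^sup>2)" by (simp add: m power2_eq_square)
  moreover have "\<eta> \<bullet> \<eta> = \<nu> \<bullet> \<nu> + dF d y z \<bullet> dF d y z"
    using \<nu>[of z] by (simp add: \<eta> inner_add inner_commute)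
  ultimately show ?thesis by (simp only:)
qed

end

section \<open>The averaged second variation\<close>

context isometrically_immersed
begin

text \<open>\<open>Z\<close> is the acceleration of \<open>\<phi>\<close>, and \<open>\<psi>\<close> moves along its
  tangential part. Subtracting the first derivative along \<open>\<psi>\<close> cancels the only term of the second
  derivative along \<open>\<phi>\<close> that depends on more than the velocity. The last two claims determine the
  tangential and the normal part of \<open>DX i\<close>, the derivative of the projected field.\<close>

lemma second_variation_along_projection:
  fixes M :: "('a::{t2_space, second_countable_topology}, 'm::finite) mfd" and u :: "'a \<Rightarrow> 'b"
  assumes RM: "riemannian_manifold M" and u: "smooth_map M N u" and c: "c \<in> charts M" "p \<in> dom_chart c"
    and e: "orthonormal_frame M c p e" and d: "d \<in> charts N" "u p \<in> dom_chart d"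
    and \<phi>: "smooth_family N N \<phi> \<epsilon>" "\<epsilon> > 0" "\<And>y. \<phi> 0 y = y"
      "\<And>y. ((\<lambda>t. F (\<phi> t y)) has_vector_derivative proj y E) (at 0)"
  defines "Z \<equiv> \<lambda>y. vector_derivative (\<lambda>s. vector_derivative (\<lambda>r. F (\<phi> r y)) (at s)) (at 0)"
  assumes \<psi>: "smooth_family N N \<psi> \<delta>" "\<delta> > 0" "\<And>y. \<psi> 0 y = y"
      "\<And>y. ((\<lambda>t. F (\<psi> t y)) has_vector_derivative proj y (Z y)) (at 0)"
  defines "a \<equiv> \<lambda>i. differential c d u p (e i)"
  assumes diag: "\<And>i j. i \<noteq> j \<Longrightarrow> metric N d (u p) (a i) (a j) = 0"
  defines "V \<equiv> lift d (u p) E"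
  defines "DX \<equiv> \<lambda>i. differential_euclidean d (\<lambda>y. proj y E) (u p) (a i)"
  shows "vector_derivative (\<lambda>s. vector_derivative (\<lambda>r. d3_norm_sq M N (\<lambda>p. \<phi> r (u p)) p) (at s)) (at 0)
      - vector_derivative (\<lambda>r. d3_norm_sq M N (\<lambda>p. \<psi> r (u p)) p) (at 0)
    = 6 * (\<Sum>i\<in>UNIV. (metric N d (u p) (a i) (a i))\<^sup>2 * (DX i \<bullet> DX i - sff d (u p) V V \<bullet> sff d (u p) (a i) (a i)))
      + 24 * (\<Sum>i\<in>UNIV. \<Sum>j\<in>UNIV. metric N d (u p) (a i) (a i) * (E \<bullet> sff d (u p) (a i) (a j))\<^sup>2)"
    "\<exists>z. DX i = sff d (u p) (a i) V + dF d (u p) z" "DX i \<bullet> dF d (u p) b = E \<bullet> sff d (u p) (a i) b"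
proof -
  note AM = riemannian_manifoldD(1)[OF RM]
  let ?y = "u p"
  define X where "X y = proj y E" for y
  define T where "T y = proj y (Z y)" for y
  have const: "smooth_function N (\<lambda>y. E)" by (simp add: smooth_function_def smooth_on_const)
  have sX: "smooth_function N X" unfolding X_def by (rule smooth_proj[OF const])
  have e\<phi>: "smooth_evolution N (\<lambda>t y. F (\<phi> t y)) \<epsilon>" by (rule smooth_evolution_compose[OF atlas atlas \<phi>(1) smooth_F])
  have sZ: "smooth_function N Z"
    unfolding Z_def
    by (rule smooth_evolution_at[OF atlas smooth_evolution_time_derivative[OF atlas smooth_evolution_time_derivative[OF atlas e\<phi>]]])
      (use \<phi>(2) in simp)
  have sT: "smooth_function N T" unfolding T_def by (rule smooth_proj[OF sZ])
  have chain: "differential_euclidean c (\<lambda>p. f (u p)) p (e i) = differential_euclidean d f ?y (a i)"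
    if "smooth_function N f" for f :: "'b \<Rightarrow> real ^ 'q" and i
    unfolding a_def by (rule differential_euclidean_compose(2)[OF AM atlas u that c d])
  have normal_X: "X ?y \<bullet> sff d ?y v w = 0" "T ?y \<bullet> sff d ?y v w = 0" for v w
    by (subst inner_commute, simp add: X_def T_def proj_eq[OF d] sff_normal[OF d])+
  have DX_dF: "DX i \<bullet> dF d ?y b = E \<bullet> sff d ?y (a i) b" for i b
  proof -
    have "differential_euclidean d (\<lambda>y. E) ?y v = 0" for v
      using frechet_derivative_at[OF has_derivative_const[of E "at (coord d ?y)"]]
      by (simp add: differential_euclidean_def o_def)
    then show ?thesis
      using proj_derivative_tangential[OF const d, of "a i" b] normal_X(1)
      by (simp add: DX_def X_def inner_diff_left)
  qed
  then show "DX i \<bullet> dF d ?y b = E \<bullet> sff d ?y (a i) b" .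
  show "\<exists>z. DX i = sff d (u p) (a i) V + dF d (u p) z"
    unfolding DX_def V_def by (rule proj_derivative_normal[OF const d])
  have energy: "smooth_evolution M (\<lambda>t p. F (\<chi>' t (u p))) \<epsilon>'"
    "\<And>t. t \<in> {-\<epsilon>'<..<\<epsilon>'} \<Longrightarrow> d3_norm_sq M N (\<lambda>p. \<chi>' t (u p)) p = energy_density M c (\<lambda>p. F (\<chi>' t (u p))) p"
    if \<chi>': "smooth_family N N \<chi>' \<epsilon>'" for \<chi>' \<epsilon>'
  proof -
    have fam: "smooth_family M N (\<lambda>t p. \<chi>' t (u p)) \<epsilon>'"
      by (rule smooth_family_compose[OF AM atlas atlas smooth_family_constant[OF AM atlas u] \<chi>'])
    show "smooth_evolution M (\<lambda>t p. F (\<chi>' t (u p))) \<epsilon>'" by (rule smooth_evolution_compose[OF AM atlas fam smooth_F])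
    show "d3_norm_sq M N (\<lambda>p. \<chi>' t (u p)) p = energy_density M c (\<lambda>p. F (\<chi>' t (u p))) p"
      if "t \<in> {-\<epsilon>'<..<\<epsilon>'}" for t
      by (rule d3_norm_sq_eq_energy_density[OF RM riem iso smooth_family_at[OF AM atlas fam that] c])
  qed
  have X_vel: "(\<lambda>p. vector_derivative (\<lambda>s. F (\<phi> s (u p))) (at 0)) = (\<lambda>p. X (u p))"
    using vector_derivative_at[OF \<phi>(4)] by (simp add: X_def)
  have T_vel: "(\<lambda>p. vector_derivative (\<lambda>s. F (\<psi> s (u p))) (at 0)) = (\<lambda>p. T (u p))"
    using vector_derivative_at[OF \<psi>(4)] by (simp add: T_def)
  define s where "s i = metric N d ?y (a i) (a i)" for i
  have bb: "dF d ?y (a i) \<bullet> dF d ?y (a j) = metric N d ?y (a i) (a j)" for i j by (rule dF_inner[OF d])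
  have b\<phi>: "differential_euclidean c (\<lambda>p. F (\<phi> 0 (u p))) p (e i) = dF d ?y (a i)" for i
    unfolding \<phi>(3) by (rule chain[OF smooth_F])
  have b\<psi>: "differential_euclidean c (\<lambda>p. F (\<psi> 0 (u p))) p (e i) = dF d ?y (a i)" for i
    unfolding \<psi>(3) by (rule chain[OF smooth_F])
  have b'\<phi>: "differential_euclidean c (\<lambda>p. vector_derivative (\<lambda>s. F (\<phi> s (u p))) (at 0)) p (e i) = DX i" for i
    unfolding X_vel chain[OF sX] by (simp add: DX_def X_def[abs_def])
  have b'\<psi>: "differential_euclidean c (\<lambda>p. vector_derivative (\<lambda>s. F (\<psi> s (u p))) (at 0)) p (e i)
      = differential_euclidean d T ?y (a i)" for i
    unfolding T_vel by (rule chain[OF sT])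
  have b''\<phi>: "differential_euclidean c (\<lambda>p. vector_derivative (\<lambda>s. vector_derivative (\<lambda>r. F (\<phi> r (u p))) (at s)) (at 0)) p (e i)
      = differential_euclidean d Z ?y (a i)" for i
    using chain[OF sZ] by (simp add: Z_def)
  have "vector_derivative (\<lambda>s. vector_derivative (\<lambda>r. d3_norm_sq M N (\<lambda>p. \<phi> r (u p)) p) (at s)) (at 0)
    = 6 * (\<Sum>i\<in>UNIV. (dF d ?y (a i) \<bullet> dF d ?y (a i))\<^sup>2 * (differential_euclidean d Z ?y (a i) \<bullet> dF d ?y (a i) + DX i \<bullet> DX i))
      + 6 * (\<Sum>i\<in>UNIV. \<Sum>j\<in>UNIV. (dF d ?y (a i) \<bullet> dF d ?y (a i)) * (DX i \<bullet> dF d ?y (a j) + dF d ?y (a i) \<bullet> DX j)\<^sup>2)"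
    using energy_density_derivatives(2)[OF AM energy(1)[OF \<phi>(1)] \<phi>(2) c energy(2)[OF \<phi>(1)] e]
    unfolding b\<phi> b'\<phi> b''\<phi> bb using diag by blast
  moreover have "vector_derivative (\<lambda>r. d3_norm_sq M N (\<lambda>p. \<psi> r (u p)) p) (at 0)
    = 6 * (\<Sum>i\<in>UNIV. (dF d ?y (a i) \<bullet> dF d ?y (a i))\<^sup>2 * (differential_euclidean d T ?y (a i) \<bullet> dF d ?y (a i)))"
    using energy_density_derivatives(1)[OF AM energy(1)[OF \<psi>(1)] \<psi>(2) c energy(2)[OF \<psi>(1)] e]
    unfolding b\<psi> b'\<psi> bb using diag by blast
  moreover have "differential_euclidean d Z ?y (a i) \<bullet> dF d ?y (a i)
     = differential_euclidean d T ?y (a i) \<bullet> dF d ?y (a i) - sff d ?y V V \<bullet> sff d ?y (a i) (a i)" for i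
  proof -
    have "((\<lambda>t. F (\<phi> t ?y)) has_vector_derivative dF d ?y V) (at 0)"
      using \<phi>(4)[of ?y] by (simp add: V_def proj_eq[OF d])
    from acceleration_normal[OF \<phi>(1-3) d this] obtain z where z: "Z ?y = sff d ?y V V + dF d ?y z"
      unfolding Z_def by blast
    have "(Z ?y - T ?y) \<bullet> sff d ?y (a i) (a i) = sff d ?y V V \<bullet> sff d ?y (a i) (a i)"
    proof -
      have "dF d ?y z \<bullet> sff d ?y (a i) (a i) = 0" by (subst inner_commute) (rule sff_normal[OF d])
      then show ?thesis by (simp add: z inner_diff_left inner_left_distrib normal_X(2))
    qed
    then show ?thesis
      using proj_derivative_tangential[OF sZ d, of "a i" "a i"] by (simp add: T_def[abs_def])
  qed
  moreover have "dF d ?y (a i) \<bullet> DX j = DX i \<bullet> dF d ?y (a j)" for i j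
    using DX_dF[of i "a j"] DX_dF[of j "a i"] sff_symmetric[OF d] by (simp add: inner_commute)
  ultimately show "vector_derivative (\<lambda>s. vector_derivative (\<lambda>r. d3_norm_sq M N (\<lambda>p. \<phi> r (u p)) p) (at s)) (at 0)
      - vector_derivative (\<lambda>r. d3_norm_sq M N (\<lambda>p. \<psi> r (u p)) p) (at 0)
    = 6 * (\<Sum>i\<in>UNIV. (metric N d ?y (a i) (a i))\<^sup>2 * (DX i \<bullet> DX i - sff d ?y V V \<bullet> sff d ?y (a i) (a i)))
      + 24 * (\<Sum>i\<in>UNIV. \<Sum>j\<in>UNIV. metric N d ?y (a i) (a i) * (E \<bullet> sff d ?y (a i) (a j))\<^sup>2)"
    by (simp add: bb DX_dF sum_distrib_left power2_eq_square algebra_simps sum_subtractf sum.distrib)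
qed

text \<open>By Pythagoras the squared derivative of the projected field consists of a normal and a tangential part,
  and each contributes \<open>\<Sum>\<^sub>k |B(a\<^sub>i, f\<^sub>k)|\<^sup>2\<close> when summed over the ambient
  basis.\<close>

lemma averaged_variation_formula:
  assumes d: "d \<in> charts N" "y \<in> dom_chart d" and f: "orthonormal_frame N d y f"
    and DX: "\<And>E i. \<exists>z. DX E i = sff d y (a i) (lift d y E) + dF d y z"
      "\<And>E i b. DX E i \<bullet> dF d y b = E \<bullet> sff d y (a i) b"
  shows "(\<Sum>E\<in>Basis. 6 * (\<Sum>i\<in>UNIV. (s i)\<^sup>2 *
        (DX E i \<bullet> DX E i - sff d y (lift d y E) (lift d y E) \<bullet> sff d y (a i) (a i)))
      + 24 * (\<Sum>i\<in>UNIV. \<Sum>j\<in>UNIV. s i * (E \<bullet> sff d y (a i) (a j))\<^sup>2))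
    = 6 * ((\<Sum>i\<in>UNIV. (s i)\<^sup>2 * (2 * (\<Sum>k\<in>UNIV. (norm (sff d y (a i) (f k)))\<^sup>2)
          - (\<Sum>k\<in>UNIV. sff d y (f k) (f k)) \<bullet> sff d y (a i) (a i)))
      + 4 * (\<Sum>i\<in>UNIV. \<Sum>j\<in>UNIV. s i * (norm (sff d y (a i) (a j)))\<^sup>2))"
proof -
  let ?B = "sff d y"
  have nb: "(\<Sum>E\<in>Basis. (E \<bullet> v)\<^sup>2) = (norm v)\<^sup>2" for v :: "real ^ 'q"
    unfolding power2_norm_eq_inner using euclidean_inner[of v v] by (simp add: power2_eq_square inner_commute)
  have lB: "linear (?B v)" for v using bilinear_sff[OF d] by (simp add: bilinear_def)
  have bil: "bilinear (\<lambda>v w. ?B x v \<bullet> ?B x w)" for x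
    unfolding bilinear_def
    by (auto intro!: linearI simp: linear_add[OF lB] linear_scale[OF lB] inner_left_distrib inner_right_distrib)
  have DXn: "DX E i \<bullet> DX E i = ?B (a i) (lift d y E) \<bullet> ?B (a i) (lift d y E) + (\<Sum>k\<in>UNIV. (E \<bullet> ?B (a i) (f k))\<^sup>2)" for E i
  proof -
    obtain z where "DX E i = ?B (a i) (lift d y E) + dF d y z" using DX(1) by blast
    from norm_tangential_normal[OF d f sff_normal[OF d] this] show ?thesis by (simp add: DX(2))
  qed
  have 1: "(\<Sum>E\<in>Basis. DX E i \<bullet> DX E i) = 2 * (\<Sum>k\<in>UNIV. (norm (?B (a i) (f k)))\<^sup>2)" for i
  proof -
    have "(\<Sum>E\<in>Basis. \<Sum>k\<in>UNIV. (E \<bullet> ?B (a i) (f k))\<^sup>2) = (\<Sum>k\<in>UNIV. (norm (?B (a i) (f k)))\<^sup>2)"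
      unfolding nb[symmetric] by (rule sum.swap)
    then show ?thesis
      unfolding DXn sum.distrib trace_over_ambient_basis[OF d f bil] by (simp add: power2_norm_eq_inner)
  qed
  have 2: "(\<Sum>E\<in>Basis. ?B (lift d y E) (lift d y E) \<bullet> v) = (\<Sum>k\<in>UNIV. ?B (f k) (f k)) \<bullet> v" for v
    unfolding inner_sum_left[symmetric] trace_over_ambient_basis[OF d f bilinear_sff[OF d]] ..
  have "(\<Sum>E\<in>Basis. \<Sum>i\<in>UNIV. (s i)\<^sup>2 * (DX E i \<bullet> DX E i - ?B (lift d y E) (lift d y E) \<bullet> ?B (a i) (a i)))
    = (\<Sum>i\<in>UNIV. (s i)\<^sup>2 * (2 * (\<Sum>k\<in>UNIV. (norm (?B (a i) (f k)))\<^sup>2) - (\<Sum>k\<in>UNIV. ?B (f k) (f k)) \<bullet> ?B (a i) (a i)))"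
    by (subst sum.swap) (simp only: sum_distrib_left[symmetric] sum_subtractf 1 2)
  moreover have "(\<Sum>E\<in>Basis. \<Sum>i\<in>UNIV. \<Sum>j\<in>UNIV. s i * (E \<bullet> ?B (a i) (a j))\<^sup>2)
    = (\<Sum>i\<in>UNIV. \<Sum>j\<in>UNIV. s i * (norm (?B (a i) (a j)))\<^sup>2)"
  proof -
    have "(\<Sum>E\<in>Basis. \<Sum>i\<in>UNIV. \<Sum>j\<in>UNIV. s i * (E \<bullet> ?B (a i) (a j))\<^sup>2)
      = (\<Sum>i\<in>UNIV. \<Sum>j\<in>UNIV. \<Sum>E\<in>Basis. s i * (E \<bullet> ?B (a i) (a j))\<^sup>2)"
      by (subst sum.swap) (intro sum.cong refl sum.swap)
    then show ?thesis by (simp only: sum_distrib_left[symmetric] nb)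
  qed
  ultimately show ?thesis by (simp only: sum.distrib sum_distrib_left[symmetric]) simp
qed

end

text \<open>On a coordinate ball the derivative of the coordinate expression vanishes, so \<open>u\<close> is locally
  constant.\<close>

lemma constant_if_differential_zero:
  fixes M :: "('a::{t2_space, second_countable_topology}, 'm::finite) mfd"
    and N :: "('b::{t2_space, second_countable_topology}, 'n::finite) mfd"
  assumes A: "smooth_atlas (charts M)" "smooth_atlas (charts N)" and con: "connected (UNIV :: 'a set)"
    and u: "smooth_map M N u"
    and zero: "\<And>c d p v. c \<in> charts M \<Longrightarrow> p \<in> dom_chart c \<Longrightarrow> d \<in> charts N \<Longrightarrow> u p \<in> dom_chart d \<Longrightarrow>
      differential c d u p v = 0"
  shows "u constant_on UNIV"
proof (rule locally_constant_imp_constant[OF con])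
  fix p :: 'a
  obtain c where c: "c \<in> charts M" "p \<in> dom_chart c" using atlas_cover[OF A(1)] .
  obtain d where d: "d \<in> charts N" "u p \<in> dom_chart d" using atlas_cover[OF A(2)] .
  note ac = atlas_chart[OF A(1) c(1)] and ad = atlas_chart[OF A(2) d(1)]
  have cu: "continuous_on UNIV u" using u by (simp add: smooth_map_def)
  define S where "S = {x \<in> codom_chart c. u (inv_coord c x) \<in> dom_chart d}"
  have oS: "open S" unfolding S_def
    by (intro open_preimage_within ac ad continuous_on_compose2[OF cu ac(4)]) auto
  have "coord c p \<in> S" using c d ac(5,6) by (simp add: S_def)
  then obtain r where r: "r > 0" "ball (coord c p) r \<subseteq> S" using oS openE by blast
  let ?f = "\<lambda>x. coord d (u (inv_coord c x))"
  have der: "(?f has_derivative (\<lambda>v. 0)) (at x)" if x: "x \<in> S" for x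
  proof -
    have q: "inv_coord c x \<in> dom_chart c" "u (inv_coord c x) \<in> dom_chart d" "coord c (inv_coord c x) = x"
      using x ac(7,8) by (auto simp: S_def)
    have "?f differentiable (at x)"
      using smooth_map_differentiable[OF A(1) u c(1) q(1) d(1) q(2)] unfolding q(3) .
    then have "(?f has_derivative differential c d u (inv_coord c x)) (at x)"
      unfolding frechet_derivative_works differential_def o_def q(3) .
    moreover have "differential c d u (inv_coord c x) = (\<lambda>v. 0)"
      using zero[OF c(1) q(1) d(1) q(2)] by blast
    ultimately show ?thesis by simp
  qed
  have const: "?f x = ?f (coord c p)" if "x \<in> ball (coord c p) r" for x
  proof (rule has_derivative_zero_unique[where f = ?f, OF convex_ball])
    show "(?f has_derivative (\<lambda>h. 0)) (at z within ball (coord c p) r)" if "z \<in> ball (coord c p) r" for z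
      using der that r(2) by (blast intro: has_derivative_at_withinI)
  qed (use that r(1) in auto)
  let ?T = "{q \<in> dom_chart c. coord c q \<in> ball (coord c p) r}"
  have "open ?T" by (intro open_preimage_within ac open_ball)
  moreover have "p \<in> ?T" using c r by simp
  moreover have "u q = u p" if q: "q \<in> ?T" for q
  proof -
    have qS: "coord c q \<in> S" using q r(2) by blast
    have "u q \<in> dom_chart d" using qS ac(5) q by (auto simp: S_def)
    moreover have "coord d (u q) = coord d (u p)" using const[of "coord c q"] q ac(5) c(2) by simp
    ultimately have "u q \<in> dom_chart d" "coord d (u q) = coord d (u p)" by blast+
    from ad(5)[OF this(1)] this(2) ad(5)[OF d(2)] show ?thesis by simp
  qed
  ultimately show "\<exists>T. openin (top_of_set UNIV) T \<and> p \<in> T \<and> (\<forall>q\<in>T. u q = u p)"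
    unfolding subtopology_UNIV open_openin[symmetric] by blast
qed

theorem theorem7p1:
  fixes M :: "('a::{t2_space, second_countable_topology}, 'm::finite) mfd"
    and N :: "('b::{t2_space, second_countable_topology}, 'n::finite) mfd"
    and u :: "'a \<Rightarrow> 'b"
  assumes "riemannian_manifold N" and "compact (UNIV :: 'b set)" and "phi3_SSU TYPE('q::finite) N"
    and "riemannian_manifold M" and "compact (UNIV :: 'a set)"
    and "stable_phi3_harmonic M N u"
  shows "u constant_on UNIV"
proof (rule ccontr)
  assume nc: "\<not> u constant_on UNIV"
  note RN = assms(1) and cN = assms(2) and RM = assms(4) and cM = assms(5) and st = assms(6)
  obtain F :: "'b \<Rightarrow> real ^ 'q" where iso: "isometric_immersion N F" and
    ssu: "\<And>d y v e. d \<in> charts N \<Longrightarrow> y \<in> dom_chart d \<Longrightarrow> metric N d y v v = 1 \<Longrightarrow> orthonormal_frame N d y e \<Longrightarrow>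
       (\<Sum>i\<in>UNIV. 6 * (second_fundamental_form d F y v (e i) \<bullet> second_fundamental_form d F y v (e i))
         - second_fundamental_form d F y v v \<bullet> second_fundamental_form d F y (e i) (e i)) < 0"
    using assms(3) unfolding phi3_SSU_def Let_def by blast
  interpret isometrically_immersed N F by unfold_locales (rule RN, rule iso)
  note AM = riemannian_manifoldD(1)[OF RM]
  have u: "smooth_map M N u" using st by (simp add: stable_phi3_harmonic_def phi3_harmonic_def)
  have const: "smooth_function N (\<lambda>y. E)" for E :: "real ^ 'q" by (simp add: smooth_function_def smooth_on_const)
  have "\<forall>E. \<exists>\<phi> \<epsilon>. \<epsilon> > 0 \<and> smooth_family N N \<phi> \<epsilon> \<and> (\<forall>y. \<phi> 0 y = y) \<and>
      (\<forall>y. ((\<lambda>t. F (\<phi> t y)) has_vector_derivative proj y E) (at 0))"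
    using ex_tangential_family[OF cN const] by blast
  from choice[OF this] obtain \<phi> where "\<forall>E. \<exists>\<epsilon>. \<epsilon> > 0 \<and> smooth_family N N (\<phi> E) \<epsilon> \<and> (\<forall>y. \<phi> E 0 y = y) \<and>
      (\<forall>y. ((\<lambda>t. F (\<phi> E t y)) has_vector_derivative proj y E) (at 0))" ..
  from choice[OF this] obtain \<epsilon> where \<phi>: "\<And>E. \<epsilon> E > 0" "\<And>E. smooth_family N N (\<phi> E) (\<epsilon> E)" "\<And>E y. \<phi> E 0 y = y"
      "\<And>E y. ((\<lambda>t. F (\<phi> E t y)) has_vector_derivative proj y E) (at 0)" by blast
  define Z where "Z E y = vector_derivative (\<lambda>s. vector_derivative (\<lambda>r. F (\<phi> E r y)) (at s)) (at 0)" for E y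
  have sZ: "smooth_function N (Z E)" for E
    unfolding Z_def
    by (rule smooth_evolution_at[OF atlas smooth_evolution_time_derivative[OF atlas
            smooth_evolution_time_derivative[OF atlas smooth_evolution_compose[OF atlas atlas \<phi>(2) smooth_F]]]])
      (use \<phi>(1) in simp)
  have "\<forall>E. \<exists>\<psi> \<delta>. \<delta> > 0 \<and> smooth_family N N \<psi> \<delta> \<and> (\<forall>y. \<psi> 0 y = y) \<and>
      (\<forall>y. ((\<lambda>t. F (\<psi> t y)) has_vector_derivative proj y (Z E y)) (at 0))"
    using ex_tangential_family[OF cN sZ] by blast
  from choice[OF this] obtain \<psi> where "\<forall>E. \<exists>\<delta>. \<delta> > 0 \<and> smooth_family N N (\<psi> E) \<delta> \<and> (\<forall>y. \<psi> E 0 y = y) \<and>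
      (\<forall>y. ((\<lambda>t. F (\<psi> E t y)) has_vector_derivative proj y (Z E y)) (at 0))" ..
  from choice[OF this] obtain \<delta> where \<psi>: "\<And>E. \<delta> E > 0" "\<And>E. smooth_family N N (\<psi> E) (\<delta> E)" "\<And>E y. \<psi> E 0 y = y"
      "\<And>E y. ((\<lambda>t. F (\<psi> E t y)) has_vector_derivative proj y (Z E y)) (at 0)" by blast
  \<comment> \<open>The second derivative of the density along the projection of \<open>E\<close>, and its first derivative along
    the tangential part of the acceleration. The latter has integral 0.\<close>
  define D2 where "D2 E p = vector_derivative (\<lambda>s. vector_derivative (\<lambda>r. d3_norm_sq M N (\<lambda>p. \<phi> E r (u p)) p) (at s)) (at 0)" for E p
  define D1 where "D1 E p = vector_derivative (\<lambda>r. d3_norm_sq M N (\<lambda>p. \<psi> E r (u p)) p) (at 0)" for E p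
  have fam\<phi>: "smooth_family M N (\<lambda>t p. \<phi> E t (u p)) (\<epsilon> E)" for E
    by (rule smooth_family_compose[OF AM atlas atlas smooth_family_constant[OF AM atlas u] \<phi>(2)])
  have fam\<psi>: "smooth_family M N (\<lambda>t p. \<psi> E t (u p)) (\<delta> E)" for E
    by (rule smooth_family_compose[OF AM atlas atlas smooth_family_constant[OF AM atlas u] \<psi>(2)])
  let ?\<mu> = "volume_measure M"
  have D2: "(\<integral>p. D2 E p \<partial>?\<mu>) \<ge> 0" "continuous_on UNIV (D2 E)" for E
    using stable_family_derivatives(2,4)[OF RM RN cM iso st fam\<phi>[of E] \<phi>(1)] \<phi>(3) by (simp_all add: D2_def[abs_def])
  have D1: "(\<integral>p. D1 E p \<partial>?\<mu>) = 0" "continuous_on UNIV (D1 E)" for E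
    using stable_family_derivatives(1,3)[OF RM RN cM iso st fam\<psi>[of E] \<psi>(1)] \<psi>(3) by (simp_all add: D1_def[abs_def])
  define Q where "Q p = (\<Sum>E\<in>Basis. D2 E p - D1 E p)" for p
  have cQ: "continuous_on UNIV Q"
    unfolding Q_def by (intro continuous_on_sum continuous_on_diff D1 D2)
  have iQ: "integrable ?\<mu> Q" by (rule compact_manifold_integrable[OF RM cM cQ])
  have "(\<integral>p. Q p \<partial>?\<mu>) = (\<Sum>E\<in>Basis. (\<integral>p. D2 E p \<partial>?\<mu>) - (\<integral>p. D1 E p \<partial>?\<mu>))"
    unfolding Q_def
    by (subst Bochner_Integration.integral_sum)
      (simp_all add: compact_manifold_integrable[OF RM cM D2(2)] compact_manifold_integrable[OF RM cM D1(2)])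
  then have Q_int: "(\<integral>p. Q p \<partial>?\<mu>) \<ge> 0" by (simp add: D1(1) D2(1) sum_nonneg)
  have Q_sign: "Q p \<le> 0 \<and> (differential c d u p v \<noteq> 0 \<longrightarrow> Q p < 0)"
    if c: "c \<in> charts M" "p \<in> dom_chart c" and d: "d \<in> charts N" "u p \<in> dom_chart d" for c d p v
  proof -
    let ?du = "differential c d u p" and ?h = "metric N d (u p)" and ?B = "second_fundamental_form d F (u p)"
    have "(\<lambda>x. coord d (u (inv_coord c x))) differentiable (at (coord c p))"
      by (rule smooth_map_differentiable[OF AM u c d])
    then have "((\<lambda>x. coord d (u (inv_coord c x))) has_derivative ?du) (at (coord c p))"
      unfolding frechet_derivative_works differential_def o_def .
    then have lin: "linear ?du" by (rule has_derivative_linear)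
    have bil: "bilinear (\<lambda>v w. ?h (?du v) (?du w))"
      using bilinear_metric[of N d "u p"] linear_compose[OF lin] unfolding bilinear_def o_def by blast
    \<comment> \<open>A frame in which the pullback of the metric of \<open>N\<close> is diagonal.\<close>
    obtain e where e: "orthonormal_frame M c p e" and diag: "\<And>i j. i \<noteq> j \<Longrightarrow> ?h (?du (e i)) (?du (e j)) = 0"
      using ex_diagonalising_frame[OF RM c bil riemannian_manifoldD(3)[OF RN d]] by blast
    obtain f where f: "orthonormal_frame N d (u p) f" using ex_orthonormal_frame[OF RN d] .
    let ?a = "\<lambda>i. ?du (e i)"
    note var = second_variation_along_projection[OF RM u c e d \<phi>(2,1,3,4)
        \<psi>(2,1,3,4)[unfolded Z_def] diag]
    let ?q = "(\<Sum>i\<in>UNIV. (?h (?a i) (?a i))\<^sup>2 * (2 * (\<Sum>k\<in>UNIV. (norm (?B (?a i) (f k)))\<^sup>2)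
          - (\<Sum>k\<in>UNIV. ?B (f k) (f k)) \<bullet> ?B (?a i) (?a i)))
      + 4 * (\<Sum>i\<in>UNIV. \<Sum>j\<in>UNIV. ?h (?a i) (?a i) * (norm (?B (?a i) (?a j)))\<^sup>2)"
    have Qq: "Q p = 6 * ?q"
      unfolding Q_def D1_def D2_def
      by (rule trans[OF sum.cong[OF refl var(1)] averaged_variation_formula[OF d f var(2,3)]])
    note avg = averaged_second_variation_negative[where a = ?a, OF bilinear_metric riemannian_manifoldD(3)[OF RN d]
        riemannian_manifoldD(4)[OF RN d] f[unfolded orthonormal_frame_def, rule_format] frame_expansion[OF f]
        bilinear_sff[OF d] sff_symmetric[OF d] ssu[OF d _ f] diag]
    have "Q p \<le> 0" unfolding Qq by (rule mult_nonneg_nonpos[OF _ avg(1)]) simp_all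
    moreover have "Q p < 0" if "?a i \<noteq> 0" for i
      unfolding Qq by (rule mult_pos_neg[OF _ avg(2)[OF _ _ _ that]]) simp_all
    moreover have "\<exists>i. ?a i \<noteq> 0" if "?du v \<noteq> 0"
    proof (rule ccontr)
      assume "\<nexists>i. ?a i \<noteq> 0"
      then have "?du (\<Sum>k\<in>UNIV. metric M c p (e k) v *\<^sub>R e k) = 0"
        by (simp add: linear_sum[OF lin] linear_scale[OF lin])
      moreover have "(\<Sum>k\<in>UNIV. metric M c p (e k) v *\<^sub>R e k) = v"
        unfolding metric_def by (rule orthonormal_frame_expansion[OF orthonormal_frame_gram[OF e], symmetric])
      ultimately show False using that by simp
    qed
    ultimately show ?thesis by blast
  qed
  have Q_le: "Q p \<le> 0" for p
  proof -
    obtain c where c: "c \<in> charts M" "p \<in> dom_chart c" using atlas_cover[OF AM] .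
    obtain d where d: "d \<in> charts N" "u p \<in> dom_chart d" using atlas_cover[OF atlas] .
    show ?thesis using Q_sign[OF c d] by blast
  qed
  have "connected (UNIV :: 'a set)" using RM by (simp add: riemannian_manifold_def)
  from constant_if_differential_zero[OF AM atlas this u] nc Q_sign
  obtain p0 where p0: "Q p0 < 0" by metis
  have "open {p. Q p < 0}" by (intro open_Collect_less cQ continuous_on_const)
  then have pos: "emeasure ?\<mu> {p. Q p < 0} > 0" using p0 by (intro volume_measure_finite_positive(4)[OF RM cM]) auto
  have "(\<integral>p. - Q p \<partial>?\<mu>) = 0"
  proof (rule antisym)
    show "(\<integral>p. - Q p \<partial>?\<mu>) \<le> 0" using Q_int by simp
    show "(\<integral>p. - Q p \<partial>?\<mu>) \<ge> 0" by (rule integral_nonneg_AE) (simp add: Q_le)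
  qed
  then have "AE p in ?\<mu>. - Q p = 0"
    by (subst integral_nonneg_eq_0_iff_AE[symmetric]) (use iQ Q_le in auto)
  then have "AE p in ?\<mu>. p \<notin> {p. Q p < 0}" by (rule AE_mp) auto
  moreover have "{p. Q p < 0} \<in> sets ?\<mu>"
    using \<open>open {p. Q p < 0}\<close> volume_measure_finite_positive(1)[OF RM cM] by simp
  ultimately have "emeasure ?\<mu> {p. Q p < 0} = 0"
    using AE_iff_measurable[of "{p. Q p < 0}" ?\<mu> "\<lambda>p. p \<notin> {p. Q p < 0}"] volume_measure_finite_positive(2)[OF RM cM] by simp
  with pos show False by simp
qed

end
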